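(* For each integer $n\ge 2$, $$d_{SK}(OH_n)\ \ge\ \left[\frac{n}{2\sqrt{n-1}}\right]^{1/2}.$$
   Context: An operator space is a closed subspace $E\subset B(H)$, $H$ a complex Hilbert space, with the norms on $M_n(E)$ induced by $B(\ell_2^n(H))$. For linear $u:E\to F$, $\|u\|_{cb}=\sup_{n\ge1}\|I_{M_n}\otimes u\|_{M_n(E)\to M_n(F)}$. For operator spaces $E,F$, $d_{cb}(E,F)=\inf\{\|u\|_{cb}\|u^{-1}\|_{cb}\}$ over all isomorphisms $u:E\to F$ ($=\infty$ if there is no complete isomorphism). Let $K=K(\ell_2)$ be the space of compact operators on $\ell_2$, and $$d_{SK}(E)=\inf\{d_{cb}(E,F)\mid F\subset K\text{ a closed subspace}\};$$ for finite dimensional $E$ this equals $\inf\{d_{cb}(E,F)\mid F\subset M_k,\ k\ge1\}$. $OH_n$ denotes the $n$-dimensional operator Hilbert space: it is isometric to $\ell_2^n$ and has an orthonormal basis $(\theta_i)_{i\le n}$ such that for all $a_1,\dots,a_n\in B=B(\ell_2)$, $$\Big\|\sum_{i=1}^n\theta_i\otimes a_i\Big\|_{OH_n\otimes_{\min}B}=\Big\|\sum_{i=1}^n a_i\otimes\bar a_i\Big\|_{B\otimes_{\min}\overline{B}}^{1/2},$$ where $\overline{B}$ is the complex conjugate $C^*$-algebra of $B$ and $\otimes_{\min}$ is the minimal (spatial) tensor product. This determines $OH_n$ up to complete isometry. *)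

theory Defs
  imports "HOL-Analysis.Analysis"
begin

section \<open>Complex Hilbert spaces\<close>

text \<open>
  The inner product is antilinear in the first argument. Norm, metric and topology are those
  of the underlying real Hilbert space, whose inner product is the real part of the complex one.
\<close>

class complex_hilbert = real_inner + complete_space +
  fixes scaleC :: "complex \<Rightarrow> 'a \<Rightarrow> 'a" (infixr "*\<^sub>C" 75)
    and cinner :: "'a \<Rightarrow> 'a \<Rightarrow> complex"
  assumes scaleC_add_right: "c *\<^sub>C (x + y) = c *\<^sub>C x + c *\<^sub>C y"
    and scaleC_add_left: "(c + d) *\<^sub>C x = c *\<^sub>C x + d *\<^sub>C x"
    and scaleC_scaleC: "c *\<^sub>C d *\<^sub>C x = (c * d) *\<^sub>C x"
    and scaleC_of_real: "complex_of_real r *\<^sub>C x = r *\<^sub>R x"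
    and cinner_commute: "cinner x y = cnj (cinner y x)"
    and cinner_add_right: "cinner x (y + z) = cinner x y + cinner x z"
    and cinner_scaleC_right: "cinner x (c *\<^sub>C y) = c * cinner x y"
    and Re_cinner: "Re (cinner x y) = x \<bullet> y"

lemma norm_scaleC: "norm (c *\<^sub>C (x :: 'a::complex_hilbert)) = cmod c * norm x"
proof -
  have "cinner (c *\<^sub>C x) x = cnj c * cinner x x"
    by (metis cinner_commute cinner_scaleC_right complex_cnj_mult)
  then have "cinner (c *\<^sub>C x) (c *\<^sub>C x) = of_real ((cmod c)\<^sup>2) * cinner x x"
    by (simp only: cinner_scaleC_right complex_norm_square mult.assoc)
  then have "(c *\<^sub>C x) \<bullet> (c *\<^sub>C x) = (cmod c)\<^sup>2 * (x \<bullet> x)"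
    by (simp only: Re_cinner[symmetric] Re_complex_of_real Im_complex_of_real times_complex.sel)
  then show ?thesis
    by (simp add: norm_eq_sqrt_inner real_sqrt_mult)
qed

lemma bounded_linear_scaleC: "bounded_linear (scaleC c :: 'a::complex_hilbert \<Rightarrow> 'a)"
  by (rule bounded_linear_intro[where K = "cmod c"])
    (simp_all only: scaleC_add_right norm_scaleC mult.commute scaleC_scaleC scaleC_of_real[symmetric] order_refl)


subsection \<open>The space of square summable sequences\<close>

typedef ell2 = "{x :: nat \<Rightarrow> complex. summable (\<lambda>n. (cmod (x n))\<^sup>2)}"
  morphisms ell2_nth Abs_ell2
  by (rule exI[of _ "\<lambda>_. 0"]) simp

setup_lifting type_definition_ell2

lemma summable_ell2: "summable (\<lambda>n. (cmod (ell2_nth x n))\<^sup>2)"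
  using ell2_nth[of x] by simp

lemma sq_summable_add:
  assumes "summable (\<lambda>n. (cmod (x n))\<^sup>2)" "summable (\<lambda>n. (cmod (y n))\<^sup>2)"
  shows "summable (\<lambda>n. (cmod (x n + y n))\<^sup>2)"
proof (rule summable_comparison_test')
  show "summable (\<lambda>n. 2 * (cmod (x n))\<^sup>2 + 2 * (cmod (y n))\<^sup>2)"
    using assms by (intro summable_add summable_mult)
  fix n :: nat
  have "(cmod (x n + y n))\<^sup>2 \<le> (cmod (x n) + cmod (y n))\<^sup>2"
    by (intro power_mono norm_triangle_ineq) simp
  also have "\<dots> \<le> 2 * (cmod (x n))\<^sup>2 + 2 * (cmod (y n))\<^sup>2"
    using zero_le_power2[of "cmod (x n) - cmod (y n)"]
    by (simp add: power2_eq_square algebra_simps)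
  finally show "norm ((cmod (x n + y n))\<^sup>2) \<le> 2 * (cmod (x n))\<^sup>2 + 2 * (cmod (y n))\<^sup>2"
    by simp
qed

lemma sq_summable_mult:
  assumes "summable (\<lambda>n. (cmod (x n))\<^sup>2)"
  shows "summable (\<lambda>n. (cmod (c * x n))\<^sup>2)"
  using summable_mult[OF assms, of "(cmod c)\<^sup>2"] by (simp only: norm_mult power_mult_distrib)

lemma summable_ell2_prod: "summable (\<lambda>n. cnj (ell2_nth x n) * ell2_nth y n)"
proof (rule summable_comparison_test')
  show "summable (\<lambda>n. (cmod (ell2_nth x n))\<^sup>2 + (cmod (ell2_nth y n))\<^sup>2)"
    by (intro summable_add summable_ell2)
  fix n :: nat
  show "norm (cnj (ell2_nth x n) * ell2_nth y n)
      \<le> (cmod (ell2_nth x n))\<^sup>2 + (cmod (ell2_nth y n))\<^sup>2"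
    using zero_le_power2[of "cmod (ell2_nth x n) - cmod (ell2_nth y n)"]
      mult_nonneg_nonneg[OF norm_ge_zero[of "ell2_nth x n"] norm_ge_zero[of "ell2_nth y n"]]
    unfolding norm_mult complex_mod_cnj power2_diff by linarith
qed

instantiation ell2 :: real_inner
begin

lift_definition zero_ell2 :: ell2 is "\<lambda>_. 0" by simp
lift_definition plus_ell2 :: "ell2 \<Rightarrow> ell2 \<Rightarrow> ell2" is "\<lambda>x y n. x n + y n"
  by (rule sq_summable_add)
lift_definition uminus_ell2 :: "ell2 \<Rightarrow> ell2" is "\<lambda>x n. - x n" by simp
lift_definition minus_ell2 :: "ell2 \<Rightarrow> ell2 \<Rightarrow> ell2" is "\<lambda>x y n. x n - y n"
proof -
  fix x y :: "nat \<Rightarrow> complex"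
  assume "summable (\<lambda>n. (cmod (x n))\<^sup>2)" "summable (\<lambda>n. (cmod (y n))\<^sup>2)"
  then show "summable (\<lambda>n. (cmod (x n - y n))\<^sup>2)"
    using sq_summable_add[of x "\<lambda>n. - y n"] by simp
qed
lift_definition scaleR_ell2 :: "real \<Rightarrow> ell2 \<Rightarrow> ell2" is "\<lambda>r x n. of_real r * x n"
  by (rule sq_summable_mult)

definition inner_ell2 :: "ell2 \<Rightarrow> ell2 \<Rightarrow> real" where
  "inner_ell2 x y = Re (\<Sum>n. cnj (ell2_nth x n) * ell2_nth y n)"
definition norm_ell2 :: "ell2 \<Rightarrow> real" where
  "norm_ell2 x = sqrt (x \<bullet> x)"
definition dist_ell2 :: "ell2 \<Rightarrow> ell2 \<Rightarrow> real" where
  "dist_ell2 x y = norm (x - y)"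
definition sgn_ell2 :: "ell2 \<Rightarrow> ell2" where
  "sgn_ell2 x = inverse (norm x) *\<^sub>R x"
definition uniformity_ell2 :: "(ell2 \<times> ell2) filter" where
  "uniformity_ell2 = (INF e\<in>{0<..}. principal {(x, y). dist x y < e})"
definition open_ell2 :: "ell2 set \<Rightarrow> bool" where
  "open_ell2 U \<longleftrightarrow> (\<forall>x\<in>U. eventually (\<lambda>(x', y). x' = x \<longrightarrow> y \<in> U) uniformity)"

lemma inner_ell2_self: "x \<bullet> x = (\<Sum>n. (cmod (ell2_nth x n))\<^sup>2)" for x :: ell2
proof -
  have "Re (\<Sum>n. cnj (ell2_nth x n) * ell2_nth x n) = (\<Sum>n. Re (cnj (ell2_nth x n) * ell2_nth x n))"
    by (rule bounded_linear.suminf[OF bounded_linear_Re summable_ell2_prod])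
  then show ?thesis
    by (simp add: inner_ell2_def cmod_power2 flip: power2_eq_square)
qed

instance
proof
  fix x y z :: ell2 and r s :: real
  show "x + y + z = x + (y + z)" "x + y = y + x" "0 + x = x" "- x + x = 0" "x - y = x + - y"
    "r *\<^sub>R (x + y) = r *\<^sub>R x + r *\<^sub>R y" "(r + s) *\<^sub>R x = r *\<^sub>R x + s *\<^sub>R x"
    "r *\<^sub>R s *\<^sub>R x = (r * s) *\<^sub>R x" "1 *\<^sub>R x = x"
    by (transfer; simp add: algebra_simps)+
  show "dist x y = norm (x - y)" "sgn x = inverse (norm x) *\<^sub>R x" "norm x = sqrt (x \<bullet> x)"
    by (simp_all add: dist_ell2_def sgn_ell2_def norm_ell2_def)
  show "uniformity = (INF e\<in>{0<..}. principal {(x, y :: ell2). dist x y < e})"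
    by (rule uniformity_ell2_def)
  show "open U \<longleftrightarrow> (\<forall>x\<in>U. eventually (\<lambda>(x', y). x' = x \<longrightarrow> y \<in> U) uniformity)" for U :: "ell2 set"
    by (rule open_ell2_def)
  have "(\<Sum>n. cnj (ell2_nth x n) * ell2_nth y n) = cnj (\<Sum>n. cnj (ell2_nth y n) * ell2_nth x n)"
    using bounded_linear.suminf[OF bounded_linear_cnj summable_ell2_prod[of y x]]
    by (simp add: mult.commute)
  then show "x \<bullet> y = y \<bullet> x"
    by (simp add: inner_ell2_def)
  show "(x + y) \<bullet> z = x \<bullet> z + y \<bullet> z"
    by (simp add: inner_ell2_def plus_ell2.rep_eq distrib_right
        suminf_add[OF summable_ell2_prod summable_ell2_prod, symmetric])
  show "(r *\<^sub>R x) \<bullet> y = r * (x \<bullet> y)"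
    using suminf_mult[OF summable_ell2_prod[of x y], of "of_real r"]
    by (simp add: inner_ell2_def scaleR_ell2.rep_eq mult.assoc)
  show "0 \<le> x \<bullet> x"
    by (simp add: inner_ell2_self suminf_nonneg summable_ell2)
  show "x \<bullet> x = 0 \<longleftrightarrow> x = 0"
    by (simp add: inner_ell2_self suminf_eq_zero_iff summable_ell2)
      (transfer, auto)
qed

end

lemma norm_ell2_sq: "(norm x)\<^sup>2 = (\<Sum>n. (cmod (ell2_nth x n))\<^sup>2)" for x :: ell2
  by (simp add: power2_norm_eq_inner inner_ell2_self)

lemma sum_le_norm_ell2: "(\<Sum>n<N. (cmod (ell2_nth x n))\<^sup>2) \<le> (norm x)\<^sup>2"
  unfolding norm_ell2_sq by (rule sum_le_suminf) (simp_all add: summable_ell2)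

lemma cmod_ell2_nth_le: "cmod (ell2_nth x n) \<le> norm x"
proof -
  have "(cmod (ell2_nth x n))\<^sup>2 \<le> (\<Sum>k<Suc n. (cmod (ell2_nth x k))\<^sup>2)"
    by (rule member_le_sum[where f = "\<lambda>k. (cmod (ell2_nth x k))\<^sup>2"]) simp_all
  also have "\<dots> \<le> (norm x)\<^sup>2"
    by (rule sum_le_norm_ell2)
  finally show ?thesis
    by (rule power2_le_imp_le) (rule norm_ge_zero)
qed

instantiation ell2 :: complex_hilbert
begin

lift_definition scaleC_ell2 :: "complex \<Rightarrow> ell2 \<Rightarrow> ell2" is "\<lambda>c x n. c * x n"
  by (rule sq_summable_mult)

definition cinner_ell2 :: "ell2 \<Rightarrow> ell2 \<Rightarrow> complex" where
  "cinner_ell2 x y = (\<Sum>n. cnj (ell2_nth x n) * ell2_nth y n)"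

instance
proof
  fix X :: "nat \<Rightarrow> ell2"
  assume X: "Cauchy X"
  have nth_diff: "ell2_nth (x - y) n = ell2_nth x n - ell2_nth y n" for x y n
    by (simp add: minus_ell2.rep_eq)
  have "Cauchy (\<lambda>m. ell2_nth (X m) n)" for n
  proof (rule metric_CauchyI)
    fix e :: real assume "e > 0"
    then obtain M where M: "\<And>m k. m \<ge> M \<Longrightarrow> k \<ge> M \<Longrightarrow> dist (X m) (X k) < e"
      using metric_CauchyD[OF X] by blast
    have "dist (ell2_nth (X m) n) (ell2_nth (X k) n) < e" if "m \<ge> M" "k \<ge> M" for m k
      using M[OF that] cmod_ell2_nth_le[of "X m - X k" n]
      by (simp add: dist_norm nth_diff)
    then show "\<exists>M. \<forall>m\<ge>M. \<forall>k\<ge>M. dist (ell2_nth (X m) n) (ell2_nth (X k) n) < e"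
      by blast
  qed
  then have "\<exists>l. (\<lambda>m. ell2_nth (X m) n) \<longlonglongrightarrow> l" for n
    by (simp add: Cauchy_convergent_iff convergent_def)
  then obtain x where x: "\<And>n. (\<lambda>m. ell2_nth (X m) n) \<longlonglongrightarrow> x n"
    by metis
  have tail: "\<exists>M. \<forall>m\<ge>M. \<forall>N. (\<Sum>n<N. (cmod (ell2_nth (X m) n - x n))\<^sup>2) \<le> e\<^sup>2"
    if "e > 0" for e
  proof -
    obtain M where M: "\<And>m k. m \<ge> M \<Longrightarrow> k \<ge> M \<Longrightarrow> dist (X m) (X k) < e"
      using metric_CauchyD[OF X \<open>e > 0\<close>] by blast
    have "(\<Sum>n<N. (cmod (ell2_nth (X m) n - x n))\<^sup>2) \<le> e\<^sup>2" if "m \<ge> M" for m N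
    proof (rule tendsto_upperbound)
      show "(\<lambda>k. \<Sum>n<N. (cmod (ell2_nth (X m) n - ell2_nth (X k) n))\<^sup>2)
          \<longlonglongrightarrow> (\<Sum>n<N. (cmod (ell2_nth (X m) n - x n))\<^sup>2)"
        by (intro tendsto_intros x)
      have "(\<Sum>n<N. (cmod (ell2_nth (X m) n - ell2_nth (X k) n))\<^sup>2) \<le> e\<^sup>2" if "k \<ge> M" for k
      proof -
        have "(norm (X m - X k))\<^sup>2 \<le> e\<^sup>2"
          using M[OF \<open>m \<ge> M\<close> that] by (intro power_mono) (auto simp: dist_norm)
        then show ?thesis
          using sum_le_norm_ell2[of "X m - X k" N] by (simp add: nth_diff)
      qed
      then show "\<forall>\<^sub>F k in sequentially.
          (\<Sum>n<N. (cmod (ell2_nth (X m) n - ell2_nth (X k) n))\<^sup>2) \<le> e\<^sup>2"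
        by (auto simp: eventually_sequentially)
    qed simp
    then show ?thesis by blast
  qed
  have sm: "summable (\<lambda>n. (cmod (ell2_nth (X m) n - x n))\<^sup>2)"
    if "\<forall>N. (\<Sum>n<N. (cmod (ell2_nth (X m) n - x n))\<^sup>2) \<le> e\<^sup>2" for m and e :: real
    by (rule summableI_nonneg_bounded[where x = "e\<^sup>2"]) (use that in simp_all)
  obtain M where "\<forall>m\<ge>M. \<forall>N. (\<Sum>n<N. (cmod (ell2_nth (X m) n - x n))\<^sup>2) \<le> 1\<^sup>2"
    using tail[OF zero_less_one] by blast
  then have "summable (\<lambda>n. (cmod (ell2_nth (X M) n - x n))\<^sup>2)"
    using sm[of M 1] by blast
  then have "summable (\<lambda>n. (cmod (ell2_nth (X M) n + - (ell2_nth (X M) n - x n)))\<^sup>2)"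
    by (intro sq_summable_add summable_ell2) (simp only: norm_minus_cancel)
  then have nth_x: "ell2_nth (Abs_ell2 x) = x"
    by (simp add: Abs_ell2_inverse)
  have "X \<longlonglongrightarrow> Abs_ell2 x"
  proof (rule metric_LIMSEQ_I)
    fix e :: real assume "e > 0"
    then obtain M where M: "\<forall>m\<ge>M. \<forall>N. (\<Sum>n<N. (cmod (ell2_nth (X m) n - x n))\<^sup>2) \<le> (e / 2)\<^sup>2"
      using tail[OF half_gt_zero] by blast
    have "dist (X m) (Abs_ell2 x) < e" if "m \<ge> M" for m
    proof -
      have "(norm (X m - Abs_ell2 x))\<^sup>2 \<le> (e / 2)\<^sup>2"
        unfolding norm_ell2_sq nth_diff nth_x
        using M that by (intro suminf_le_const sm[where e = "e / 2"]) blast+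
      then have "norm (X m - Abs_ell2 x) \<le> e / 2"
        by (rule power2_le_imp_le) (use \<open>e > 0\<close> in simp)
      then show ?thesis
        using \<open>e > 0\<close> by (simp add: dist_norm)
    qed
    then show "\<exists>M. \<forall>m\<ge>M. dist (X m) (Abs_ell2 x) < e" by blast
  qed
  then show "convergent X" by (rule convergentI)
next
  fix x y z :: ell2 and c d :: complex and r :: real
  show "c *\<^sub>C (x + y) = c *\<^sub>C x + c *\<^sub>C y" "(c + d) *\<^sub>C x = c *\<^sub>C x + d *\<^sub>C x"
    "c *\<^sub>C d *\<^sub>C x = (c * d) *\<^sub>C x" "complex_of_real r *\<^sub>C x = r *\<^sub>R x"
    by (transfer; simp add: algebra_simps)+
  show "cinner x y = cnj (cinner y x)"
    using bounded_linear.suminf[OF bounded_linear_cnj summable_ell2_prod[of y x]]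
    by (simp add: cinner_ell2_def mult.commute)
  show "cinner x (y + z) = cinner x y + cinner x z"
    by (simp add: cinner_ell2_def plus_ell2.rep_eq distrib_left
        suminf_add[OF summable_ell2_prod summable_ell2_prod, symmetric])
  show "cinner x (c *\<^sub>C y) = c * cinner x y"
    using suminf_mult[OF summable_ell2_prod[of x y], of c]
    by (simp add: cinner_ell2_def scaleC_ell2.rep_eq mult.left_commute)
  show "Re (cinner x y) = x \<bullet> y"
    by (simp add: cinner_ell2_def inner_ell2_def)
qed

end


subsection \<open>The complex conjugate of a Hilbert space\<close>

typedef 'a cconj = "UNIV :: 'a set"
  morphisms of_cconj to_cconj by simp

setup_lifting type_definition_cconj

instantiation cconj :: (complex_hilbert) real_inner
begin

lift_definition zero_cconj :: "'a cconj" is 0 .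
lift_definition plus_cconj :: "'a cconj \<Rightarrow> 'a cconj \<Rightarrow> 'a cconj" is "(+)" .
lift_definition uminus_cconj :: "'a cconj \<Rightarrow> 'a cconj" is uminus .
lift_definition minus_cconj :: "'a cconj \<Rightarrow> 'a cconj \<Rightarrow> 'a cconj" is "(-)" .
lift_definition scaleR_cconj :: "real \<Rightarrow> 'a cconj \<Rightarrow> 'a cconj" is scaleR .
lift_definition inner_cconj :: "'a cconj \<Rightarrow> 'a cconj \<Rightarrow> real" is inner .
lift_definition norm_cconj :: "'a cconj \<Rightarrow> real" is norm .
lift_definition dist_cconj :: "'a cconj \<Rightarrow> 'a cconj \<Rightarrow> real" is dist .
lift_definition sgn_cconj :: "'a cconj \<Rightarrow> 'a cconj" is sgn .

definition uniformity_cconj :: "('a cconj \<times> 'a cconj) filter" where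
  "uniformity_cconj = (INF e\<in>{0<..}. principal {(x, y). dist x y < e})"
definition open_cconj :: "'a cconj set \<Rightarrow> bool" where
  "open_cconj U \<longleftrightarrow> (\<forall>x\<in>U. eventually (\<lambda>(x', y). x' = x \<longrightarrow> y \<in> U) uniformity)"

instance
proof
  fix x y z :: "'a cconj" and r s :: real
  show "x + y + z = x + (y + z)" "x + y = y + x" "0 + x = x" "- x + x = 0" "x - y = x + - y"
    "r *\<^sub>R (x + y) = r *\<^sub>R x + r *\<^sub>R y" "(r + s) *\<^sub>R x = r *\<^sub>R x + s *\<^sub>R x"
    "r *\<^sub>R s *\<^sub>R x = (r * s) *\<^sub>R x" "1 *\<^sub>R x = x"
    by (transfer; simp add: algebra_simps)+
  show "dist x y = norm (x - y)"
    by (transfer) (rule dist_norm)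
  show "sgn x = inverse (norm x) *\<^sub>R x"
    by (transfer) (rule sgn_div_norm)
  show "norm x = sqrt (x \<bullet> x)"
    by (transfer) (rule norm_eq_sqrt_inner)
  show "uniformity = (INF e\<in>{0<..}. principal {(x, y :: 'a cconj). dist x y < e})"
    by (rule uniformity_cconj_def)
  show "open U \<longleftrightarrow> (\<forall>x\<in>U. eventually (\<lambda>(x', y). x' = x \<longrightarrow> y \<in> U) uniformity)" for U :: "'a cconj set"
    by (rule open_cconj_def)
  show "x \<bullet> y = y \<bullet> x"
    by (transfer) (rule inner_commute)
  show "(x + y) \<bullet> z = x \<bullet> z + y \<bullet> z" "(r *\<^sub>R x) \<bullet> y = r * (x \<bullet> y)" "0 \<le> x \<bullet> x"
    "x \<bullet> x = 0 \<longleftrightarrow> x = 0"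
    by (transfer; simp add: inner_add_left)+
qed

end

instantiation cconj :: (complex_hilbert) complex_hilbert
begin

lift_definition scaleC_cconj :: "complex \<Rightarrow> 'a cconj \<Rightarrow> 'a cconj" is "\<lambda>c x. cnj c *\<^sub>C x" .
lift_definition cinner_cconj :: "'a cconj \<Rightarrow> 'a cconj \<Rightarrow> complex" is "\<lambda>x y. cnj (cinner x y)" .

instance
proof
  fix X :: "nat \<Rightarrow> 'a cconj"
  assume "Cauchy X"
  then have "Cauchy (\<lambda>n. of_cconj (X n))"
    by (simp add: Cauchy_def dist_cconj.rep_eq)
  then obtain l where "(\<lambda>n. of_cconj (X n)) \<longlonglongrightarrow> l"
    by (auto simp: Cauchy_convergent_iff convergent_def)
  then have "X \<longlonglongrightarrow> to_cconj l"
    by (simp add: lim_sequentially dist_cconj.rep_eq to_cconj_inverse)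
  then show "convergent X" by (rule convergentI)
next
  fix x y z :: "'a cconj" and c d :: complex and r :: real
  show "c *\<^sub>C (x + y) = c *\<^sub>C x + c *\<^sub>C y" "(c + d) *\<^sub>C x = c *\<^sub>C x + d *\<^sub>C x"
    "c *\<^sub>C d *\<^sub>C x = (c * d) *\<^sub>C x" "complex_of_real r *\<^sub>C x = r *\<^sub>R x"
    by (transfer; simp add: scaleC_add_left scaleC_add_right scaleC_scaleC scaleC_of_real)+
  show "cinner x y = cnj (cinner y x)"
    by (transfer) (metis cinner_commute)
  show "cinner x (y + z) = cinner x y + cinner x z" "cinner x (c *\<^sub>C y) = c * cinner x y"
    "Re (cinner x y) = x \<bullet> y"
    by (transfer; simp add: cinner_add_right cinner_scaleC_right Re_cinner)+
qed

end


section \<open>Operators\<close>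

text \<open>
  The library type of bounded operators only demands real linearity; its norm is the operator
  norm. The set \<open>bop\<close> is the space of bounded complex linear operators.
\<close>

definition bop :: "('a::complex_hilbert \<Rightarrow>\<^sub>L 'a) set" where
  "bop = {T. \<forall>c x. blinfun_apply T (c *\<^sub>C x) = c *\<^sub>C blinfun_apply T x}"

definition compact_ops :: "('a::complex_hilbert \<Rightarrow>\<^sub>L 'a) set" where
  "compact_ops = {T \<in> bop. compact (closure (blinfun_apply T ` cball 0 1))}"

lift_definition scale_op :: "complex \<Rightarrow> ('a::complex_hilbert \<Rightarrow>\<^sub>L 'a) \<Rightarrow> ('a \<Rightarrow>\<^sub>L 'a)"
  is "\<lambda>c T x. c *\<^sub>C T x"
  by (rule bounded_linear_compose[OF bounded_linear_scaleC])

lemma of_cconj_bounded_linear: "bounded_linear (of_cconj :: 'a::complex_hilbert cconj \<Rightarrow> 'a)"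
  by (rule bounded_linear_intro[where K = 1])
    (simp_all add: plus_cconj.rep_eq scaleR_cconj.rep_eq norm_cconj.rep_eq)

lemma to_cconj_bounded_linear: "bounded_linear (to_cconj :: 'a::complex_hilbert \<Rightarrow> 'a cconj)"
  by (rule bounded_linear_intro[where K = 1])
    (simp_all add: plus_cconj.abs_eq scaleR_cconj.abs_eq norm_cconj.abs_eq)

text \<open>
  The conjugate C*-algebra of the bounded operators on a Hilbert space is the algebra of bounded
  operators on the conjugate Hilbert space, the conjugate of \<open>T\<close> acting as the same map.
\<close>

lift_definition conj_op ::
    "('a::complex_hilbert \<Rightarrow>\<^sub>L 'a) \<Rightarrow> ('a cconj \<Rightarrow>\<^sub>L 'a cconj)"
  is "\<lambda>T x. to_cconj (T (of_cconj x))"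
  by (intro bounded_linear_compose[OF to_cconj_bounded_linear]
      bounded_linear_compose[OF _ of_cconj_bounded_linear])

lemma conj_op_bop: "T \<in> bop \<Longrightarrow> conj_op T \<in> bop"
  by (simp add: bop_def conj_op.rep_eq scaleC_cconj.rep_eq scaleC_cconj.abs_eq)


section \<open>Minimal tensor norm\<close>

text \<open>
  A list \<open>[(h\<^sub>1, k\<^sub>1), \<dots>]\<close> stands for the element \<open>\<Sum>\<^sub>j h\<^sub>j \<otimes> k\<^sub>j\<close> of the algebraic tensor product,
  and \<open>tensor_norm\<close> is its norm in the Hilbert space tensor product. Since the algebraic tensor
  product is dense there, \<open>min_norm [(a\<^sub>1, b\<^sub>1), \<dots>]\<close> is the operator norm of \<open>\<Sum>\<^sub>i a\<^sub>i \<otimes> b\<^sub>i\<close> on the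
  Hilbert space tensor product. For \<open>a\<^sub>i, b\<^sub>i \<in> bop\<close> the set whose supremum is taken is bounded by
  \<open>\<Sum>\<^sub>i norm a\<^sub>i * norm b\<^sub>i\<close>.
\<close>

definition tensor_norm :: "('a::complex_hilbert \<times> 'b::complex_hilbert) list \<Rightarrow> real" where
  "tensor_norm v =
     sqrt (Re (\<Sum>(h, k)\<leftarrow>v. \<Sum>(h', k')\<leftarrow>v. cinner h h' * cinner k k'))"

definition tensor_apply ::
  "(('a::complex_hilbert \<Rightarrow>\<^sub>L 'a) \<times> ('b::complex_hilbert \<Rightarrow>\<^sub>L 'b)) list
    \<Rightarrow> ('a \<times> 'b) list \<Rightarrow> ('a \<times> 'b) list" where
  "tensor_apply t v = [(blinfun_apply a h, blinfun_apply b k). (a, b) \<leftarrow> t, (h, k) \<leftarrow> v]"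

definition min_norm ::
  "(('a::complex_hilbert \<Rightarrow>\<^sub>L 'a) \<times> ('b::complex_hilbert \<Rightarrow>\<^sub>L 'b)) list \<Rightarrow> real" where
  "min_norm t = Sup {tensor_norm (tensor_apply t v) |v. tensor_norm v \<le> 1}"


section \<open>Operator spaces\<close>

definition operator_space :: "('a::complex_hilbert \<Rightarrow>\<^sub>L 'a) set \<Rightarrow> bool" where
  "operator_space E \<longleftrightarrow>
     E \<subseteq> bop \<and> subspace E \<and> (\<forall>c. \<forall>T\<in>E. scale_op c T \<in> E) \<and> closed E"

text \<open>The norm of the matrix \<open>(x i j)\<close>, \<open>i, j < k\<close>, as an operator on the \<open>k\<close>-fold Hilbert sum.\<close>

definition mat_norm :: "nat \<Rightarrow> (nat \<Rightarrow> nat \<Rightarrow> 'a::complex_hilbert \<Rightarrow>\<^sub>L 'a) \<Rightarrow> real" where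
  "mat_norm k x =
     Sup {sqrt (\<Sum>i<k. (norm (\<Sum>j<k. blinfun_apply (x i j) (h j)))\<^sup>2) |h. (\<Sum>j<k. (norm (h j))\<^sup>2) \<le> 1}"

definition cb_norm ::
  "('a::complex_hilbert \<Rightarrow>\<^sub>L 'a) set \<Rightarrow> (('a \<Rightarrow>\<^sub>L 'a) \<Rightarrow> ('b::complex_hilbert \<Rightarrow>\<^sub>L 'b)) \<Rightarrow> ennreal" where
  "cb_norm E u =
     (SUP k\<in>{1..}. SUP x\<in>{x. (\<forall>i<k. \<forall>j<k. x i j \<in> E) \<and> mat_norm k x \<le> 1}.
        ennreal (mat_norm k (\<lambda>i j. u (x i j))))"

definition linear_iso ::
  "('a::complex_hilbert \<Rightarrow>\<^sub>L 'a) set \<Rightarrow> ('b::complex_hilbert \<Rightarrow>\<^sub>L 'b) set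
    \<Rightarrow> (('a \<Rightarrow>\<^sub>L 'a) \<Rightarrow> ('b \<Rightarrow>\<^sub>L 'b)) \<Rightarrow> bool" where
  "linear_iso E F u \<longleftrightarrow>
     bij_betw u E F \<and> (\<forall>S\<in>E. \<forall>T\<in>E. u (S + T) = u S + u T) \<and>
     (\<forall>c. \<forall>T\<in>E. u (scale_op c T) = scale_op c (u T))"

definition d_cb ::
  "('a::complex_hilbert \<Rightarrow>\<^sub>L 'a) set \<Rightarrow> ('b::complex_hilbert \<Rightarrow>\<^sub>L 'b) set \<Rightarrow> ennreal" where
  "d_cb E F = (INF u\<in>{u. linear_iso E F u}. cb_norm E u * cb_norm F (inv_into E u))"

definition d_SK :: "('a::complex_hilbert \<Rightarrow>\<^sub>L 'a) set \<Rightarrow> ennreal" where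
  "d_SK E = (INF F\<in>{F :: (ell2 \<Rightarrow>\<^sub>L ell2) set. operator_space F \<and> F \<subseteq> compact_ops}. d_cb E F)"


section \<open>The operator Hilbert space\<close>

text \<open>
  \<open>is_OH n E\<close>: the concretely represented operator space \<open>E\<close> is (a copy of) the \<open>n\<close>-dimensional
  operator Hilbert space.
\<close>

definition is_OH :: "nat \<Rightarrow> ('a::complex_hilbert \<Rightarrow>\<^sub>L 'a) set \<Rightarrow> bool" where
  "is_OH n E \<longleftrightarrow> operator_space E \<and>
     (\<exists>\<theta> :: nat \<Rightarrow> 'a \<Rightarrow>\<^sub>L 'a.
        E = range (\<lambda>c. \<Sum>i<n. scale_op (c i) (\<theta> i)) \<and>
        (\<forall>c. norm (\<Sum>i<n. scale_op (c i) (\<theta> i)) = sqrt (\<Sum>i<n. (cmod (c i))\<^sup>2)) \<and>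
        (\<forall>a :: nat \<Rightarrow> ell2 \<Rightarrow>\<^sub>L ell2. (\<forall>i<n. a i \<in> bop) \<longrightarrow>
           min_norm (map (\<lambda>i. (\<theta> i, a i)) [0..<n]) =
           sqrt (min_norm (map (\<lambda>i. (a i, conj_op (a i))) [0..<n]))))"

end

theory Submission
  imports Defs
begin

text \<open>
  Let \<open>u\<close> be an isomorphism of \<open>OH\<^sub>n\<close> onto a space of compact operators, \<open>x\<^sub>i = u \<theta>\<^sub>i\<close>. The generators
  \<open>\<lambda>(g\<^sub>i)\<close> of the regular representation of the free product of \<open>n\<close> groups of order two satisfy
  \<open>\<parallel>\<Sum>\<^sub>i \<lambda>(g\<^sub>i) \<otimes> cnj \<lambda>(g\<^sub>i)\<parallel> \<le> 2 \<surd>(n - 1)\<close> (the spectral radius of the \<open>n\<close>-regular tree), so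
  \<open>\<parallel>\<Sum>\<^sub>i x\<^sub>i \<otimes> \<lambda>(g\<^sub>i)\<parallel>\<close> is at most \<open>\<parallel>u\<parallel>\<^sub>c\<^sub>b (2 \<surd>(n - 1))\<^sup>1\<^sup>/\<^sup>2\<close>. After replacing the \<open>x\<^sub>i\<close> by matrices,
  let permutation matrices \<open>u\<^sub>i\<close> of a finite quotient of large girth take the place of \<open>\<lambda>(g\<^sub>i)\<close>. A
  moment comparison shows that \<open>\<Sum>\<^sub>i x\<^sub>i \<otimes> u\<^sub>i\<close> exceeds the above bound only on a subspace of small
  relative dimension, and because the \<open>x\<^sub>i\<close> have a fixed size this subspace is removed by a
  projection \<open>q\<close> of almost full rank acting on the second factor only. For \<open>a\<^sub>i = q u\<^sub>i\<close> the norm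
  \<open>\<parallel>\<Sum>\<^sub>i a\<^sub>i \<otimes> cnj a\<^sub>i\<parallel>\<close> is at least the normalized trace of \<open>\<Sum>\<^sub>i a\<^sub>i a\<^sub>i\<^sup>*\<close>, which is almost \<open>n\<close>; applying
  the inverse of \<open>u\<close> to \<open>\<Sum>\<^sub>i x\<^sub>i \<otimes> a\<^sub>i\<close> gives the inequality.
\<close>

section \<open>Orthonormal systems in complex Hilbert spaces\<close>

lemma cinner_add_left: "cinner (x + y) z = cinner x z + cinner y z"
  for x y z :: "'a::complex_hilbert"
  by (metis cinner_commute cinner_add_right complex_cnj_add)

lemma cinner_scaleC_left: "cinner (c *\<^sub>C x) y = cnj c * cinner x y"
  for x y :: "'a::complex_hilbert"
  by (metis cinner_commute cinner_scaleC_right complex_cnj_mult)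

lemma cinner_zero_right [simp]: "cinner x 0 = 0" for x :: "'a::complex_hilbert"
  using cinner_add_right[of x 0 0] by simp

lemma cinner_zero_left [simp]: "cinner 0 x = 0" for x :: "'a::complex_hilbert"
  using cinner_add_left[of 0 0 x] by simp

lemma cinner_diff_right: "cinner x (y - z) = cinner x y - cinner x z"
  for x y z :: "'a::complex_hilbert"
  using cinner_add_right[of x "y - z" z] by simp

lemma cinner_diff_left: "cinner (x - y) z = cinner x z - cinner y z"
  for x y z :: "'a::complex_hilbert"
  using cinner_add_left[of "x - y" y z] by simp

lemma cinner_sum_right: "cinner x (\<Sum>i\<in>I. f i) = (\<Sum>i\<in>I. cinner x (f i))"
  for x :: "'a::complex_hilbert"
  by (induction I rule: infinite_finite_induct) (simp_all add: cinner_add_right)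

lemma cinner_sum_left: "cinner (\<Sum>i\<in>I. f i) x = (\<Sum>i\<in>I. cinner (f i) x)"
  for x :: "'a::complex_hilbert"
  by (induction I rule: infinite_finite_induct) (simp_all add: cinner_add_left)

lemma cinner_eq_zero_commute: "cinner x y = 0 \<longleftrightarrow> cinner y x = 0" for x y :: "'a::complex_hilbert"
  using cinner_commute[of x y] by simp

lemma cinner_self: "cinner x x = of_real ((norm x)\<^sup>2)" for x :: "'a::complex_hilbert"
proof (rule complex_eqI)
  show "Re (cinner x x) = Re (of_real ((norm x)\<^sup>2))"
    by (simp add: Re_cinner power2_norm_eq_inner)
  have "Im (cinner x x) = - Im (cinner x x)"
    using arg_cong[OF cinner_commute[of x x], of Im] by simp
  then show "Im (cinner x x) = Im (of_real ((norm x)\<^sup>2))" by simp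
qed

lemma scaleC_one [simp]: "1 *\<^sub>C x = x" for x :: "'a::complex_hilbert"
  using scaleC_of_real[of 1 x] by simp

lemma scaleC_zero_left [simp]: "0 *\<^sub>C x = 0" for x :: "'a::complex_hilbert"
  using scaleC_of_real[of 0 x] by simp

lemma scaleC_zero_right [simp]: "c *\<^sub>C (0 :: 'a::complex_hilbert) = 0"
  by (rule linear_0[OF bounded_linear.linear[OF bounded_linear_scaleC]])

lemma scaleC_diff_right: "c *\<^sub>C (x - y) = c *\<^sub>C x - c *\<^sub>C y" for x y :: "'a::complex_hilbert"
  by (rule linear_diff[OF bounded_linear.linear[OF bounded_linear_scaleC]])

lemma scaleC_sum_right: "c *\<^sub>C (\<Sum>i\<in>I. f i) = (\<Sum>i\<in>I. c *\<^sub>C f i)"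
  for f :: "_ \<Rightarrow> 'a::complex_hilbert"
  by (rule linear_sum[OF bounded_linear.linear[OF bounded_linear_scaleC]])

lemma scaleC_sum_left: "(\<Sum>i\<in>I. f i) *\<^sub>C x = (\<Sum>i\<in>I. f i *\<^sub>C x)"
  for x :: "'a::complex_hilbert"
  by (induction I rule: infinite_finite_induct) (simp_all add: scaleC_add_left)

definition corthonormal :: "('i \<Rightarrow> 'a::complex_hilbert) \<Rightarrow> 'i set \<Rightarrow> bool" where
  "corthonormal f I \<longleftrightarrow> finite I \<and> (\<forall>s\<in>I. \<forall>t\<in>I. cinner (f s) (f t) = (if s = t then 1 else 0))"

definition cproj :: "('i \<Rightarrow> 'a::complex_hilbert) \<Rightarrow> 'i set \<Rightarrow> 'a \<Rightarrow> 'a" where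
  "cproj f I x = (\<Sum>i\<in>I. cinner (f i) x *\<^sub>C f i)"

lemma corthonormal_finite: "corthonormal f I \<Longrightarrow> finite I"
  by (simp add: corthonormal_def)

lemma norm_corthonormal:
  assumes "corthonormal f I" "i \<in> I"
  shows "norm (f i) = 1"
proof -
  have "complex_of_real ((norm (f i))\<^sup>2) = 1"
    using assms unfolding cinner_self[symmetric] by (simp add: corthonormal_def)
  then have "(norm (f i))\<^sup>2 = 1\<^sup>2"
    by (simp only: of_real_eq_1_iff one_power2)
  then show ?thesis
    by (simp only: power2_eq_iff_nonneg norm_ge_zero zero_le_one)
qed

lemma cinner_corthonormal_sum:
  assumes "corthonormal f I" "s \<in> I"
  shows "cinner (f s) (\<Sum>i\<in>I. c i *\<^sub>C f i) = c s"
proof -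
  have "cinner (f s) (\<Sum>i\<in>I. c i *\<^sub>C f i) = (\<Sum>i\<in>I. if s = i then c i else 0)"
    unfolding cinner_sum_right cinner_scaleC_right
    using assms by (intro sum.cong) (auto simp: corthonormal_def)
  then show ?thesis using assms by (simp add: corthonormal_def)
qed

lemma norm_corthonormal_sum:
  assumes "corthonormal f I"
  shows "(norm (\<Sum>i\<in>I. c i *\<^sub>C f i))\<^sup>2 = (\<Sum>i\<in>I. (cmod (c i))\<^sup>2)"
proof -
  have "cinner (\<Sum>i\<in>I. c i *\<^sub>C f i) (\<Sum>i\<in>I. c i *\<^sub>C f i) = (\<Sum>i\<in>I. cnj (c i) * c i)"
    unfolding cinner_sum_left[of "\<lambda>i. c i *\<^sub>C f i"] cinner_scaleC_left
    using assms by (intro sum.cong) (simp_all add: cinner_corthonormal_sum)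
  also have "\<dots> = of_real (\<Sum>i\<in>I. (cmod (c i))\<^sup>2)"
    by (simp add: complex_norm_square mult.commute del: of_real_power)
  finally show ?thesis
    unfolding cinner_self of_real_eq_iff .
qed

lemma cproj_corthonormal_sum:
  "corthonormal f I \<Longrightarrow> cproj f I (\<Sum>i\<in>I. c i *\<^sub>C f i) = (\<Sum>i\<in>I. c i *\<^sub>C f i)"
  unfolding cproj_def by (intro sum.cong refl) (simp add: cinner_corthonormal_sum)

lemma cproj_cproj: "corthonormal f I \<Longrightarrow> cproj f I (cproj f I x) = cproj f I x"
  unfolding cproj_def[of f I x] by (rule cproj_corthonormal_sum)

lemma cproj_member:
  assumes "corthonormal f I" "s \<in> I"
  shows "cproj f I (f s) = f s"
proof -
  have "cproj f I (f s) = (\<Sum>i\<in>I. if i = s then f s else 0)"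
    unfolding cproj_def using assms by (intro sum.cong) (auto simp: corthonormal_def)
  then show ?thesis
    using assms by (simp add: corthonormal_def)
qed

lemma cinner_cproj: "corthonormal f I \<Longrightarrow> s \<in> I \<Longrightarrow> cinner (f s) (cproj f I x) = cinner (f s) x"
  unfolding cproj_def by (rule cinner_corthonormal_sum)

lemma cinner_diff_cproj: "corthonormal f I \<Longrightarrow> s \<in> I \<Longrightarrow> cinner (f s) (x - cproj f I x) = 0"
  by (simp add: cinner_diff_right cinner_cproj)

lemma cinner_expand:
  assumes "cproj f I y = y"
  shows "cinner x y = (\<Sum>i\<in>I. cinner x (f i) * cinner (f i) y)"
proof -
  have "cinner x y = cinner x (cproj f I y)"
    using assms by simp
  then show ?thesis
    by (simp add: cproj_def cinner_sum_right cinner_scaleC_right mult.commute)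
qed

lemma cinner_eq_zero_if_cproj:
  assumes "cproj f I y = y" "\<And>i. i \<in> I \<Longrightarrow> cinner (f i) x = 0"
  shows "cinner x y = 0"
proof -
  have "cinner x (f i) = 0" if "i \<in> I" for i
    using assms(2)[OF that] cinner_eq_zero_commute by blast
  then show ?thesis
    by (simp add: cinner_expand[OF assms(1), of x])
qed

lemma cproj_Pythagoras:
  assumes "corthonormal f I"
  shows "(norm x)\<^sup>2 = (norm (x - cproj f I x))\<^sup>2 + (\<Sum>i\<in>I. (cmod (cinner (f i) x))\<^sup>2)"
proof -
  have "cinner (x - cproj f I x) (cproj f I x) = 0"
    using cproj_cproj[OF assms] cinner_diff_cproj[OF assms] by (rule cinner_eq_zero_if_cproj)
  then have "(x - cproj f I x) \<bullet> cproj f I x = 0"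
    by (simp flip: Re_cinner)
  then have "(norm x)\<^sup>2 = (norm (x - cproj f I x))\<^sup>2 + (norm (cproj f I x))\<^sup>2"
    unfolding power2_norm_eq_inner
    by (simp add: inner_diff_left inner_diff_right inner_commute)
  then show ?thesis
    using norm_corthonormal_sum[OF assms, of "\<lambda>i. cinner (f i) x"] by (simp add: cproj_def)
qed

lemma norm_diff_cproj_le: "corthonormal f I \<Longrightarrow> norm (x - cproj f I x) \<le> norm x"
  by (rule power2_le_imp_le) (simp_all add: cproj_Pythagoras[of f I x] sum_nonneg)

lemma cBessel: "corthonormal f I \<Longrightarrow> (\<Sum>i\<in>I. (cmod (cinner (f i) x))\<^sup>2) \<le> (norm x)\<^sup>2"
  using cproj_Pythagoras[of f I x] by simp

lemma cParseval:
  "corthonormal f I \<Longrightarrow> cproj f I x = x \<Longrightarrow> (norm x)\<^sup>2 = (\<Sum>i\<in>I. (cmod (cinner (f i) x))\<^sup>2)"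
  using cproj_Pythagoras[of f I x] by simp

lemma cmod_cinner_le: "cmod (cinner x y) \<le> norm x * norm y" for x y :: "'a::complex_hilbert"
proof (cases "x = 0")
  case False
  define e where "e = of_real (1 / norm x) *\<^sub>C x"
  have "corthonormal (\<lambda>_. e) {()}"
    using False by (simp add: corthonormal_def e_def cinner_self norm_scaleC norm_divide)
  from cBessel[OF this, of y] have "cmod (cinner e y) \<le> norm y"
    by simp
  moreover have "cmod (cinner e y) = cmod (cinner x y) / norm x"
    by (simp add: e_def cinner_scaleC_left norm_mult norm_divide)
  ultimately show ?thesis
    using False by (simp add: field_simps)
qed simp

lemma cproj_mono:
  assumes "corthonormal f J" "I \<subseteq> J" "cproj f I x = x"
  shows "cproj f J x = x"
proof -
  have "cinner (f j) x = 0" if "j \<in> J - I" for j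
    using assms(1,2) that
    by (intro cinner_eq_zero_if_cproj[OF assms(3)]) (auto simp: corthonormal_def)
  then have "cproj f J x = cproj f I x"
    unfolding cproj_def
    using assms(1,2) by (intro sum.mono_neutral_right) (auto simp: corthonormal_finite)
  then show ?thesis
    using assms(3) by simp
qed

lemma corthonormal_inj_on: "corthonormal f I \<Longrightarrow> inj_on f I"
  unfolding corthonormal_def by (rule inj_onI) (metis zero_neq_one)

lemma corthonormal_image: "corthonormal f I \<Longrightarrow> corthonormal (\<lambda>g. g) (f ` I)"
  using corthonormal_inj_on[of f I] by (auto simp: corthonormal_def inj_on_eq_iff)

definition csubspace :: "'a::complex_hilbert set \<Rightarrow> bool" where
  "csubspace S \<longleftrightarrow> 0 \<in> S \<and> (\<forall>x\<in>S. \<forall>y\<in>S. x + y \<in> S) \<and> (\<forall>c. \<forall>x\<in>S. c *\<^sub>C x \<in> S)"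

lemma csubspace_sum:
  assumes "csubspace S" "\<And>i. i \<in> I \<Longrightarrow> f i \<in> S"
  shows "(\<Sum>i\<in>I. f i) \<in> S"
  using assms by (induction I rule: infinite_finite_induct) (auto simp: csubspace_def)

lemma csubspace_diff:
  assumes "csubspace S" "x \<in> S" "y \<in> S"
  shows "x - y \<in> S"
proof -
  have "x + (-1) *\<^sub>C y \<in> S"
    using assms by (simp add: csubspace_def)
  then show ?thesis
    using scaleC_of_real[of "-1" y] by simp
qed

lemma csubspace_cproj: "csubspace S \<Longrightarrow> f ` I \<subseteq> S \<Longrightarrow> cproj f I x \<in> S"
  unfolding cproj_def by (rule csubspace_sum) (auto simp: csubspace_def)

lemma Gram_Schmidt_step:
  assumes orthonormal: "corthonormal (\<lambda>g. g) B" and subspace: "csubspace S" "B \<subseteq> S"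
    and x_mem: "x \<in> S"
  shows "\<exists>B'. corthonormal (\<lambda>g. g) B' \<and> B \<subseteq> B' \<and> B' \<subseteq> S \<and> card B' \<le> Suc (card B) \<and>
    cproj (\<lambda>g. g) B' x = x"
proof (cases "cproj (\<lambda>g. g) B x = x")
  case True
  then show ?thesis using orthonormal subspace by (intro exI[of _ B]) auto
next
  case False
  define r where "r = x - cproj (\<lambda>g. g) B x"
  define e where "e = of_real (1 / norm r) *\<^sub>C r"
  have r_nonzero: "r \<noteq> 0" using False by (simp add: r_def)
  have "r \<in> S"
    unfolding r_def using subspace x_mem by (intro csubspace_diff csubspace_cproj) auto
  then have e_mem: "e \<in> S"
    using subspace(1) by (simp add: e_def csubspace_def)
  have unit: "cinner e e = 1"
    using r_nonzero by (simp add: e_def cinner_self norm_scaleC norm_divide)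
  have orth: "cinner g e = 0" "cinner e g = 0" if "g \<in> B" for g
  proof -
    show "cinner g e = 0"
      using cinner_diff_cproj[OF orthonormal that, of x]
      by (simp add: e_def r_def cinner_scaleC_right)
    then show "cinner e g = 0" by (simp add: cinner_eq_zero_commute)
  qed
  have "e \<notin> B" using orth unit by force
  have "cinner e x = cinner e r"
    by (simp add: r_def cproj_def cinner_diff_right cinner_sum_right cinner_scaleC_right orth)
  also have "\<dots> = of_real (norm r)"
    using r_nonzero by (simp add: e_def cinner_scaleC_left cinner_self power2_eq_square)
  finally have "cinner e x *\<^sub>C e = r"
    using r_nonzero by (simp add: e_def scaleC_scaleC)
  then have "cproj (\<lambda>g. g) (insert e B) x = x"
    using \<open>e \<notin> B\<close> corthonormal_finite[OF orthonormal] by (simp add: cproj_def r_def)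
  moreover have "corthonormal (\<lambda>g. g) (insert e B)"
    using orthonormal unit orth by (auto simp: corthonormal_def)
  ultimately show ?thesis
    using subspace(2) e_mem \<open>e \<notin> B\<close> corthonormal_finite[OF orthonormal]
    by (intro exI[of _ "insert e B"]) auto
qed

lemma Gram_Schmidt_extension:
  assumes orthonormal: "corthonormal (\<lambda>g. g) B" and subspace: "csubspace S" "B \<subseteq> S"
    and finite_subset: "finite X" "X \<subseteq> S"
  shows "\<exists>B'. corthonormal (\<lambda>g. g) B' \<and> B \<subseteq> B' \<and> B' \<subseteq> S \<and> card B' \<le> card B + card X \<and>
    (\<forall>x\<in>X. cproj (\<lambda>g. g) B' x = x)"
  using finite_subset
proof (induction X rule: finite_induct)
  case empty
  show ?case using orthonormal subspace by (intro exI[of _ B]) auto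
next
  case (insert x X)
  then obtain B1 where previous: "corthonormal (\<lambda>g. g) B1" "B \<subseteq> B1" "B1 \<subseteq> S"
      "card B1 \<le> card B + card X" "\<forall>x\<in>X. cproj (\<lambda>g. g) B1 x = x"
    by auto
  obtain B2 where extended: "corthonormal (\<lambda>g. g) B2" "B1 \<subseteq> B2" "B2 \<subseteq> S" "card B2 \<le> Suc (card B1)"
      "cproj (\<lambda>g. g) B2 x = x"
    using Gram_Schmidt_step[OF previous(1) subspace(1) previous(3)] insert.prems by blast
  show ?case
    using insert.hyps previous extended cproj_mono[OF extended(1,2)] by (intro exI[of _ B2]) auto
qed

corollary corthonormal_basis_exists:
  fixes X :: "'a::complex_hilbert set"
  assumes "corthonormal f I" "finite X"
  shows "\<exists>B. corthonormal (\<lambda>g. g) B \<and> f ` I \<subseteq> B \<and> (\<forall>x\<in>X. cproj (\<lambda>g. g) B x = x)"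
proof -
  have "csubspace (UNIV :: 'a set)" by (simp add: csubspace_def)
  from Gram_Schmidt_extension[OF corthonormal_image[OF assms(1)] this _ assms(2)]
  show ?thesis by blast
qed

section \<open>Square summable sequences\<close>

lemma ell2_nth_add: "ell2_nth (x + y) s = ell2_nth x s + ell2_nth y s"
  by (simp add: plus_ell2.rep_eq)

lemma ell2_nth_diff: "ell2_nth (x - y) s = ell2_nth x s - ell2_nth y s"
  by (simp add: minus_ell2.rep_eq)

lemma ell2_nth_scaleR: "ell2_nth (c *\<^sub>R x) s = of_real c * ell2_nth x s"
  by (simp add: scaleR_ell2.rep_eq)

lemma ell2_nth_scaleC: "ell2_nth (c *\<^sub>C x) s = c * ell2_nth x s"
  by (simp add: scaleC_ell2.rep_eq)

lemma ell2_nth_sum: "ell2_nth (\<Sum>i\<in>I. f i) s = (\<Sum>i\<in>I. ell2_nth (f i) s)"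
  by (induction I rule: infinite_finite_induct) (simp_all add: ell2_nth_add zero_ell2.rep_eq)

lemma bounded_linear_ell2_nth: "bounded_linear (\<lambda>x. ell2_nth x s)"
  by (rule bounded_linear_intro[where K = 1])
    (simp_all add: ell2_nth_add ell2_nth_scaleR scaleR_conv_of_real cmod_ell2_nth_le)

lift_definition evec :: "nat \<Rightarrow> (nat \<Rightarrow> complex) \<Rightarrow> ell2" is "\<lambda>N g s. if s < N then g s else 0"
proof -
  fix N :: nat and g :: "nat \<Rightarrow> complex"
  show "summable (\<lambda>n. (cmod (if n < N then g n else 0))\<^sup>2)"
    by (rule summable_finite[of "{..<N}"]) auto
qed

lemma cinner_evec: "cinner (evec N g) h = (\<Sum>s<N. cnj (g s) * ell2_nth h s)"
proof -
  have "(\<Sum>n. cnj (if n < N then g n else 0) * ell2_nth h n) =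
      (\<Sum>s<N. cnj (if s < N then g s else 0) * ell2_nth h s)"
    by (rule suminf_finite) auto
  then show ?thesis by (simp add: cinner_ell2_def evec.rep_eq)
qed

lemma cinner_evec_evec: "cinner (evec N g) (evec N h) = (\<Sum>s<N. cnj (g s) * h s)"
  by (simp add: cinner_evec evec.rep_eq)

lemma norm_evec_sq: "(norm (evec N g))\<^sup>2 = (\<Sum>s<N. (cmod (g s))\<^sup>2)"
proof -
  have "complex_of_real ((norm (evec N g))\<^sup>2) = of_real (\<Sum>s<N. (cmod (g s))\<^sup>2)"
    unfolding cinner_self[symmetric] cinner_evec_evec
    by (simp add: complex_norm_square mult.commute del: of_real_power)
  then show ?thesis by (simp only: of_real_eq_iff)
qed

lemma evec_cong: "(\<And>s. s < N \<Longrightarrow> g s = g' s) \<Longrightarrow> evec N g = evec N g'"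
  by transfer auto

lemma evec_add: "evec N (\<lambda>s. g s + g' s) = evec N g + evec N g'"
  by transfer auto

lemma evec_scaleC: "evec N (\<lambda>s. c * g s) = c *\<^sub>C evec N g"
  by transfer auto

lemma evec_scaleR: "evec N (\<lambda>s. of_real c * g s) = c *\<^sub>R evec N g"
  by transfer auto

lemma evec_zero: "evec N (\<lambda>s. 0) = 0"
  by transfer auto

lemma evec_sum: "evec N (\<lambda>s. \<Sum>i\<in>I. g i s) = (\<Sum>i\<in>I. evec N (g i))"
  by (induction I rule: infinite_finite_induct) (simp_all add: evec_add evec_zero)

lemma evec_ell2_nth_evec: "evec N (ell2_nth (evec N g)) = evec N g"
  by (rule evec_cong) (simp add: evec.rep_eq)

lemma csubspace_range_evec: "csubspace (range (evec N))"
  unfolding csubspace_def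
  by (auto simp flip: evec_zero[of N] evec_add evec_scaleC)

definition ebase :: "nat \<Rightarrow> ell2" where
  "ebase t = evec (Suc t) (\<lambda>s. if s = t then 1 else 0)"

lemma ell2_nth_ebase: "ell2_nth (ebase t) s = (if s = t then 1 else 0)"
  by (auto simp: ebase_def evec.rep_eq)

lemma cinner_ebase: "cinner (ebase t) h = ell2_nth h t"
proof -
  have "cinner (ebase t) h = (\<Sum>s<Suc t. if s = t then ell2_nth h t else 0)"
    unfolding ebase_def cinner_evec by (intro sum.cong) auto
  then show ?thesis by simp
qed

lemma corthonormal_ebase: "finite I \<Longrightarrow> corthonormal ebase I"
  by (simp add: corthonormal_def cinner_ebase ell2_nth_ebase)

lemma evec_eq_sum_ebase: "evec N g = (\<Sum>s<N. g s *\<^sub>C ebase s)"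
proof -
  have "ell2_nth (evec N g) s = ell2_nth (\<Sum>s<N. g s *\<^sub>C ebase s) s" for s
  proof -
    have "ell2_nth (\<Sum>s<N. g s *\<^sub>C ebase s) s = (\<Sum>i<N. if i = s then g s else 0)"
      unfolding ell2_nth_sum ell2_nth_scaleC ell2_nth_ebase by (intro sum.cong) auto
    then show ?thesis by (simp add: evec.rep_eq)
  qed
  then show ?thesis by (metis ell2_nth_inverse ext)
qed

lift_definition truncation :: "nat \<Rightarrow> ell2 \<Rightarrow>\<^sub>L ell2" is "\<lambda>N h. evec N (ell2_nth h)"
proof (rule bounded_linear_intro)
  fix N :: nat and g h :: ell2 and r :: real
  show "evec N (ell2_nth (g + h)) = evec N (ell2_nth g) + evec N (ell2_nth h)"
    unfolding evec_add[symmetric] ell2_nth_add ..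
  show "evec N (ell2_nth (r *\<^sub>R h)) = r *\<^sub>R evec N (ell2_nth h)"
    unfolding evec_scaleR[symmetric] ell2_nth_scaleR ..
  show "norm (evec N (ell2_nth h)) \<le> norm h * 1"
    by (rule power2_le_imp_le) (simp_all add: norm_evec_sq sum_le_norm_ell2)
qed

lemma norm_truncation_apply_le: "norm (blinfun_apply (truncation N) h) \<le> norm h"
  by (rule power2_le_imp_le) (simp_all add: truncation.rep_eq norm_evec_sq sum_le_norm_ell2)

lemma norm_truncation_le: "norm (truncation N) \<le> 1"
  by (rule norm_blinfun_bound) (simp_all add: norm_truncation_apply_le)

lemma cinner_truncation:
  "cinner x (blinfun_apply (truncation N) y) = cinner (blinfun_apply (truncation N) x) y"
  using cinner_commute[of x "blinfun_apply (truncation N) y"]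
  by (simp add: truncation.rep_eq cinner_evec mult.commute)

lemma truncation_tendsto: "(\<lambda>N. blinfun_apply (truncation N) h) \<longlonglongrightarrow> h"
proof -
  have "(norm (h - blinfun_apply (truncation N) h))\<^sup>2 =
      (norm h)\<^sup>2 - (\<Sum>s<N. (cmod (ell2_nth h s))\<^sup>2)" for N
  proof -
    have "(norm (h - blinfun_apply (truncation N) h))\<^sup>2 =
        (\<Sum>n. (cmod (ell2_nth h n))\<^sup>2 - (cmod (ell2_nth (blinfun_apply (truncation N) h) n))\<^sup>2)"
      unfolding norm_ell2_sq
      by (intro suminf_cong) (simp add: ell2_nth_diff truncation.rep_eq evec.rep_eq)
    also have "\<dots> = (norm h)\<^sup>2 - (norm (blinfun_apply (truncation N) h))\<^sup>2"
      unfolding norm_ell2_sq by (rule suminf_diff[symmetric]) (rule summable_ell2)+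
    finally show ?thesis by (simp add: truncation.rep_eq norm_evec_sq)
  qed
  moreover have "(\<lambda>N. (norm h)\<^sup>2 - (\<Sum>s<N. (cmod (ell2_nth h s))\<^sup>2)) \<longlonglongrightarrow> (norm h)\<^sup>2 - (norm h)\<^sup>2"
    using summable_LIMSEQ[OF summable_ell2[of h]]
    by (intro tendsto_diff tendsto_const) (simp add: norm_ell2_sq)
  ultimately have "(\<lambda>N. sqrt ((norm (h - blinfun_apply (truncation N) h))\<^sup>2)) \<longlonglongrightarrow> sqrt 0"
    by (intro tendsto_real_sqrt) simp
  then have "(\<lambda>N. norm (blinfun_apply (truncation N) h - h)) \<longlonglongrightarrow> 0"
    by (simp add: norm_minus_commute)
  then show ?thesis
    using Lim_null tendsto_norm_zero_iff by blast
qed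

lemma ell2_Riesz:
  fixes \<phi> :: "ell2 \<Rightarrow> complex"
  assumes bounded: "bounded_linear \<phi>" and scale: "\<And>c h. \<phi> (c *\<^sub>C h) = c * \<phi> h"
  shows "\<exists>y. \<forall>h. \<phi> h = cinner y h"
proof -
  define a where "a m = \<phi> (ebase m)" for m
  have \<phi>_evec: "\<phi> (evec M g) = (\<Sum>m<M. g m * a m)" for M g
    unfolding evec_eq_sum_ebase linear_sum[OF bounded_linear.linear[OF bounded]]
    by (simp add: scale a_def)
  obtain K where \<phi>_bound: "\<And>h. cmod (\<phi> h) \<le> norm h * K" "K \<ge> 0"
    using bounded_linear.nonneg_bounded[OF bounded] by auto
  have "(\<Sum>m<M. (cmod (cnj (a m)))\<^sup>2) \<le> K\<^sup>2" for M
  proof -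
    define g where "g = evec M (\<lambda>m. cnj (a m))"
    have "of_real ((norm g)\<^sup>2) = \<phi> g"
      unfolding g_def \<phi>_evec norm_evec_sq
      by (simp add: complex_norm_square mult.commute del: of_real_power)
    then have "norm g * norm g \<le> norm g * K"
      using \<phi>_bound(1)[of g] by (metis norm_of_real abs_power2 power2_eq_square)
    then have "norm g \<le> K"
      using \<phi>_bound(2) by (cases "norm g = 0") auto
    then show ?thesis
      using power_mono[of "norm g" K 2] by (simp add: g_def norm_evec_sq)
  qed
  then have "summable (\<lambda>m. (cmod (cnj (a m)))\<^sup>2)"
    by (intro summableI_nonneg_bounded) auto
  then obtain y where y_nth: "\<And>m. ell2_nth y m = cnj (a m)"
    using Abs_ell2_inverse[of "\<lambda>m. cnj (a m)"] by (metis mem_Collect_eq)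
  have "\<phi> h = cinner y h" for h
  proof (rule LIMSEQ_unique)
    show "(\<lambda>M. \<phi> (blinfun_apply (truncation M) h)) \<longlonglongrightarrow> \<phi> h"
      by (intro bounded_linear.tendsto[OF bounded] truncation_tendsto)
    show "(\<lambda>M. \<phi> (blinfun_apply (truncation M) h)) \<longlonglongrightarrow> cinner y h"
      using summable_LIMSEQ[OF summable_ell2_prod[of y h]]
      by (simp add: truncation.rep_eq \<phi>_evec cinner_ell2_def y_nth mult.commute)
  qed
  then show ?thesis by blast
qed

section \<open>Finite complex matrices\<close>

definition finner :: "'x set \<Rightarrow> ('x \<Rightarrow> complex) \<Rightarrow> ('x \<Rightarrow> complex) \<Rightarrow> complex" where
  "finner I u v = (\<Sum>x\<in>I. cnj (u x) * v x)"

definition sqnorm :: "'x set \<Rightarrow> ('x \<Rightarrow> complex) \<Rightarrow> real" where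
  "sqnorm I u = (\<Sum>x\<in>I. (cmod (u x))\<^sup>2)"

definition mat_vec :: "'y set \<Rightarrow> ('x \<Rightarrow> 'y \<Rightarrow> complex) \<Rightarrow> ('y \<Rightarrow> complex) \<Rightarrow> 'x \<Rightarrow> complex" where
  "mat_vec J A g x = (\<Sum>y\<in>J. A x y * g y)"

definition mat_mult ::
  "'y set \<Rightarrow> ('x \<Rightarrow> 'y \<Rightarrow> complex) \<Rightarrow> ('y \<Rightarrow> 'z \<Rightarrow> complex) \<Rightarrow> 'x \<Rightarrow> 'z \<Rightarrow> complex" where
  "mat_mult J A B x z = (\<Sum>y\<in>J. A x y * B y z)"

definition adjoint_mat :: "('x \<Rightarrow> 'y \<Rightarrow> complex) \<Rightarrow> 'y \<Rightarrow> 'x \<Rightarrow> complex" where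
  "adjoint_mat A y x = cnj (A x y)"

definition opnorm_le :: "'x set \<Rightarrow> 'y set \<Rightarrow> ('x \<Rightarrow> 'y \<Rightarrow> complex) \<Rightarrow> real \<Rightarrow> bool" where
  "opnorm_le I J A r \<longleftrightarrow> (\<forall>g. sqnorm I (mat_vec J A g) \<le> r\<^sup>2 * sqnorm J g)"

definition hs_sqnorm :: "'x set \<Rightarrow> ('x \<Rightarrow> 'x \<Rightarrow> complex) \<Rightarrow> real" where
  "hs_sqnorm I A = (\<Sum>x\<in>I. sqnorm I (A x))"

definition kron_sum ::
  "nat \<Rightarrow> (nat \<Rightarrow> 'x \<Rightarrow> 'y \<Rightarrow> complex) \<Rightarrow> (nat \<Rightarrow> 'v \<Rightarrow> 'w \<Rightarrow> complex) \<Rightarrow> 'x \<times> 'v \<Rightarrow> 'y \<times> 'w \<Rightarrow> complex"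
  where "kron_sum n X \<beta> x y = (\<Sum>i<n. X i (fst x) (fst y) * \<beta> i (snd x) (snd y))"

definition unit_vec :: "'x \<Rightarrow> 'x \<Rightarrow> complex" where
  "unit_vec x = (\<lambda>y. if y = x then 1 else 0)"

lemma sqnorm_nonneg: "sqnorm I u \<ge> 0"
  by (simp add: sqnorm_def sum_nonneg)

lemma sqnorm_cong: "(\<And>x. x \<in> I \<Longrightarrow> u x = v x) \<Longrightarrow> sqnorm I u = sqnorm I v"
  by (simp add: sqnorm_def)

lemma sqnorm_scale: "sqnorm I (\<lambda>x. c * u x) = (cmod c)\<^sup>2 * sqnorm I u"
  by (simp add: sqnorm_def norm_mult power_mult_distrib sum_distrib_left)

lemma sqnorm_Times: "sqnorm (A \<times> B) u = (\<Sum>b\<in>B. sqnorm A (\<lambda>a. u (a, b)))"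
  unfolding sqnorm_def by (subst sum.swap) (simp add: sum.cartesian_product)

lemma sqnorm_evec: "sqnorm {..<N} g = (norm (evec N g))\<^sup>2"
  by (simp add: sqnorm_def norm_evec_sq)

lemma finner_self: "finner I u u = of_real (sqnorm I u)"
  by (simp add: finner_def sqnorm_def complex_norm_square mult.commute del: of_real_power)

lemma finner_unit_vec: "finite I \<Longrightarrow> x \<in> I \<Longrightarrow> finner I u (unit_vec x) = cnj (u x)"
proof -
  assume "finite I" "x \<in> I"
  moreover have "finner I u (unit_vec x) = (\<Sum>y\<in>I. if y = x then cnj (u x) else 0)"
    unfolding finner_def unit_vec_def by (intro sum.cong) auto
  ultimately show ?thesis by simp
qed

lemma sqnorm_unit_vec:
  assumes "finite I" "x \<in> I"
  shows "sqnorm I (unit_vec x) = 1"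
proof -
  have "complex_of_real (sqnorm I (unit_vec x)) = 1"
    unfolding finner_self[symmetric] finner_unit_vec[OF assms] by (simp add: unit_vec_def)
  then show ?thesis by simp
qed

lemma finner_embedding:
  assumes "finite I"
  shows "\<exists>T :: ('x \<Rightarrow> complex) \<Rightarrow> ell2. \<forall>u v. cinner (T u) (T v) = finner (I :: 'x set) u v"
proof -
  obtain e where bij: "bij_betw e {..<card I} I"
    using ex_bij_betw_nat_finite[OF assms] by (auto simp: atLeast0LessThan)
  have "cinner (evec (card I) (u \<circ> e)) (evec (card I) (v \<circ> e)) = finner I u v" for u v
    using sum.reindex_bij_betw[OF bij, of "\<lambda>x. cnj (u x) * v x"]
    by (simp add: cinner_evec_evec finner_def)
  then show ?thesis by (intro exI[of _ "\<lambda>u. evec (card I) (u \<circ> e)"]) blast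
qed

lemma finner_Cauchy_Schwarz: "(cmod (finner I u v))\<^sup>2 \<le> sqnorm I u * sqnorm I v"
proof (cases "finite I")
  case True
  then obtain T :: "_ \<Rightarrow> ell2" where embedding: "\<And>u v. cinner (T u) (T v) = finner I u v"
    using finner_embedding by blast
  have norm_embedding: "(norm (T u))\<^sup>2 = sqnorm I u" for u
    using embedding[of u u] unfolding cinner_self finner_self of_real_eq_iff .
  have "(cmod (cinner (T u) (T v)))\<^sup>2 \<le> (norm (T u) * norm (T v))\<^sup>2"
    by (intro power_mono cmod_cinner_le) simp
  then show ?thesis by (simp add: embedding power_mult_distrib norm_embedding)
qed (simp add: finner_def sqnorm_def)

lemma finner_Bessel:
  assumes "finite I" "finite J"
    and "\<And>j l. j \<in> J \<Longrightarrow> l \<in> J \<Longrightarrow> finner I (u j) (u l) = (if j = l then 1 else 0)"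
  shows "(\<Sum>j\<in>J. (cmod (finner I (u j) v))\<^sup>2) \<le> sqnorm I v"
proof -
  obtain T :: "_ \<Rightarrow> ell2" where embedding: "\<And>u v. cinner (T u) (T v) = finner I u v"
    using finner_embedding[OF assms(1)] by blast
  have "(norm (T v))\<^sup>2 = sqnorm I v"
    using embedding[of v v] unfolding cinner_self finner_self of_real_eq_iff .
  moreover have "corthonormal (\<lambda>j. T (u j)) J"
    using assms(2,3) by (simp add: corthonormal_def embedding)
  ultimately show ?thesis
    using cBessel[of "\<lambda>j. T (u j)" J "T v"] by (simp add: embedding)
qed

lemma adjoint_mat_adjoint_mat [simp]: "adjoint_mat (adjoint_mat A) = A"
  by (simp add: adjoint_mat_def fun_eq_iff)

lemma mat_vec_cong: "(\<And>y. y \<in> J \<Longrightarrow> g y = g' y) \<Longrightarrow> mat_vec J A g = mat_vec J A g'"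
  by (intro ext) (simp add: mat_vec_def)

lemma mat_vec_scale: "mat_vec J A (\<lambda>y. c * g y) = (\<lambda>x. c * mat_vec J A g x)"
  by (intro ext) (simp add: mat_vec_def sum_distrib_left mult.left_commute)

lemma mat_vec_mat_mult: "mat_vec L (mat_mult J A B) g = mat_vec J A (mat_vec L B g)"
proof
  fix x
  have "mat_vec L (mat_mult J A B) g x = (\<Sum>z\<in>L. \<Sum>y\<in>J. A x y * (B y z * g z))"
    by (simp add: mat_vec_def mat_mult_def sum_distrib_right mult.assoc)
  also have "\<dots> = mat_vec J A (mat_vec L B g) x"
    unfolding mat_vec_def sum_distrib_left by (rule sum.swap)
  finally show "mat_vec L (mat_mult J A B) g x = mat_vec J A (mat_vec L B g) x" .
qed

lemma adjoint_kron_sum: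
  "adjoint_mat (kron_sum n X \<beta>) = kron_sum n (\<lambda>i. adjoint_mat (X i)) (\<lambda>i. adjoint_mat (\<beta> i))"
  by (simp add: adjoint_mat_def kron_sum_def fun_eq_iff)

lemma adjoint_mat_mult: "adjoint_mat (mat_mult J A B) = mat_mult J (adjoint_mat B) (adjoint_mat A)"
  by (simp add: adjoint_mat_def mat_mult_def fun_eq_iff mult.commute)

lemma mat_vec_kron_sum:
  "mat_vec (K \<times> V) (kron_sum n X \<beta>) g (a, s) =
    (\<Sum>i<n. \<Sum>t\<in>V. \<beta> i s t * mat_vec K (X i) (\<lambda>b. g (b, t)) a)"
proof -
  have "mat_vec (K \<times> V) (kron_sum n X \<beta>) g (a, s) =
      (\<Sum>b\<in>K. \<Sum>t\<in>V. \<Sum>i<n. X i a b * \<beta> i s t * g (b, t))"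
    by (simp add: mat_vec_def kron_sum_def sum.cartesian_product' sum_distrib_right)
  also have "\<dots> = (\<Sum>i<n. \<Sum>t\<in>V. \<Sum>b\<in>K. X i a b * \<beta> i s t * g (b, t))"
    by (simp only: sum.swap[of _ "{..<n}"] sum.swap[of _ K V])
  finally show ?thesis
    by (simp add: mat_vec_def sum_distrib_left mult_ac)
qed

lemma mat_vec_kron_sum_mat_mult:
  "mat_vec (K \<times> V) (kron_sum n X (\<lambda>i. mat_mult V (\<beta> i) q)) h (a, s) =
    mat_vec (K \<times> V) (kron_sum n X \<beta>) (\<lambda>y. mat_vec V q (\<lambda>t. h (fst y, t)) (snd y)) (a, s)"
proof -
  have "(\<Sum>t\<in>V. mat_mult V (\<beta> i) q s t * mat_vec K (X i) (\<lambda>b. h (b, t)) a) =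
      (\<Sum>r\<in>V. \<beta> i s r * mat_vec K (X i) (\<lambda>b. mat_vec V q (\<lambda>t. h (b, t)) r) a)" for i
  proof -
    have "(\<Sum>t\<in>V. mat_mult V (\<beta> i) q s t * mat_vec K (X i) (\<lambda>b. h (b, t)) a) =
        (\<Sum>t\<in>V. \<Sum>r\<in>V. \<Sum>b\<in>K. \<beta> i s r * q r t * (X i a b * h (b, t)))"
      by (simp add: mat_vec_def mat_mult_def sum_product)
    also have "\<dots> = (\<Sum>r\<in>V. \<Sum>b\<in>K. \<Sum>t\<in>V. \<beta> i s r * q r t * (X i a b * h (b, t)))"
      by (subst sum.swap) (intro sum.cong refl sum.swap)
    finally show ?thesis
      by (simp add: mat_vec_def sum_distrib_left mult_ac)
  qed
  then show ?thesis
    by (simp add: mat_vec_kron_sum)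
qed

lemma finner_mat_vec: "finner I (mat_vec J A u) v = finner J u (mat_vec I (adjoint_mat A) v)"
proof -
  have "finner I (mat_vec J A u) v = (\<Sum>x\<in>I. \<Sum>y\<in>J. cnj (A x y) * cnj (u y) * v x)"
    by (simp add: finner_def mat_vec_def sum_distrib_right)
  also have "\<dots> = (\<Sum>y\<in>J. \<Sum>x\<in>I. cnj (A x y) * cnj (u y) * v x)"
    by (rule sum.swap)
  also have "\<dots> = finner J u (mat_vec I (adjoint_mat A) v)"
    by (simp add: finner_def mat_vec_def adjoint_mat_def sum_distrib_left mult_ac)
  finally show ?thesis .
qed

lemma opnorm_leD: "opnorm_le I J A r \<Longrightarrow> sqnorm I (mat_vec J A g) \<le> r\<^sup>2 * sqnorm J g"
  by (simp add: opnorm_le_def)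

lemma opnorm_le_mono: "opnorm_le I J A r \<Longrightarrow> 0 \<le> r \<Longrightarrow> r \<le> r' \<Longrightarrow> opnorm_le I J A r'"
  unfolding opnorm_le_def
  by (meson mult_right_mono order_trans power_mono sqnorm_nonneg)

lemma opnorm_le_adjoint:
  assumes "opnorm_le I J A r"
  shows "opnorm_le J I (adjoint_mat A) r"
  unfolding opnorm_le_def
proof
  fix h
  define v where "v = mat_vec I (adjoint_mat A) h"
  have "(sqnorm J v)\<^sup>2 = (cmod (finner J v v))\<^sup>2"
    by (simp add: finner_self)
  also have "finner J v v = finner I h (mat_vec J A v)"
    by (subst v_def) (simp add: finner_mat_vec)
  also have "(cmod (finner I h (mat_vec J A v)))\<^sup>2 \<le> sqnorm I h * sqnorm I (mat_vec J A v)"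
    by (rule finner_Cauchy_Schwarz)
  also have "\<dots> \<le> sqnorm I h * (r\<^sup>2 * sqnorm J v)"
    by (intro mult_left_mono opnorm_leD assms sqnorm_nonneg)
  finally have "sqnorm J v * sqnorm J v \<le> (r\<^sup>2 * sqnorm I h) * sqnorm J v"
    by (simp add: power2_eq_square mult_ac)
  then show "sqnorm J v \<le> r\<^sup>2 * sqnorm I h"
    using sqnorm_nonneg[of J v] sqnorm_nonneg[of I h] by (cases "sqnorm J v = 0") auto
qed

lemma opnorm_le_mat_mult:
  assumes A_bound: "opnorm_le I J A r" and B_bound: "opnorm_le J L B s"
  shows "opnorm_le I L (mat_mult J A B) (r * s)"
  unfolding opnorm_le_def mat_vec_mat_mult
proof
  fix g
  have "sqnorm I (mat_vec J A (mat_vec L B g)) \<le> r\<^sup>2 * sqnorm J (mat_vec L B g)"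
    by (rule opnorm_leD[OF A_bound])
  also have "\<dots> \<le> r\<^sup>2 * (s\<^sup>2 * sqnorm L g)"
    by (intro mult_left_mono opnorm_leD[OF B_bound]) simp
  finally show "sqnorm I (mat_vec J A (mat_vec L B g)) \<le> (r * s)\<^sup>2 * sqnorm L g"
    by (simp add: power_mult_distrib mult.assoc)
qed

lemma sqnorm_reindex:
  "bij_betw m I' I \<Longrightarrow> (\<And>y. y \<in> I' \<Longrightarrow> h y = g (m y)) \<Longrightarrow> sqnorm I' h = sqnorm I g"
  using sum.reindex_bij_betw[of m I' I "\<lambda>y. (cmod (g y))\<^sup>2"] by (simp add: sqnorm_def)

lemma mat_vec_reindex:
  assumes "bij_betw m I' I" and "\<And>y. y \<in> I' \<Longrightarrow> B x y = A (m x) (m y)"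
    and "\<And>y. y \<in> I' \<Longrightarrow> h y = g (m y)"
  shows "mat_vec I' B h x = mat_vec I A g (m x)"
  using sum.reindex_bij_betw[OF assms(1), of "\<lambda>y. A (m x) y * g y"] assms(2,3)
  by (simp add: mat_vec_def)

lemma opnorm_le_reindex:
  assumes bij: "bij_betw m I' I" and B_eq: "\<And>x y. x \<in> I' \<Longrightarrow> y \<in> I' \<Longrightarrow> B x y = A (m x) (m y)"
  shows "opnorm_le I' I' B r \<longleftrightarrow> opnorm_le I I A r"
proof -
  have transfer: "sqnorm I' (mat_vec I' B h) \<le> r\<^sup>2 * sqnorm I' h \<longleftrightarrow>
      sqnorm I (mat_vec I A g) \<le> r\<^sup>2 * sqnorm I g"
    if h_eq: "\<And>y. y \<in> I' \<Longrightarrow> h y = g (m y)" for g h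
    using sqnorm_reindex[OF bij, of "mat_vec I' B h" "mat_vec I A g"]
      sqnorm_reindex[of m I' I h g, OF bij h_eq]
      mat_vec_reindex[of m I' I B _ A h g, OF bij B_eq h_eq] by simp
  show ?thesis
    unfolding opnorm_le_def
  proof (intro iffI allI)
    fix g :: "_ \<Rightarrow> complex"
    assume "\<forall>h. sqnorm I' (mat_vec I' B h) \<le> r\<^sup>2 * sqnorm I' h"
    then show "sqnorm I (mat_vec I A g) \<le> r\<^sup>2 * sqnorm I g"
      using transfer[of "\<lambda>y. g (m y)" g] by simp
  next
    fix h :: "_ \<Rightarrow> complex"
    assume "\<forall>g. sqnorm I (mat_vec I A g) \<le> r\<^sup>2 * sqnorm I g"
    moreover have "h y = h (the_inv_into I' m (m y))" if "y \<in> I'" for y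
      using bij that by (simp add: bij_betw_def the_inv_into_f_f)
    ultimately show "sqnorm I' (mat_vec I' B h) \<le> r\<^sup>2 * sqnorm I' h"
      using transfer[of h "\<lambda>x. h (the_inv_into I' m x)"] by simp
  qed
qed

lemma weighted_Cauchy_Schwarz:
  assumes "\<And>y. y \<in> I \<Longrightarrow> a y \<ge> 0" "\<And>y. y \<in> I \<Longrightarrow> \<omega> y > 0"
  shows "(cmod (\<Sum>y\<in>I. of_real (a y) * g y))\<^sup>2 \<le>
      (\<Sum>y\<in>I. a y * \<omega> y) * (\<Sum>y\<in>I. a y * (cmod (g y))\<^sup>2 / \<omega> y)"
proof -
  define u where "u y = complex_of_real (sqrt (a y * \<omega> y))" for y
  define v where "v y = of_real (sqrt (a y / \<omega> y)) * g y" for y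
  have "of_real (a y) * g y = cnj (u y) * v y" if "y \<in> I" for y
  proof -
    have "sqrt (a y * \<omega> y) * sqrt (a y / \<omega> y) = a y"
      using assms[OF that] by (simp add: real_sqrt_mult[symmetric] less_imp_neq[symmetric])
    then show ?thesis
      by (simp add: u_def v_def mult.assoc[symmetric] flip: of_real_mult)
  qed
  then have "(\<Sum>y\<in>I. of_real (a y) * g y) = finner I u v"
    by (simp add: finner_def)
  moreover have "sqnorm I u = (\<Sum>y\<in>I. a y * \<omega> y)" "sqnorm I v = (\<Sum>y\<in>I. a y * (cmod (g y))\<^sup>2 / \<omega> y)"
    unfolding sqnorm_def u_def v_def norm_mult norm_of_real power_mult_distrib power2_abs
    using assms by (simp_all add: less_imp_le)
  ultimately show ?thesis
    using finner_Cauchy_Schwarz[of I u v] by simp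
qed

lemma Schur_test:
  fixes A :: "'x \<Rightarrow> 'x \<Rightarrow> real"
  assumes nonneg: "\<And>x y. x \<in> I \<Longrightarrow> y \<in> I \<Longrightarrow> A x y \<ge> 0"
    and symmetric: "\<And>x y. x \<in> I \<Longrightarrow> y \<in> I \<Longrightarrow> A x y = A y x"
    and weight: "\<And>x. x \<in> I \<Longrightarrow> \<omega> x > 0" and "r \<ge> 0"
    and row_le: "\<And>x. x \<in> I \<Longrightarrow> (\<Sum>y\<in>I. A x y * \<omega> y) \<le> r * \<omega> x"
  shows "opnorm_le I I (\<lambda>x y. of_real (A x y)) r"
  unfolding opnorm_le_def
proof
  fix g :: "'x \<Rightarrow> complex"
  have "sqnorm I (mat_vec I (\<lambda>x y. of_real (A x y)) g) \<le>
      (\<Sum>x\<in>I. r * \<omega> x * (\<Sum>y\<in>I. A x y * (cmod (g y))\<^sup>2 / \<omega> y))"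
    unfolding sqnorm_def mat_vec_def
  proof (rule sum_mono)
    fix x assume x_mem: "x \<in> I"
    have "(cmod (\<Sum>y\<in>I. of_real (A x y) * g y))\<^sup>2 \<le>
        (\<Sum>y\<in>I. A x y * \<omega> y) * (\<Sum>y\<in>I. A x y * (cmod (g y))\<^sup>2 / \<omega> y)"
      by (intro weighted_Cauchy_Schwarz nonneg weight x_mem)
    also have "\<dots> \<le> r * \<omega> x * (\<Sum>y\<in>I. A x y * (cmod (g y))\<^sup>2 / \<omega> y)"
      using x_mem nonneg weight
      by (intro mult_right_mono row_le sum_nonneg) (auto simp: less_imp_le)
    finally show "(cmod (\<Sum>y\<in>I. of_real (A x y) * g y))\<^sup>2 \<le>
        r * \<omega> x * (\<Sum>y\<in>I. A x y * (cmod (g y))\<^sup>2 / \<omega> y)" .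
  qed
  also have "\<dots> = (\<Sum>y\<in>I. \<Sum>x\<in>I. r * \<omega> x * (A x y * (cmod (g y))\<^sup>2 / \<omega> y))"
    unfolding sum_distrib_left by (rule sum.swap)
  also have "\<dots> = (\<Sum>y\<in>I. r * ((cmod (g y))\<^sup>2 / \<omega> y) * (\<Sum>x\<in>I. A y x * \<omega> x))"
    unfolding sum_distrib_left by (intro sum.cong refl) (auto simp: symmetric)
  also have "\<dots> \<le> (\<Sum>y\<in>I. r * ((cmod (g y))\<^sup>2 / \<omega> y) * (r * \<omega> y))"
    using weight \<open>r \<ge> 0\<close> by (intro sum_mono mult_left_mono row_le) (auto simp: less_imp_le)
  also have "\<dots> = (\<Sum>y\<in>I. r\<^sup>2 * (cmod (g y))\<^sup>2)"
    by (intro sum.cong refl) (use weight in \<open>auto simp: power2_eq_square less_imp_neq[symmetric]\<close>)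
  finally show "sqnorm I (mat_vec I (\<lambda>x y. of_real (A x y)) g) \<le> r\<^sup>2 * sqnorm I g"
    by (simp add: sqnorm_def sum_distrib_left)
qed

subsection \<open>Diagonal moments\<close>

definition gram_map :: "'x set \<Rightarrow> ('x \<Rightarrow> 'x \<Rightarrow> complex) \<Rightarrow> ('x \<Rightarrow> complex) \<Rightarrow> 'x \<Rightarrow> complex" where
  "gram_map I A g = mat_vec I A (mat_vec I (adjoint_mat A) g)"

definition diag_moment :: "'x set \<Rightarrow> ('x \<Rightarrow> 'x \<Rightarrow> complex) \<Rightarrow> nat \<Rightarrow> 'x \<Rightarrow> real" where
  "diag_moment I A p x = sqnorm I ((gram_map I A ^^ p) (unit_vec x))"

lemma gram_map_cong: "(\<And>y. y \<in> I \<Longrightarrow> g y = g' y) \<Longrightarrow> gram_map I A g = gram_map I A g'"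
  unfolding gram_map_def by (rule arg_cong[where f = "mat_vec I A"]) (rule mat_vec_cong)

lemma gram_map_reindex:
  assumes "bij_betw m I' I" and "\<And>x y. x \<in> I' \<Longrightarrow> y \<in> I' \<Longrightarrow> B x y = A (m x) (m y)"
    and "\<And>y. y \<in> I' \<Longrightarrow> h y = g (m y)" and "x \<in> I'"
  shows "gram_map I' B h x = gram_map I A g (m x)"
  unfolding gram_map_def by (intro mat_vec_reindex assms) (simp_all add: adjoint_mat_def assms)

lemma diag_moment_reindex:
  assumes bij: "bij_betw m I' I" and B_eq: "\<And>x y. x \<in> I' \<Longrightarrow> y \<in> I' \<Longrightarrow> B x y = A (m x) (m y)"
    and x_mem: "x \<in> I'"
  shows "diag_moment I' B p x = diag_moment I A p (m x)"
proof -
  have "(gram_map I' B ^^ p) (unit_vec x) y = (gram_map I A ^^ p) (unit_vec (m x)) (m y)"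
    if "y \<in> I'" for y
    using that
  proof (induction p arbitrary: y)
    case 0
    then show ?case
      using bij x_mem by (auto simp: unit_vec_def bij_betw_def inj_on_eq_iff)
  next
    case (Suc p)
    then show ?case
      unfolding funpow.simps o_apply by (intro gram_map_reindex[where A = A and B = B, OF bij B_eq])
  qed
  then show ?thesis
    unfolding diag_moment_def by (rule sqnorm_reindex[OF bij])
qed

lemma sqnorm_gram_map_pow_le:
  assumes "opnorm_le I I A r"
  shows "sqnorm I ((gram_map I A ^^ p) g) \<le> (r ^ (2 * p))\<^sup>2 * sqnorm I g"
proof (induction p)
  case (Suc p)
  define h where "h = (gram_map I A ^^ p) g"
  have "sqnorm I (gram_map I A h) \<le> r\<^sup>2 * sqnorm I (mat_vec I (adjoint_mat A) h)"
    unfolding gram_map_def by (rule opnorm_leD[OF assms])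
  also have "\<dots> \<le> r\<^sup>2 * (r\<^sup>2 * sqnorm I h)"
    by (intro mult_left_mono opnorm_leD opnorm_le_adjoint assms) simp
  also have "\<dots> \<le> r\<^sup>2 * (r\<^sup>2 * ((r ^ (2 * p))\<^sup>2 * sqnorm I g))"
    using Suc.IH by (intro mult_left_mono) (simp_all add: h_def)
  finally show ?case
    by (simp add: h_def power_mult_distrib mult_ac power2_eq_square)
qed simp

lemma diag_moment_le:
  "opnorm_le I I A r \<Longrightarrow> finite I \<Longrightarrow> x \<in> I \<Longrightarrow> diag_moment I A p x \<le> (r ^ (2 * p))\<^sup>2"
  using sqnorm_gram_map_pow_le[of I A r p "unit_vec x"]
  by (simp add: diag_moment_def sqnorm_unit_vec)

lemma finner_gram_map_pow: "finner I ((gram_map I A ^^ p) u) v = finner I u ((gram_map I A ^^ p) v)"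
proof (induction p arbitrary: v)
  case (Suc p)
  have "finner I ((gram_map I A ^^ Suc p) u) v = finner I ((gram_map I A ^^ p) u) (gram_map I A v)"
    by (simp add: gram_map_def finner_mat_vec)
  also have "\<dots> = finner I u ((gram_map I A ^^ Suc p) v)"
    by (simp add: Suc.IH funpow_swap1)
  finally show ?case .
qed simp

lemma sqnorm_adjoint_ratio_mono:
  assumes "c * sqnorm I u \<le> sqnorm J (mat_vec I (adjoint_mat A) u)"
  shows "c * sqnorm J (mat_vec I (adjoint_mat A) u) \<le>
      sqnorm I (mat_vec J A (mat_vec I (adjoint_mat A) u))"
proof -
  define w where "w = mat_vec I (adjoint_mat A) u"
  have "finner J w w = finner I u (mat_vec J A w)"
    by (subst w_def) (simp add: finner_mat_vec)
  then have "sqnorm J w * sqnorm J w = (cmod (finner I u (mat_vec J A w)))\<^sup>2"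
    by (simp add: finner_self flip: power2_eq_square) (metis norm_of_real power2_abs)
  also have "\<dots> \<le> sqnorm I u * sqnorm I (mat_vec J A w)"
    by (rule finner_Cauchy_Schwarz)
  finally have Cauchy_Schwarz: "sqnorm J w * sqnorm J w \<le> sqnorm I u * sqnorm I (mat_vec J A w)" .
  show ?thesis
  proof (cases "sqnorm I u = 0")
    case True
    then show ?thesis
      using Cauchy_Schwarz sqnorm_nonneg[of J w]
      by (auto simp: mult_le_0_iff sqnorm_nonneg simp flip: w_def)
  next
    case False
    have "sqnorm I u * (c * sqnorm J w) \<le> sqnorm J w * sqnorm J w"
      using mult_right_mono[OF assms sqnorm_nonneg[of J w]] by (simp add: w_def mult_ac)
    also note Cauchy_Schwarz
    finally show ?thesis
      using False sqnorm_nonneg[of I u] by (simp add: w_def)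
  qed
qed

lemma sqnorm_gram_map_pow_ge:
  assumes "c \<ge> 0" and "c * sqnorm I u \<le> sqnorm I (mat_vec I (adjoint_mat A) u)"
  shows "c ^ (2 * p) * sqnorm I u \<le> sqnorm I ((gram_map I A ^^ p) u)"
proof -
  have "c ^ (2 * p) * sqnorm I u \<le> sqnorm I ((gram_map I A ^^ p) u) \<and>
      c * sqnorm I ((gram_map I A ^^ p) u) \<le>
        sqnorm I (mat_vec I (adjoint_mat A) ((gram_map I A ^^ p) u))"
  proof (induction p)
    case (Suc p)
    define v where "v = (gram_map I A ^^ p) u"
    have even: "c * sqnorm I v \<le> sqnorm I (mat_vec I (adjoint_mat A) v)"
      using Suc.IH by (simp add: v_def)
    have odd: "c * sqnorm I (mat_vec I (adjoint_mat A) v) \<le> sqnorm I (gram_map I A v)"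
      unfolding gram_map_def by (rule sqnorm_adjoint_ratio_mono[OF even])
    have "c * sqnorm I (gram_map I A v) \<le> sqnorm I (mat_vec I (adjoint_mat A) (gram_map I A v))"
      using sqnorm_adjoint_ratio_mono[of c I "mat_vec I (adjoint_mat A) v" I "adjoint_mat A"] odd
      by (simp add: gram_map_def)
    moreover have "c ^ (2 * Suc p) * sqnorm I u = c * (c * (c ^ (2 * p) * sqnorm I u))"
      by (simp add: mult_ac)
    moreover have "\<dots> \<le> c * (c * sqnorm I v)"
      using Suc.IH \<open>c \<ge> 0\<close> by (intro mult_left_mono) (auto simp: v_def)
    moreover have "\<dots> \<le> c * sqnorm I (mat_vec I (adjoint_mat A) v)"
      using even \<open>c \<ge> 0\<close> by (rule mult_left_mono)
    ultimately show ?case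
      using odd by (simp add: v_def)
  qed (use assms in simp)
  then show ?thesis ..
qed

section \<open>Operator matrices\<close>

lemma bop_scaleC: "x \<in> bop \<Longrightarrow> blinfun_apply x (c *\<^sub>C h) = c *\<^sub>C blinfun_apply x h"
  by (simp add: bop_def)

lemma bop_sum:
  "x \<in> bop \<Longrightarrow> blinfun_apply x (\<Sum>i\<in>I. c i *\<^sub>C h i) = (\<Sum>i\<in>I. c i *\<^sub>C blinfun_apply x (h i))"
  by (simp add: blinfun.sum_right bop_scaleC)

lemma bop_diff: "S \<in> bop \<Longrightarrow> T \<in> bop \<Longrightarrow> S - T \<in> bop"
  by (simp add: bop_def blinfun.diff_left scaleC_diff_right)

lemma scale_op_diff: "scale_op c (S - T) = scale_op c S - scale_op c T"
  by (rule blinfun_eqI) (simp add: scale_op.rep_eq blinfun.diff_left scaleC_diff_right)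

lemma scale_op_scale_op: "scale_op c (scale_op d T) = scale_op (c * d) T"
  by (rule blinfun_eqI) (simp add: scale_op.rep_eq scaleC_scaleC)

lemma scale_op_one [simp]: "scale_op 1 T = T"
  by (rule blinfun_eqI) (simp add: scale_op.rep_eq)

lemma scale_op_zero [simp]: "scale_op 0 T = 0"
  by (rule blinfun_eqI) (simp add: scale_op.rep_eq)

definition hsum_norm :: "nat \<Rightarrow> (nat \<Rightarrow> 'a::real_normed_vector) \<Rightarrow> real" where
  "hsum_norm k h = L2_set (\<lambda>j. norm (h j)) {..<k}"

definition mat_apply ::
  "nat \<Rightarrow> (nat \<Rightarrow> nat \<Rightarrow> 'a::complex_hilbert \<Rightarrow>\<^sub>L 'a) \<Rightarrow> (nat \<Rightarrow> 'a) \<Rightarrow> nat \<Rightarrow> 'a" where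
  "mat_apply k x h i = (\<Sum>j<k. blinfun_apply (x i j) (h j))"

lemma hsum_norm_sq: "(hsum_norm k h)\<^sup>2 = (\<Sum>j<k. (norm (h j))\<^sup>2)"
  by (simp add: hsum_norm_def L2_set_def sum_nonneg)

lemma hsum_norm_nonneg [simp]: "0 \<le> hsum_norm k h"
  by (simp add: hsum_norm_def L2_set_nonneg)

lemma hsum_norm_cong: "(\<And>j. j < k \<Longrightarrow> g j = h j) \<Longrightarrow> hsum_norm k g = hsum_norm k h"
  unfolding hsum_norm_def by (rule L2_set_cong) auto

lemma norm_le_hsum_norm: "j < k \<Longrightarrow> norm (h j) \<le> hsum_norm k h"
  unfolding hsum_norm_def by (rule member_le_L2_set) auto

lemma hsum_norm_zero [simp]: "hsum_norm k (\<lambda>j. 0) = 0"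
  by (simp add: hsum_norm_def L2_set_def)

lemma hsum_norm_add_le: "hsum_norm k (\<lambda>j. g j + h j) \<le> hsum_norm k g + hsum_norm k h"
  unfolding hsum_norm_def
  by (rule order_trans[OF L2_set_mono L2_set_triangle_ineq]) (simp_all add: norm_triangle_ineq)

lemma hsum_norm_scaleR: "hsum_norm k (\<lambda>j. r *\<^sub>R h j) = \<bar>r\<bar> * hsum_norm k h"
  by (simp add: hsum_norm_def L2_set_right_distrib)

lemma hsum_norm_scaleC: "hsum_norm k (\<lambda>j. c *\<^sub>C h j) = cmod c * hsum_norm k h"
  by (simp add: hsum_norm_def L2_set_right_distrib norm_scaleC)

lemma sum_norm_le_hsum_norm: "(\<Sum>j<k. norm (h j)) \<le> sqrt (real k) * hsum_norm k h"
  using L2_set_mult_ineq[of "\<lambda>_. 1" "\<lambda>j. norm (h j)" "{..<k}"]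
  by (simp add: hsum_norm_def L2_set_def)

lemma mat_apply_scaleR: "mat_apply k x (\<lambda>j. r *\<^sub>R h j) = (\<lambda>i. r *\<^sub>R mat_apply k x h i)"
  by (simp add: mat_apply_def fun_eq_iff blinfun.scaleR_right scaleR_sum_right)

lemma mat_apply_add:
  "mat_apply k (\<lambda>i j. x i j + y i j) h = (\<lambda>i. mat_apply k x h i + mat_apply k y h i)"
  by (simp add: mat_apply_def fun_eq_iff blinfun.add_left sum.distrib)

lemma mat_apply_scale_op: "mat_apply k (\<lambda>i j. scale_op c (x i j)) h = (\<lambda>i. c *\<^sub>C mat_apply k x h i)"
  by (simp add: mat_apply_def fun_eq_iff scale_op.rep_eq scaleC_sum_right)

lemma mat_norm_eq_Sup: "mat_norm k x = Sup {hsum_norm k (mat_apply k x h) |h. hsum_norm k h \<le> 1}"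
  by (simp add: mat_norm_def hsum_norm_def L2_set_def mat_apply_def)

lemma bdd_above_mat_norm: "bdd_above {hsum_norm k (mat_apply k x h) |h. hsum_norm k h \<le> 1}"
proof (rule bdd_aboveI, safe)
  fix h :: "nat \<Rightarrow> 'a" assume unit: "hsum_norm k h \<le> 1"
  have "norm (mat_apply k x h i) \<le> (\<Sum>j<k. norm (x i j))" for i
    unfolding mat_apply_def
  proof (rule sum_norm_le)
    fix j assume "j \<in> {..<k}"
    then have "norm (x i j) * norm (h j) \<le> norm (x i j) * 1"
      using unit norm_le_hsum_norm[of j k h] by (intro mult_left_mono) auto
    then show "norm (blinfun_apply (x i j) (h j)) \<le> norm (x i j)"
      using norm_blinfun[of "x i j" "h j"] by simp
  qed
  then show "hsum_norm k (mat_apply k x h) \<le> L2_set (\<lambda>i. \<Sum>j<k. norm (x i j)) {..<k}"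
    unfolding hsum_norm_def by (intro L2_set_mono) auto
qed

lemma hsum_norm_mat_apply_unit_le:
  "hsum_norm k h \<le> 1 \<Longrightarrow> hsum_norm k (mat_apply k x h) \<le> mat_norm k x"
  unfolding mat_norm_eq_Sup by (intro cSup_upper bdd_above_mat_norm) auto

lemma mat_norm_nonneg [simp]: "0 \<le> mat_norm k x"
  using hsum_norm_mat_apply_unit_le[of k "\<lambda>_. 0" x] by (simp add: order_trans[OF hsum_norm_nonneg])

lemma hsum_norm_mat_apply_le: "hsum_norm k (mat_apply k x h) \<le> mat_norm k x * hsum_norm k h"
proof (cases "hsum_norm k h = 0")
  case True
  then have "mat_apply k x h = (\<lambda>_. 0)"
    using norm_le_hsum_norm[of _ k h] by (auto simp: mat_apply_def fun_eq_iff intro!: sum.neutral)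
  then show ?thesis using True by simp
next
  case False
  then have positive: "hsum_norm k h > 0"
    by (simp add: less_le)
  let ?h = "\<lambda>j. (1 / hsum_norm k h) *\<^sub>R h j"
  have "hsum_norm k (mat_apply k x ?h) \<le> mat_norm k x"
    using positive by (intro hsum_norm_mat_apply_unit_le) (simp add: hsum_norm_scaleR)
  then show ?thesis
    using positive by (simp add: mat_apply_scaleR hsum_norm_scaleR field_simps)
qed

lemma mat_norm_leI:
  assumes "C \<ge> 0" and "\<And>h. hsum_norm k (mat_apply k x h) \<le> C * hsum_norm k h"
  shows "mat_norm k x \<le> C"
  unfolding mat_norm_eq_Sup
proof (rule cSup_least)
  show "{hsum_norm k (mat_apply k x h) |h. hsum_norm k h \<le> 1} \<noteq> {}"
    by (auto intro: exI[of _ "\<lambda>_. 0"])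
  fix r assume "r \<in> {hsum_norm k (mat_apply k x h) |h. hsum_norm k h \<le> 1}"
  then obtain h where r_eq: "r = hsum_norm k (mat_apply k x h)" and unit: "hsum_norm k h \<le> 1"
    by blast
  have "C * hsum_norm k h \<le> C"
    using unit \<open>C \<ge> 0\<close> by (simp add: mult_left_le)
  then show "r \<le> C"
    using assms(2)[of h] by (simp add: r_eq)
qed

lemma mat_norm_add: "mat_norm k (\<lambda>i j. x i j + y i j) \<le> mat_norm k x + mat_norm k y"
proof (rule mat_norm_leI)
  fix h
  show "hsum_norm k (mat_apply k (\<lambda>i j. x i j + y i j) h) \<le>
      (mat_norm k x + mat_norm k y) * hsum_norm k h"
    unfolding mat_apply_add distrib_right
    by (rule order_trans[OF hsum_norm_add_le]) (intro add_mono hsum_norm_mat_apply_le)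
qed simp

lemma mat_norm_zero [simp]: "mat_norm k (\<lambda>i j. 0) = 0"
  by (rule antisym) (auto intro!: mat_norm_leI simp: mat_apply_def[abs_def])

lemma mat_norm_sum: "mat_norm k (\<lambda>s t. \<Sum>i\<in>I. x i s t) \<le> (\<Sum>i\<in>I. mat_norm k (x i))"
proof (induction I rule: infinite_finite_induct)
  case (insert i I)
  then show ?case
    using mat_norm_add[of k "x i" "\<lambda>s t. \<Sum>i\<in>I. x i s t"] by simp
qed simp_all

lemma mat_norm_scale_op: "mat_norm k (\<lambda>i j. scale_op c (x i j)) \<le> cmod c * mat_norm k x"
proof (rule mat_norm_leI)
  fix h
  show "hsum_norm k (mat_apply k (\<lambda>i j. scale_op c (x i j)) h) \<le>
      cmod c * mat_norm k x * hsum_norm k h"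
    unfolding mat_apply_scale_op hsum_norm_scaleC mult.assoc
    by (intro mult_left_mono hsum_norm_mat_apply_le) simp
qed simp

lemma norm_le_mat_norm:
  fixes x :: "nat \<Rightarrow> nat \<Rightarrow> 'a::complex_hilbert \<Rightarrow>\<^sub>L 'a"
  assumes "i < k" "j < k"
  shows "norm (x i j) \<le> mat_norm k x"
proof (rule norm_blinfun_bound)
  fix h :: 'a
  define g where "g l = (if l = j then h else 0)" for l
  have "mat_apply k x g i = (\<Sum>l<k. if l = j then blinfun_apply (x i j) h else 0)"
    unfolding mat_apply_def g_def by (intro sum.cong) (auto simp: blinfun.zero_right)
  then have "blinfun_apply (x i j) h = mat_apply k x g i"
    using assms by simp
  also have "norm \<dots> \<le> hsum_norm k (mat_apply k x g)"
    by (rule norm_le_hsum_norm[OF assms(1)])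
  also have "\<dots> \<le> mat_norm k x * hsum_norm k g"
    by (rule hsum_norm_mat_apply_le)
  also have "hsum_norm k g = norm h"
  proof -
    have "(hsum_norm k g)\<^sup>2 = (\<Sum>l<k. if l = j then (norm h)\<^sup>2 else 0)"
      unfolding hsum_norm_sq g_def by (intro sum.cong) auto
    then show ?thesis
      using assms(2) by simp
  qed
  finally show "norm (blinfun_apply (x i j) h) \<le> mat_norm k x * norm h" .
qed simp

definition tensor_mat ::
  "nat \<Rightarrow> (nat \<Rightarrow> 'a::complex_hilbert \<Rightarrow>\<^sub>L 'a) \<Rightarrow> (nat \<Rightarrow> nat \<Rightarrow> nat \<Rightarrow> complex) \<Rightarrow> nat \<Rightarrow> nat \<Rightarrow> 'a \<Rightarrow>\<^sub>L 'a"
  where "tensor_mat n x \<beta> s t = (\<Sum>i<n. scale_op (\<beta> i s t) (x i))"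

lemma mat_apply_tensor_mat:
  "mat_apply N (tensor_mat n x \<beta>) h s = (\<Sum>i<n. \<Sum>t<N. \<beta> i s t *\<^sub>C blinfun_apply (x i) (h t))"
  unfolding mat_apply_def tensor_mat_def
  by (subst sum.swap) (simp add: blinfun.sum_left scale_op.rep_eq)

lemma hsum_norm_scalar_mat_le:
  fixes h :: "nat \<Rightarrow> 'a::complex_hilbert"
  assumes "opnorm_le {..<N} {..<N} \<beta> r" "r \<ge> 0"
  shows "hsum_norm N (\<lambda>s. \<Sum>t<N. \<beta> s t *\<^sub>C h t) \<le> r * hsum_norm N h"
proof -
  obtain B where orthonormal: "corthonormal (\<lambda>g. g) B"
    and h_span: "\<And>t. t < N \<Longrightarrow> cproj (\<lambda>g. g) B (h t) = h t"
    using corthonormal_basis_exists[of h "{}" "h ` {..<N}"] by (auto simp: corthonormal_def)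
  have "(\<Sum>t<N. \<beta> s t *\<^sub>C h t) = (\<Sum>t<N. \<beta> s t *\<^sub>C cproj (\<lambda>g. g) B (h t))" for s
    by (simp add: h_span)
  also have "\<dots> s = (\<Sum>f\<in>B. mat_vec {..<N} \<beta> (\<lambda>t. cinner f (h t)) s *\<^sub>C f)" for s
    unfolding cproj_def mat_vec_def scaleC_sum_left scaleC_sum_right
    by (subst sum.swap) (simp add: scaleC_scaleC)
  finally have "(hsum_norm N (\<lambda>s. \<Sum>t<N. \<beta> s t *\<^sub>C h t))\<^sup>2 =
      (\<Sum>f\<in>B. sqnorm {..<N} (mat_vec {..<N} \<beta> (\<lambda>t. cinner f (h t))))"
    by (simp add: hsum_norm_sq norm_corthonormal_sum[OF orthonormal] sqnorm_def sum.swap[of _ B])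
  also have "\<dots> \<le> (\<Sum>f\<in>B. r\<^sup>2 * sqnorm {..<N} (\<lambda>t. cinner f (h t)))"
    by (intro sum_mono opnorm_leD assms)
  also have "\<dots> = (r * hsum_norm N h)\<^sup>2"
    unfolding sqnorm_def power_mult_distrib hsum_norm_sq sum_distrib_left[symmetric]
    by (subst sum.swap) (simp add: cParseval[OF orthonormal h_span])
  finally show ?thesis
    by (rule power2_le_imp_le) (simp add: assms)
qed

lemma mat_norm_elementary_tensor:
  assumes bounded: "opnorm_le {..<N} {..<N} \<beta> r" "r \<ge> 0" and d_bop: "d \<in> bop"
  shows "mat_norm N (\<lambda>s t. scale_op (\<beta> s t) d) \<le> r * norm d"
proof (rule mat_norm_leI)
  fix h
  have "hsum_norm N (mat_apply N (\<lambda>s t. scale_op (\<beta> s t) d) h) =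
      hsum_norm N (\<lambda>s. blinfun_apply d (\<Sum>t<N. \<beta> s t *\<^sub>C h t))"
    by (simp add: mat_apply_def hsum_norm_def scale_op.rep_eq bop_sum[OF d_bop])
  also have "\<dots> \<le> L2_set (\<lambda>s. norm d * norm (\<Sum>t<N. \<beta> s t *\<^sub>C h t)) {..<N}"
    unfolding hsum_norm_def by (intro L2_set_mono norm_blinfun) simp
  also have "\<dots> = norm d * hsum_norm N (\<lambda>s. \<Sum>t<N. \<beta> s t *\<^sub>C h t)"
    by (simp add: hsum_norm_def L2_set_right_distrib)
  also have "\<dots> \<le> norm d * (r * hsum_norm N h)"
    by (intro mult_left_mono hsum_norm_scalar_mat_le bounded) simp
  finally show "hsum_norm N (mat_apply N (\<lambda>s t. scale_op (\<beta> s t) d) h) \<le> r * norm d * hsum_norm N h"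
    by (simp add: mult_ac)
qed (simp add: bounded)

lemma mat_norm_tensor_mat_perturb:
  assumes contraction: "\<And>i. i < n \<Longrightarrow> opnorm_le {..<N} {..<N} (\<beta> i) 1"
    and bop: "\<And>i. i < n \<Longrightarrow> x i \<in> bop" "\<And>i. i < n \<Longrightarrow> y i \<in> bop"
  shows "mat_norm N (tensor_mat n x \<beta>) \<le> mat_norm N (tensor_mat n y \<beta>) + (\<Sum>i<n. norm (x i - y i))"
proof -
  have "tensor_mat n x \<beta> = (\<lambda>s t. tensor_mat n y \<beta> s t + (\<Sum>i<n. scale_op (\<beta> i s t) (x i - y i)))"
    by (simp add: tensor_mat_def scale_op_diff sum_subtractf fun_eq_iff)
  then have "mat_norm N (tensor_mat n x \<beta>) \<le>
      mat_norm N (tensor_mat n y \<beta>) + mat_norm N (\<lambda>s t. \<Sum>i<n. scale_op (\<beta> i s t) (x i - y i))"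
    by (simp only: mat_norm_add)
  also have "mat_norm N (\<lambda>s t. \<Sum>i<n. scale_op (\<beta> i s t) (x i - y i)) \<le>
      (\<Sum>i<n. mat_norm N (\<lambda>s t. scale_op (\<beta> i s t) (x i - y i)))"
    by (rule mat_norm_sum)
  also have "\<dots> \<le> (\<Sum>i<n. norm (x i - y i))"
    using mat_norm_elementary_tensor[OF contraction zero_le_one bop_diff[OF bop]]
    by (intro sum_mono) simp
  finally show ?thesis by simp
qed

section \<open>The minimal tensor norm\<close>

definition tensor_slice ::
  "'b::complex_hilbert \<Rightarrow> ('a::complex_hilbert \<times> 'b) list \<Rightarrow> 'a" where
  "tensor_slice g v = (\<Sum>(h, k)\<leftarrow>v. cinner g k *\<^sub>C h)"

lemma cinner_tensor_slice_right:
  "cinner x (tensor_slice g v) = (\<Sum>(h, k)\<leftarrow>v. cinner g k * cinner x h)"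
  unfolding tensor_slice_def by (induction v) (auto simp: cinner_add_right cinner_scaleC_right)

lemma cinner_tensor_slice_left: "cinner (tensor_slice g v) x = (\<Sum>(h, k)\<leftarrow>v. cinner k g * cinner h x)"
  unfolding tensor_slice_def
  by (induction v) (auto simp: cinner_add_left cinner_scaleC_left cinner_commute[of _ g])

lemma sum_list_sum: "(\<Sum>p\<leftarrow>v. \<Sum>i\<in>I. F p i) = (\<Sum>i\<in>I. \<Sum>p\<leftarrow>v. F p i)"
  for F :: "_ \<Rightarrow> _ \<Rightarrow> 'c::comm_monoid_add"
  by (induction v) (simp_all add: sum.distrib)

lemma tensor_norm_eq:
  assumes orthonormal: "corthonormal f I" and v_span: "\<forall>k\<in>snd ` set v. cproj f I k = k"
  shows "tensor_norm v = sqrt (\<Sum>i\<in>I. (norm (tensor_slice (f i) v))\<^sup>2)"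
proof -
  have "cinner h h' * cinner k k' = (\<Sum>i\<in>I. cinner k (f i) * (cinner (f i) k' * cinner h h'))"
    if "(h', k') \<in> set v" for h k h' k'
  proof -
    have "cproj f I k' = k'" using that v_span by force
    from cinner_expand[OF this, of k] show ?thesis
      by (simp add: sum_distrib_left mult_ac)
  qed
  then have "(\<Sum>(h, k)\<leftarrow>v. \<Sum>(h', k')\<leftarrow>v. cinner h h' * cinner k k') =
      (\<Sum>(h, k)\<leftarrow>v. \<Sum>(h', k')\<leftarrow>v. \<Sum>i\<in>I. cinner k (f i) * (cinner (f i) k' * cinner h h'))"
    by (auto intro!: arg_cong[where f = sum_list] map_cong)
  also have "\<dots> = (\<Sum>i\<in>I. \<Sum>(h, k)\<leftarrow>v. \<Sum>(h', k')\<leftarrow>v. cinner k (f i) * (cinner (f i) k' * cinner h h'))"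
    by (simp add: case_prod_beta' sum_list_sum)
  also have "\<dots> = (\<Sum>i\<in>I. cinner (tensor_slice (f i) v) (tensor_slice (f i) v))"
    unfolding cinner_tensor_slice_left
    by (simp add: cinner_tensor_slice_right case_prod_beta' sum_list_const_mult)
  finally show ?thesis
    unfolding tensor_norm_def by (simp add: cinner_self)
qed

lemma tensor_norm_eq_basis:
  fixes v :: "('a::complex_hilbert \<times> 'b::complex_hilbert) list"
  assumes "corthonormal f I"
  shows "\<exists>B. corthonormal (\<lambda>g. g) B \<and> f ` I \<subseteq> B \<and>
    tensor_norm v = sqrt (\<Sum>g\<in>B. (norm (tensor_slice g v))\<^sup>2)"
proof -
  obtain B :: "'b set" where basis: "corthonormal (\<lambda>g. g) B" "f ` I \<subseteq> B"
      "\<forall>k\<in>snd ` set v. cproj (\<lambda>g. g) B k = k"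
    using corthonormal_basis_exists[OF assms, of "snd ` set v"] by auto
  then have "tensor_norm v = sqrt (\<Sum>g\<in>B. (norm (tensor_slice g v))\<^sup>2)"
    by (intro tensor_norm_eq)
  then show ?thesis
    using basis by blast
qed

lemma tensor_norm_eq_hsum_norm:
  assumes "corthonormal f {..<N}" "\<forall>k\<in>snd ` set v. cproj f {..<N} k = k"
  shows "tensor_norm v = hsum_norm N (\<lambda>t. tensor_slice (f t) v)"
  by (simp add: tensor_norm_eq[OF assms] hsum_norm_def L2_set_def)

lemma hsum_norm_tensor_slice_le:
  assumes orthonormal: "corthonormal f {..<N}"
  shows "hsum_norm N (\<lambda>t. tensor_slice (f t) v) \<le> tensor_norm v"
proof -
  obtain B where basis: "corthonormal (\<lambda>g. g) B" "f ` {..<N} \<subseteq> B"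
    and tensor_norm_v: "tensor_norm v = sqrt (\<Sum>g\<in>B. (norm (tensor_slice g v))\<^sup>2)"
    using tensor_norm_eq_basis[OF orthonormal] by blast
  have "(\<Sum>t<N. (norm (tensor_slice (f t) v))\<^sup>2) = (\<Sum>g\<in>f ` {..<N}. (norm (tensor_slice g v))\<^sup>2)"
    by (simp add: sum.reindex[OF corthonormal_inj_on[OF orthonormal]])
  also have "\<dots> \<le> (\<Sum>g\<in>B. (norm (tensor_slice g v))\<^sup>2)"
    using basis by (intro sum_mono2) (auto simp: corthonormal_finite)
  finally show ?thesis
    by (simp add: tensor_norm_v hsum_norm_def L2_set_def)
qed

lemma sum_list_tensor_apply:
  "(\<Sum>p\<leftarrow>tensor_apply t v. F p) =
   (\<Sum>(a, b)\<leftarrow>t. \<Sum>(h, k)\<leftarrow>v. F (blinfun_apply a h, blinfun_apply b k))"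
  for F :: "_ \<Rightarrow> 'c::comm_monoid_add"
  by (induction t) (auto simp: tensor_apply_def o_def case_prod_beta)

lemma tensor_slice_bop:
  assumes "a \<in> bop"
  shows "(\<Sum>(h, k)\<leftarrow>v. cinner g k *\<^sub>C blinfun_apply a h) = blinfun_apply a (tensor_slice g v)"
  unfolding tensor_slice_def
  by (induction v) (auto simp: blinfun.add_right blinfun.zero_right bop_scaleC[OF assms])

text \<open>
  If every \<open>b i\<close> is the matrix \<open>\<alpha> i\<close> in a finite orthonormal system \<open>f\<close>, the identification of
  \<open>\<Sum>\<^sub>t h\<^sub>t \<otimes> f\<^sub>t\<close> with the vector \<open>(h\<^sub>t)\<close> turns \<open>\<Sum>\<^sub>i \<theta>\<^sub>i \<otimes> b\<^sub>i\<close> into an operator matrix.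
\<close>

context
  fixes f :: "nat \<Rightarrow> 'b::complex_hilbert" and \<theta> :: "nat \<Rightarrow> 'a::complex_hilbert \<Rightarrow>\<^sub>L 'a"
    and b :: "nat \<Rightarrow> 'b \<Rightarrow>\<^sub>L 'b" and \<alpha> :: "nat \<Rightarrow> nat \<Rightarrow> nat \<Rightarrow> complex" and n N :: nat
  assumes orthonormal: "corthonormal f {..<N}" and \<theta>_bop: "\<And>i. i < n \<Longrightarrow> \<theta> i \<in> bop"
    and b_apply: "\<And>i k. i < n \<Longrightarrow> blinfun_apply (b i) k =
        (\<Sum>s<N. (\<Sum>t<N. \<alpha> i s t * cinner (f t) k) *\<^sub>C f s)"
begin

lemma tensor_slice_tensor_apply:
  assumes "s < N"
  shows "tensor_slice (f s) (tensor_apply (map (\<lambda>i. (\<theta> i, b i)) [0..<n]) v) =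
    mat_apply N (tensor_mat n \<theta> \<alpha>) (\<lambda>t. tensor_slice (f t) v) s"
proof -
  have "tensor_slice (f s) (tensor_apply (map (\<lambda>i. (\<theta> i, b i)) [0..<n]) v) =
      (\<Sum>i<n. \<Sum>(h, k)\<leftarrow>v. cinner (f s) (blinfun_apply (b i) k) *\<^sub>C blinfun_apply (\<theta> i) h)"
    unfolding tensor_slice_def sum_list_tensor_apply
    by (simp add: o_def interv_sum_list_conv_sum_set_nat atLeast0LessThan)
  also have "\<dots> = (\<Sum>i<n. \<Sum>t<N. \<alpha> i s t *\<^sub>C blinfun_apply (\<theta> i) (tensor_slice (f t) v))"
  proof (intro sum.cong refl)
    fix i assume i_mem: "i \<in> {..<n}"
    have "cinner (f s) (blinfun_apply (b i) k) = (\<Sum>t<N. \<alpha> i s t * cinner (f t) k)" for k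
      using i_mem assms by (simp add: b_apply cinner_corthonormal_sum[OF orthonormal])
    then have "(\<Sum>(h, k)\<leftarrow>v. cinner (f s) (blinfun_apply (b i) k) *\<^sub>C blinfun_apply (\<theta> i) h) =
        (\<Sum>t<N. \<alpha> i s t *\<^sub>C (\<Sum>(h, k)\<leftarrow>v. cinner (f t) k *\<^sub>C blinfun_apply (\<theta> i) h))"
      by (induction v) (auto simp: scaleC_add_right sum.distrib scaleC_scaleC scaleC_sum_left)
    then show "(\<Sum>(h, k)\<leftarrow>v. cinner (f s) (blinfun_apply (b i) k) *\<^sub>C blinfun_apply (\<theta> i) h) =
        (\<Sum>t<N. \<alpha> i s t *\<^sub>C blinfun_apply (\<theta> i) (tensor_slice (f t) v))"
      using i_mem by (simp add: tensor_slice_bop \<theta>_bop)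
  qed
  finally show ?thesis
    by (simp add: mat_apply_tensor_mat)
qed

lemma tensor_norm_tensor_apply:
  "tensor_norm (tensor_apply (map (\<lambda>i. (\<theta> i, b i)) [0..<n]) v) =
    hsum_norm N (mat_apply N (tensor_mat n \<theta> \<alpha>) (\<lambda>t. tensor_slice (f t) v))"
proof -
  have "\<forall>k\<in>snd ` set (tensor_apply (map (\<lambda>i. (\<theta> i, b i)) [0..<n]) v). cproj f {..<N} k = k"
    by (auto simp: tensor_apply_def b_apply cproj_corthonormal_sum[OF orthonormal])
  from tensor_norm_eq_hsum_norm[OF orthonormal this] show ?thesis
    by (simp add: tensor_slice_tensor_apply cong: hsum_norm_cong)
qed

lemma hsum_norm_eq_tensor_norm:
  defines "v \<equiv> \<lambda>h. map (\<lambda>t. (h t, f t)) [0..<N]"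
  shows "tensor_norm (v h) = hsum_norm N h"
    and "tensor_norm (tensor_apply (map (\<lambda>i. (\<theta> i, b i)) [0..<n]) (v h)) =
      hsum_norm N (mat_apply N (tensor_mat n \<theta> \<alpha>) h)"
proof -
  have slice: "tensor_slice (f t) (v h) = h t" if "t < N" for t
  proof -
    have "tensor_slice (f t) (v h) = (\<Sum>s<N. cinner (f t) (f s) *\<^sub>C h s)"
      by (simp add: tensor_slice_def v_def o_def interv_sum_list_conv_sum_set_nat atLeast0LessThan)
    also have "\<dots> = (\<Sum>s<N. if t = s then h s else 0)"
      using that orthonormal by (intro sum.cong) (auto simp: corthonormal_def)
    finally show ?thesis using that by simp
  qed
  have "\<forall>k\<in>snd ` set (v h). cproj f {..<N} k = k"
    by (auto simp: v_def intro: cproj_member[OF orthonormal])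
  from tensor_norm_eq_hsum_norm[OF orthonormal this] show "tensor_norm (v h) = hsum_norm N h"
    by (simp add: slice cong: hsum_norm_cong)
  show "tensor_norm (tensor_apply (map (\<lambda>i. (\<theta> i, b i)) [0..<n]) (v h)) =
      hsum_norm N (mat_apply N (tensor_mat n \<theta> \<alpha>) h)"
    by (simp add: tensor_norm_tensor_apply mat_apply_def[abs_def] slice)
qed

lemma min_norm_eq_mat_norm:
  "min_norm (map (\<lambda>i. (\<theta> i, b i)) [0..<n]) = mat_norm N (tensor_mat n \<theta> \<alpha>)"
proof -
  let ?t = "map (\<lambda>i. (\<theta> i, b i)) [0..<n]"
  have "{tensor_norm (tensor_apply ?t v) |v. tensor_norm v \<le> 1} =
      {hsum_norm N (mat_apply N (tensor_mat n \<theta> \<alpha>) h) |h. hsum_norm N h \<le> 1}"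
  proof (intro set_eqI iffI)
    fix r assume "r \<in> {tensor_norm (tensor_apply ?t v) |v. tensor_norm v \<le> 1}"
    then show "r \<in> {hsum_norm N (mat_apply N (tensor_mat n \<theta> \<alpha>) h) |h. hsum_norm N h \<le> 1}"
      using tensor_norm_tensor_apply hsum_norm_tensor_slice_le[OF orthonormal] order_trans by blast
  next
    fix r assume "r \<in> {hsum_norm N (mat_apply N (tensor_mat n \<theta> \<alpha>) h) |h. hsum_norm N h \<le> 1}"
    then obtain h where "hsum_norm N h \<le> 1" "r = hsum_norm N (mat_apply N (tensor_mat n \<theta> \<alpha>) h)"
      by blast
    then show "r \<in> {tensor_norm (tensor_apply ?t v) |v. tensor_norm v \<le> 1}"
      by (intro CollectI exI[of _ "map (\<lambda>t. (h t, f t)) [0..<N]"])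
        (simp add: hsum_norm_eq_tensor_norm)
  qed
  then show ?thesis
    by (simp add: min_norm_def mat_norm_eq_Sup)
qed

end

section \<open>Truncation of compact operators\<close>

lift_definition matop :: "nat \<Rightarrow> (nat \<Rightarrow> nat \<Rightarrow> complex) \<Rightarrow> ell2 \<Rightarrow>\<^sub>L ell2" is
  "\<lambda>N \<alpha> h. evec N (mat_vec {..<N} \<alpha> (ell2_nth h))"
proof (rule bounded_linear_intro)
  fix N and \<alpha> :: "nat \<Rightarrow> nat \<Rightarrow> complex" and g h :: ell2 and r :: real
  let ?T = "\<lambda>h. evec N (mat_vec {..<N} \<alpha> (ell2_nth h))"
  show "?T (g + h) = ?T g + ?T h"
    unfolding evec_add[symmetric]
    by (rule evec_cong) (simp add: mat_vec_def ell2_nth_add distrib_left sum.distrib)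
  show "?T (r *\<^sub>R h) = r *\<^sub>R ?T h"
    unfolding evec_scaleR[symmetric]
    by (rule evec_cong) (simp add: mat_vec_def ell2_nth_scaleR sum_distrib_left mult_ac)
  have "norm (?T h) = L2_set (\<lambda>s. cmod (mat_vec {..<N} \<alpha> (ell2_nth h) s)) {..<N}"
    unfolding L2_set_def norm_evec_sq[symmetric] by simp
  also have "\<dots> \<le> (\<Sum>s<N. cmod (mat_vec {..<N} \<alpha> (ell2_nth h) s))"
    by (rule L2_set_le_sum) simp
  also have "\<dots> \<le> (\<Sum>s<N. \<Sum>t<N. cmod (\<alpha> s t) * norm h)"
    unfolding mat_vec_def
    by (intro sum_mono sum_norm_le) (simp add: norm_mult mult_left_mono cmod_ell2_nth_le)
  finally show "norm (?T h) \<le> norm h * (\<Sum>s<N. \<Sum>t<N. cmod (\<alpha> s t))"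
    by (simp add: sum_distrib_left mult.commute)
qed

definition op_entry :: "(ell2 \<Rightarrow>\<^sub>L ell2) \<Rightarrow> nat \<Rightarrow> nat \<Rightarrow> complex" where
  "op_entry x a b = ell2_nth (blinfun_apply x (ebase b)) a"

definition corner :: "nat \<Rightarrow> (ell2 \<Rightarrow>\<^sub>L ell2) \<Rightarrow> ell2 \<Rightarrow>\<^sub>L ell2" where
  "corner k x = matop k (op_entry x)"

lemma matop_bop: "matop N \<alpha> \<in> bop"
  unfolding bop_def
proof (intro CollectI allI)
  fix c h
  show "blinfun_apply (matop N \<alpha>) (c *\<^sub>C h) = c *\<^sub>C blinfun_apply (matop N \<alpha>) h"
    unfolding matop.rep_eq evec_scaleC[symmetric]
    by (rule evec_cong) (simp add: mat_vec_def ell2_nth_scaleC sum_distrib_left mult_ac)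
qed

lemma corner_bop: "corner k x \<in> bop"
  by (simp add: corner_def matop_bop)

lemma matop_eq_sum_ebase:
  "blinfun_apply (matop N \<alpha>) h = (\<Sum>s<N. (\<Sum>t<N. \<alpha> s t * cinner (ebase t) h) *\<^sub>C ebase s)"
  by (simp add: matop.rep_eq mat_vec_def evec_eq_sum_ebase cinner_ebase)

lemma ell2_nth_bop_evec:
  assumes "x \<in> bop"
  shows "ell2_nth (blinfun_apply x (evec k g)) a = mat_vec {..<k} (op_entry x) g a"
  by (simp add: evec_eq_sum_ebase bop_sum[OF assms] ell2_nth_sum ell2_nth_scaleC mat_vec_def
      op_entry_def mult.commute)

lemma corner_eq_truncation:
  assumes "x \<in> bop"
  shows "corner k x = truncation k o\<^sub>L x o\<^sub>L truncation k"
  by (rule blinfun_eqI)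
    (simp add: corner_def matop.rep_eq truncation.rep_eq ell2_nth_bop_evec[OF assms]
        cong: evec_cong)

lemma norm_blinfun_bound_unit:
  assumes "e \<ge> 0" and "\<And>h. norm h \<le> 1 \<Longrightarrow> norm (blinfun_apply f h) \<le> e"
  shows "norm f \<le> e"
proof (rule norm_blinfun_bound)
  fix h
  show "norm (blinfun_apply f h) \<le> e * norm h"
  proof (cases "h = 0")
    case False
    have "norm (blinfun_apply f ((1 / norm h) *\<^sub>R h)) \<le> e"
      using False by (intro assms(2)) simp
    then show ?thesis
      using False by (simp add: blinfun.scaleR_right field_simps)
  qed (simp add: blinfun.zero_right)
qed (rule assms(1))

lemma truncation_compact_op_tendsto:
  assumes "x \<in> compact_ops"
  shows "(\<lambda>k. truncation k o\<^sub>L x) \<longlonglongrightarrow> x"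
proof (rule LIMSEQ_I)
  fix r :: real assume "r > 0"
  define e where "e = r / 4"
  have e_pos: "e > 0" using \<open>r > 0\<close> by (simp add: e_def)
  have "compact (closure (blinfun_apply x ` cball 0 1))"
    using assms by (simp add: compact_ops_def)
  then obtain Y where cover: "finite Y" "closure (blinfun_apply x ` cball 0 1) \<subseteq> (\<Union>y\<in>Y. ball y e)"
    using e_pos unfolding compact_eq_totally_bounded by meson
  have "\<forall>\<^sub>F k in sequentially. \<forall>y\<in>Y. dist (blinfun_apply (truncation k) y) y < e"
    using cover(1) tendstoD[OF truncation_tendsto e_pos] by (simp add: eventually_ball_finite)
  then obtain k0 where close: "\<And>k y. k \<ge> k0 \<Longrightarrow> y \<in> Y \<Longrightarrow> norm (blinfun_apply (truncation k) y - y) < e"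
    by (auto simp: eventually_sequentially dist_norm)
  have "norm ((truncation k o\<^sub>L x) - x) < r" if "k \<ge> k0" for k
  proof -
    have "norm ((truncation k o\<^sub>L x) - x) \<le> 3 * e"
    proof (rule norm_blinfun_bound_unit)
      fix h :: ell2 assume "norm h \<le> 1"
      then have "blinfun_apply x h \<in> closure (blinfun_apply x ` cball 0 1)"
        by (intro subsetD[OF closure_subset]) auto
      then obtain y where y_close: "y \<in> Y" "norm (blinfun_apply x h - y) < e"
        using cover(2) by (auto simp: dist_norm norm_minus_commute)
      let ?T = "blinfun_apply (truncation k)"
      have "?T (blinfun_apply x h) - blinfun_apply x h =
          ?T (blinfun_apply x h - y) + (?T y - y) + (y - blinfun_apply x h)"
        by (simp add: blinfun.diff_right)
      also have "norm \<dots> \<le> norm (?T (blinfun_apply x h - y)) + norm (?T y - y) +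
          norm (y - blinfun_apply x h)"
        by (intro norm_triangle_le add_mono norm_triangle_ineq order_refl)
      also have "\<dots> \<le> 3 * e"
        using norm_truncation_apply_le[of k "blinfun_apply x h - y"]
          close[OF that y_close(1)] y_close(2)
        by (simp add: norm_minus_commute)
      finally show "norm (blinfun_apply ((truncation k o\<^sub>L x) - x) h) \<le> 3 * e"
        by (simp add: blinfun.diff_left)
    qed (use e_pos in simp)
    then show ?thesis using \<open>r > 0\<close> by (simp add: e_def)
  qed
  then show "\<exists>k0. \<forall>k\<ge>k0. norm ((truncation k o\<^sub>L x) - x) < r" by blast
qed

lemma bop_rows_exist:
  assumes "x \<in> bop"
  shows "\<exists>Y. \<forall>a h. ell2_nth (blinfun_apply x h) a = cinner (Y a) h"
proof (intro choice allI, rule ell2_Riesz)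
  show "bounded_linear (\<lambda>h. ell2_nth (blinfun_apply x h) a)" for a
    by (rule bounded_linear_compose[OF bounded_linear_ell2_nth, of "blinfun_apply x" a])
      (rule blinfun.bounded_linear_right)
qed (simp add: bop_scaleC[OF assms] ell2_nth_scaleC)

lemma truncation_bop_truncation_tendsto:
  assumes "x \<in> bop"
  shows "(\<lambda>l. truncation k o\<^sub>L x o\<^sub>L truncation l) \<longlonglongrightarrow> (truncation k o\<^sub>L x)"
proof -
  obtain Y where rows: "\<And>a h. ell2_nth (blinfun_apply x h) a = cinner (Y a) h"
    using bop_rows_exist[OF assms] by blast
  have bound: "norm ((truncation k o\<^sub>L x o\<^sub>L truncation l) - (truncation k o\<^sub>L x)) \<le>
      (\<Sum>a<k. norm (blinfun_apply (truncation l) (Y a) - Y a))" for l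
  proof (rule norm_blinfun_bound)
    fix h
    let ?d = "\<lambda>a. blinfun_apply (truncation l) (Y a) - Y a"
    have "blinfun_apply ((truncation k o\<^sub>L x o\<^sub>L truncation l) - (truncation k o\<^sub>L x)) h =
        evec k (\<lambda>a. cinner (?d a) h)"
    proof -
      have "blinfun_apply (truncation k o\<^sub>L x o\<^sub>L truncation l) h -
          blinfun_apply (truncation k o\<^sub>L x) h =
          blinfun_apply (truncation k) (blinfun_apply x (blinfun_apply (truncation l) h - h))"
        by (simp add: blinfun.diff_right)
      also have "\<dots> = evec k (\<lambda>a. cinner (?d a) h)"
        by (simp add: truncation.rep_eq[of k] rows cinner_diff_left cinner_diff_right
            cinner_truncation cong: evec_cong)
      finally show ?thesis by (simp add: blinfun.diff_left)
    qed
    also have "norm \<dots> = L2_set (\<lambda>a. cmod (cinner (?d a) h)) {..<k}"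
      unfolding L2_set_def norm_evec_sq[symmetric] by simp
    also have "\<dots> \<le> (\<Sum>a<k. cmod (cinner (?d a) h))"
      by (rule L2_set_le_sum) simp
    also have "\<dots> \<le> (\<Sum>a<k. norm (?d a)) * norm h"
      unfolding sum_distrib_right by (intro sum_mono cmod_cinner_le)
    finally show
        "norm (blinfun_apply ((truncation k o\<^sub>L x o\<^sub>L truncation l) - (truncation k o\<^sub>L x)) h) \<le>
        (\<Sum>a<k. norm (?d a)) * norm h" .
  qed (simp add: sum_nonneg)
  have "(\<lambda>l. \<Sum>a<k. norm (blinfun_apply (truncation l) (Y a) - Y a)) \<longlonglongrightarrow> 0"
    by (intro tendsto_null_sum tendsto_norm_zero) (rule LIM_zero[OF truncation_tendsto])
  from Lim_null_comparison[OF always_eventually[OF allI[OF bound]] this] show ?thesis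
    by (rule LIM_zero_cancel)
qed

lemma compact_op_truncation_tendsto:
  assumes compact: "x \<in> compact_ops"
  shows "(\<lambda>l. x o\<^sub>L truncation l) \<longlonglongrightarrow> x"
proof (rule LIMSEQ_I)
  fix r :: real assume "r > 0"
  then have r_pos: "r / 3 > 0" by simp
  obtain k where left_close: "norm ((truncation k o\<^sub>L x) - x) < r / 3"
    using LIMSEQ_D[OF truncation_compact_op_tendsto[OF compact] r_pos] by blast
  let ?y = "truncation k o\<^sub>L x"
  have "x \<in> bop" using compact by (simp add: compact_ops_def)
  then obtain l0 where right_close: "\<And>l. l \<ge> l0 \<Longrightarrow> norm ((?y o\<^sub>L truncation l) - ?y) < r / 3"
    using LIMSEQ_D[OF truncation_bop_truncation_tendsto r_pos] by blast
  have "norm ((x o\<^sub>L truncation l) - x) < r" if "l \<ge> l0" for l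
  proof -
    have "(x o\<^sub>L truncation l) - x =
        ((x - ?y) o\<^sub>L truncation l) + ((?y o\<^sub>L truncation l) - ?y) + (?y - x)"
      by (rule blinfun_eqI) (simp add: blinfun.diff_left blinfun.add_left)
    also have "norm \<dots> \<le> norm ((x - ?y) o\<^sub>L truncation l) + norm ((?y o\<^sub>L truncation l) - ?y) +
        norm (?y - x)"
      by (intro norm_triangle_le add_mono norm_triangle_ineq order_refl)
    also have "norm ((x - ?y) o\<^sub>L truncation l) \<le> norm (x - ?y) * norm (truncation l)"
      by (rule norm_blinfun_compose)
    also have "\<dots> \<le> norm (?y - x)"
      using norm_truncation_le[of l] by (simp add: mult_left_le norm_minus_commute)
    finally show ?thesis
      using left_close right_close[OF that] by linarith
  qed
  then show "\<exists>l0. \<forall>l\<ge>l0. norm ((x o\<^sub>L truncation l) - x) < r" by blast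
qed

lemma corner_tendsto:
  assumes compact: "x \<in> compact_ops"
  shows "(\<lambda>k. corner k x) \<longlonglongrightarrow> x"
proof -
  have x_bop: "x \<in> bop" using compact by (simp add: compact_ops_def)
  have bound: "norm (corner k x - x) \<le>
      norm ((x o\<^sub>L truncation k) - x) + norm ((truncation k o\<^sub>L x) - x)" for k
  proof -
    let ?T = "truncation k"
    have "corner k x - x = (?T o\<^sub>L ((x o\<^sub>L ?T) - x)) + ((?T o\<^sub>L x) - x)"
      unfolding corner_eq_truncation[OF x_bop]
      by (rule blinfun_eqI) (simp add: blinfun.diff_left blinfun.add_left blinfun.diff_right)
    also have "norm \<dots> \<le> norm (?T o\<^sub>L ((x o\<^sub>L ?T) - x)) + norm ((?T o\<^sub>L x) - x)"
      by (rule norm_triangle_ineq)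
    also have "norm (?T o\<^sub>L ((x o\<^sub>L ?T) - x)) \<le> norm ?T * norm ((x o\<^sub>L ?T) - x)"
      by (rule norm_blinfun_compose)
    also have "\<dots> \<le> norm ((x o\<^sub>L ?T) - x)"
      using norm_truncation_le[of k] by (simp add: mult_left_le_one_le)
    finally show ?thesis by simp
  qed
  have "(\<lambda>k. norm ((x o\<^sub>L truncation k) - x) + norm ((truncation k o\<^sub>L x) - x)) \<longlonglongrightarrow> 0"
    by (intro tendsto_add_zero tendsto_norm_zero LIM_zero
        compact_op_truncation_tendsto truncation_compact_op_tendsto compact)
  from Lim_null_comparison[OF always_eventually[OF allI[OF bound]] this] show ?thesis
    by (rule LIM_zero_cancel)
qed

section \<open>Tensors of scalar matrices\<close>

lemma to_cconj_sum: "to_cconj (\<Sum>i\<in>I. f i) = (\<Sum>i\<in>I. to_cconj (f i))"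
  for f :: "_ \<Rightarrow> 'a::complex_hilbert"
  by (rule linear_sum[OF bounded_linear.linear[OF to_cconj_bounded_linear]])

lemma conj_matop_eq_sum_ebase:
  "blinfun_apply (conj_op (matop N \<alpha>)) h =
   (\<Sum>s<N. (\<Sum>t<N. cnj (\<alpha> s t) * cinner (to_cconj (ebase t)) h) *\<^sub>C to_cconj (ebase s))"
proof -
  have "to_cconj (c *\<^sub>C x) = cnj c *\<^sub>C to_cconj x" for c and x :: ell2
    by (simp add: scaleC_cconj.abs_eq)
  moreover have "cinner (to_cconj x) h = cnj (cinner x (of_cconj h))" for x
    by (simp add: cinner_cconj.rep_eq to_cconj_inverse)
  ultimately show ?thesis
    by (simp add: conj_op.rep_eq matop_eq_sum_ebase to_cconj_sum)
qed

lemma min_norm_matop: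
  assumes "\<And>i. i < n \<Longrightarrow> \<theta> i \<in> bop"
  shows "min_norm (map (\<lambda>i. (\<theta> i, matop N (\<alpha> i))) [0..<n]) = mat_norm N (tensor_mat n \<theta> \<alpha>)"
  using assms by (intro min_norm_eq_mat_norm[OF corthonormal_ebase])
    (simp_all add: matop_eq_sum_ebase)

lemma min_norm_matop_conj:
  "min_norm (map (\<lambda>i. (matop N (\<alpha> i), conj_op (matop N (\<alpha> i)))) [0..<n]) =
    mat_norm N (tensor_mat n (\<lambda>i. matop N (\<alpha> i)) (\<lambda>i s t. cnj (\<alpha> i s t)))"
proof (rule min_norm_eq_mat_norm)
  show "corthonormal (\<lambda>s. to_cconj (ebase s)) {..<N}"
    using corthonormal_ebase[of "{..<N}"] by (simp add: corthonormal_def cinner_cconj.abs_eq)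
qed (simp_all add: matop_bop conj_matop_eq_sum_ebase)

lemma mat_norm_matop_le:
  assumes "opnorm_le ({..<k} \<times> {..<N}) ({..<k} \<times> {..<N}) (kron_sum n X \<beta>) r" "r \<ge> 0"
  shows "mat_norm N (tensor_mat n (\<lambda>i. matop k (X i)) \<beta>) \<le> r"
proof (rule mat_norm_leI[OF assms(2)])
  fix h :: "nat \<Rightarrow> ell2"
  let ?J = "{..<k} \<times> {..<N}"
  define g where "g y = ell2_nth (h (snd y)) (fst y)" for y
  have "mat_apply N (tensor_mat n (\<lambda>i. matop k (X i)) \<beta>) h s =
      evec k (\<lambda>a. mat_vec ?J (kron_sum n X \<beta>) g (a, s))" for s
    by (simp add: mat_apply_tensor_mat mat_vec_kron_sum matop.rep_eq g_def evec_sum evec_scaleC)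
  then have "(hsum_norm N (mat_apply N (tensor_mat n (\<lambda>i. matop k (X i)) \<beta>) h))\<^sup>2 =
      sqnorm ?J (mat_vec ?J (kron_sum n X \<beta>) g)"
    by (simp add: hsum_norm_sq sqnorm_Times sqnorm_evec)
  also have "\<dots> \<le> r\<^sup>2 * sqnorm ?J g"
    by (rule opnorm_leD[OF assms(1)])
  also have "\<dots> \<le> r\<^sup>2 * (hsum_norm N h)\<^sup>2"
    unfolding sqnorm_Times hsum_norm_sq
    by (intro mult_left_mono sum_mono) (simp_all add: g_def sqnorm_def sum_le_norm_ell2)
  finally have "(hsum_norm N (mat_apply N (tensor_mat n (\<lambda>i. matop k (X i)) \<beta>) h))\<^sup>2 \<le>
      (r * hsum_norm N h)\<^sup>2"
    by (simp add: power_mult_distrib)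
  then show "hsum_norm N (mat_apply N (tensor_mat n (\<lambda>i. matop k (X i)) \<beta>) h) \<le> r * hsum_norm N h"
    by (rule power2_le_imp_le) (simp add: assms(2))
qed

lemma opnorm_le_op_entry:
  assumes x_bop: "\<And>i. i < n \<Longrightarrow> x i \<in> bop"
  shows "opnorm_le ({..<k} \<times> {..<N}) ({..<k} \<times> {..<N}) (kron_sum n (\<lambda>i. op_entry (x i)) \<beta>)
    (mat_norm N (tensor_mat n x \<beta>))"
  unfolding opnorm_le_def
proof
  fix g :: "nat \<times> nat \<Rightarrow> complex"
  let ?J = "{..<k} \<times> {..<N}" and ?M = "kron_sum n (\<lambda>i. op_entry (x i)) \<beta>"
  define h where "h t = evec k (\<lambda>b. g (b, t))" for t
  have "mat_vec ?J ?M g (a, s) = ell2_nth (mat_apply N (tensor_mat n x \<beta>) h s) a" for a s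
    by (simp add: mat_apply_tensor_mat mat_vec_kron_sum ell2_nth_sum ell2_nth_scaleC h_def
        ell2_nth_bop_evec[OF x_bop])
  then have "sqnorm ?J (mat_vec ?J ?M g) \<le> (hsum_norm N (mat_apply N (tensor_mat n x \<beta>) h))\<^sup>2"
    unfolding sqnorm_Times hsum_norm_sq by (simp add: sqnorm_def sum_mono sum_le_norm_ell2)
  also have "\<dots> \<le> (mat_norm N (tensor_mat n x \<beta>) * hsum_norm N h)\<^sup>2"
    by (intro power_mono hsum_norm_mat_apply_le) simp
  also have "\<dots> = (mat_norm N (tensor_mat n x \<beta>))\<^sup>2 * sqnorm ?J g"
    by (simp add: power_mult_distrib hsum_norm_sq h_def sqnorm_Times sqnorm_evec)
  finally show "sqnorm ?J (mat_vec ?J ?M g) \<le> (mat_norm N (tensor_mat n x \<beta>))\<^sup>2 * sqnorm ?J g" .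
qed

text \<open>Test on the maximally entangled vector \<open>\<Sum>\<^sub>t e\<^sub>t \<otimes> e\<^sub>t\<close>.\<close>

lemma hs_sqnorm_le_mat_norm_conj:
  "(\<Sum>i<n. hs_sqnorm {..<N} (\<alpha> i)) \<le>
    real N * mat_norm N (tensor_mat n (\<lambda>i. matop N (\<alpha> i)) (\<lambda>i s t. cnj (\<alpha> i s t)))"
    (is "_ \<le> real N * mat_norm N ?z")
proof -
  define w where "w = mat_apply N ?z ebase"
  have "(\<Sum>i<n. sqnorm {..<N} (\<alpha> i s)) \<le> norm (w s)" if "s < N" for s
  proof -
    have "mat_vec {..<N} (\<alpha> i) (ell2_nth (ebase t)) s = \<alpha> i s t" if "t < N" for i t
    proof -
      have "mat_vec {..<N} (\<alpha> i) (ell2_nth (ebase t)) s = (\<Sum>r<N. if r = t then \<alpha> i s r else 0)"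
        unfolding mat_vec_def ell2_nth_ebase by (intro sum.cong) auto
      then show ?thesis using that by simp
    qed
    then have "ell2_nth (w s) s = of_real (\<Sum>i<n. sqnorm {..<N} (\<alpha> i s))"
      using \<open>s < N\<close>
      by (simp add: w_def mat_apply_tensor_mat ell2_nth_sum ell2_nth_scaleC matop.rep_eq evec.rep_eq
          sqnorm_def complex_norm_square mult.commute del: of_real_power)
    then have "(\<Sum>i<n. sqnorm {..<N} (\<alpha> i s)) = cmod (ell2_nth (w s) s)"
      by (simp only: norm_of_real) (simp add: sum_nonneg sqnorm_nonneg)
    then show ?thesis
      by (simp add: cmod_ell2_nth_le)
  qed
  then have "(\<Sum>s<N. \<Sum>i<n. sqnorm {..<N} (\<alpha> i s)) \<le> (\<Sum>s<N. norm (w s))"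
    by (intro sum_mono) simp
  also have "\<dots> \<le> sqrt (real N) * hsum_norm N w"
    by (rule sum_norm_le_hsum_norm)
  also have "\<dots> \<le> sqrt (real N) * (mat_norm N ?z * hsum_norm N ebase)"
    unfolding w_def by (intro mult_left_mono hsum_norm_mat_apply_le) simp
  also have "hsum_norm N ebase = sqrt (real N)"
    using norm_corthonormal[OF corthonormal_ebase[of "{..<N}"]]
    by (simp add: hsum_norm_def L2_set_def)
  also have "sqrt (real N) * (mat_norm N ?z * sqrt (real N)) = real N * mat_norm N ?z"
    unfolding mult.left_commute[of "sqrt (real N)"] by (simp add: mult.commute)
  finally show ?thesis
    unfolding hs_sqnorm_def by (subst sum.swap)
qed

section \<open>The regular tree\<close>

definition graph_mat :: "(nat \<Rightarrow> 'v \<Rightarrow> 'v) \<Rightarrow> nat \<Rightarrow> 'v \<Rightarrow> 'v \<Rightarrow> complex" where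
  "graph_mat \<phi> i s t = (if t = \<phi> i s then 1 else 0)"

definition symmetric_on :: "nat \<Rightarrow> (nat \<Rightarrow> 'v \<Rightarrow> 'v) \<Rightarrow> 'v set \<Rightarrow> bool" where
  "symmetric_on n \<phi> V \<longleftrightarrow> (\<forall>i<n. \<forall>s\<in>V. \<forall>t\<in>V. t = \<phi> i s \<longleftrightarrow> s = \<phi> i t)"

lemma symmetric_onD: "symmetric_on n \<phi> V \<Longrightarrow> i < n \<Longrightarrow> s \<in> V \<Longrightarrow> t \<in> V \<Longrightarrow> t = \<phi> i s \<longleftrightarrow> s = \<phi> i t"
  unfolding symmetric_on_def by blast

lemma adjoint_graph_mat:
  assumes "symmetric_on n \<phi> V" "i < n" "s \<in> V" "t \<in> V"
  shows "adjoint_mat (graph_mat \<phi> i) s t = graph_mat \<phi> i s t"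
  using symmetric_onD[OF assms] by (simp add: adjoint_mat_def graph_mat_def)

lemma mat_vec_kron_sum_graph_mat:
  assumes "finite V"
  shows "mat_vec (K \<times> V) (kron_sum n X (graph_mat \<phi>)) g (a, s) =
    (\<Sum>i<n. if \<phi> i s \<in> V then mat_vec K (X i) (\<lambda>b. g (b, \<phi> i s)) a else 0)"
proof -
  have "(\<Sum>t\<in>V. graph_mat \<phi> i s t * mat_vec K (X i) (\<lambda>b. g (b, t)) a) =
      (\<Sum>t\<in>V. if t = \<phi> i s then mat_vec K (X i) (\<lambda>b. g (b, t)) a else 0)" for i
    by (intro sum.cong) (auto simp: graph_mat_def)
  then show ?thesis
    using assms by (simp add: mat_vec_kron_sum)
qed

lemma gram_map_kron_sum_graph_mat:
  assumes "symmetric_on n \<phi> V"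
  shows "gram_map (K \<times> V) (kron_sum n X (graph_mat \<phi>)) g =
    mat_vec (K \<times> V) (kron_sum n X (graph_mat \<phi>))
      (mat_vec (K \<times> V) (kron_sum n (\<lambda>i. adjoint_mat (X i)) (graph_mat \<phi>)) g)"
  unfolding gram_map_def
proof (rule mat_vec_cong)
  fix y assume y_mem: "y \<in> K \<times> V"
  have "(\<Sum>i<n. \<Sum>t\<in>V. adjoint_mat (graph_mat \<phi> i) (snd y) t * f i t) =
      (\<Sum>i<n. \<Sum>t\<in>V. graph_mat \<phi> i (snd y) t * f i t)" for f
    using y_mem by (intro sum.cong refl) (auto simp: adjoint_graph_mat[OF assms])
  then show "mat_vec (K \<times> V) (adjoint_mat (kron_sum n X (graph_mat \<phi>))) g y =
      mat_vec (K \<times> V) (kron_sum n (\<lambda>i. adjoint_mat (X i)) (graph_mat \<phi>)) g y"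
    unfolding adjoint_kron_sum by (cases y) (simp add: mat_vec_kron_sum)
qed

lemma opnorm_le_graph_mat:
  assumes "finite V" "bij_betw (\<phi> i) V V"
  shows "opnorm_le V V (graph_mat \<phi> i) 1"
  unfolding opnorm_le_def
proof
  fix g
  have "mat_vec V (graph_mat \<phi> i) g s = g (\<phi> i s)" if "s \<in> V" for s
  proof -
    have "mat_vec V (graph_mat \<phi> i) g s = (\<Sum>t\<in>V. if t = \<phi> i s then g t else 0)"
      unfolding mat_vec_def by (intro sum.cong) (auto simp: graph_mat_def)
    then show ?thesis
      using bij_betwE[OF assms(2)] that assms(1) by simp
  qed
  from sqnorm_reindex[of "\<phi> i" V V _ g, OF assms(2) this]
  show "sqnorm V (mat_vec V (graph_mat \<phi> i) g) \<le> 1\<^sup>2 * sqnorm V g"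
    by simp
qed

lemma hs_sqnorm_mat_mult_graph_mat:
  assumes "finite V" "bij_betw (\<phi> i) V V"
  shows "hs_sqnorm V (mat_mult V A (graph_mat \<phi> i)) = hs_sqnorm V A"
proof -
  have entry: "A s r = mat_mult V A (graph_mat \<phi> i) s (\<phi> i r)" if "r \<in> V" for r s
  proof -
    have "mat_mult V A (graph_mat \<phi> i) s (\<phi> i r) = (\<Sum>u\<in>V. if u = r then A s u else 0)"
      unfolding mat_mult_def using assms(2) that
      by (intro sum.cong) (auto simp: graph_mat_def bij_betw_def inj_on_eq_iff)
    then show ?thesis using assms(1) that by simp
  qed
  have "sqnorm V (A s) = sqnorm V (mat_mult V A (graph_mat \<phi> i) s)" for s
    using assms(2) entry by (rule sqnorm_reindex)
  then show ?thesis
    by (simp add: hs_sqnorm_def)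
qed

text \<open>
  Fell's absorption principle in its simplest form: a Schur weight for the action on the first
  tensor factor is a Schur weight for the diagonal action.
\<close>

lemma opnorm_le_kron_sum_graph_mat:
  assumes finite_sets: "finite V" "finite W"
    and symmetric: "symmetric_on n \<phi> V" "symmetric_on n \<psi> W"
    and positive: "\<And>v. \<omega> v > 0" and "r \<ge> 0"
    and weight: "\<And>v. v \<in> V \<Longrightarrow> (\<Sum>i<n. \<omega> (\<phi> i v)) \<le> r * \<omega> v"
  shows "opnorm_le (V \<times> W) (V \<times> W) (kron_sum n (graph_mat \<phi>) (graph_mat \<psi>)) r"
proof -
  define A :: "_ \<Rightarrow> _ \<Rightarrow> real" where
    "A x y = (\<Sum>i<n. if y = (\<phi> i (fst x), \<psi> i (snd x)) then 1 else 0)" for x y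
  have "kron_sum n (graph_mat \<phi>) (graph_mat \<psi>) = (\<lambda>x y. of_real (A x y))"
    by (auto simp: kron_sum_def A_def graph_mat_def fun_eq_iff prod_eq_iff intro!: sum.cong)
  moreover have "opnorm_le (V \<times> W) (V \<times> W) (\<lambda>x y. of_real (A x y)) r"
  proof (rule Schur_test[where \<omega> = "\<lambda>x. \<omega> (fst x)"])
    show "A x y = A y x" if "x \<in> V \<times> W" "y \<in> V \<times> W" for x y
      unfolding A_def
    proof (intro sum.cong refl if_cong)
      fix i assume "i \<in> {..<n}"
      then show "y = (\<phi> i (fst x), \<psi> i (snd x)) \<longleftrightarrow> x = (\<phi> i (fst y), \<psi> i (snd y))"
        using that symmetric_onD[OF symmetric(1), of i "fst x" "fst y"]
          symmetric_onD[OF symmetric(2), of i "snd x" "snd y"] by (auto simp: prod_eq_iff)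
    qed
  next
    fix x assume x_mem: "x \<in> V \<times> W"
    have "(\<Sum>y\<in>V \<times> W. A x y * \<omega> (fst y)) =
        (\<Sum>i<n. \<Sum>y\<in>V \<times> W. if y = (\<phi> i (fst x), \<psi> i (snd x)) then \<omega> (fst y) else 0)"
      unfolding A_def sum_distrib_right by (subst sum.swap) (intro sum.cong refl, simp)
    also have "\<dots> \<le> (\<Sum>i<n. \<omega> (\<phi> i (fst x)))"
      using finite_sets positive by (intro sum_mono) (simp add: less_imp_le)
    also have "\<dots> \<le> r * \<omega> (fst x)"
      using weight x_mem by auto
    finally show "(\<Sum>y\<in>V \<times> W. A x y * \<omega> (fst y)) \<le> r * \<omega> (fst x)" .
  qed (use positive \<open>r \<ge> 0\<close> in \<open>auto simp: A_def sum_nonneg\<close>)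
  ultimately show ?thesis by simp
qed

text \<open>
  Words without equal adjacent letters are the elements of the free product of \<open>n\<close> copies of the
  group of order two, and \<open>reduced_Cons i\<close> is left multiplication by the \<open>i\<close>-th generator. The
  Cayley graph is the \<open>n\<close>-regular tree.
\<close>

definition reduced_words :: "nat \<Rightarrow> nat \<Rightarrow> nat list set" where
  "reduced_words n L = {w. set w \<subseteq> {..<n} \<and> length w \<le> L \<and> distinct_adj w}"

fun reduced_Cons :: "nat \<Rightarrow> nat list \<Rightarrow> nat list" where
  "reduced_Cons i [] = [i]"
| "reduced_Cons i (j # w) = (if j = i then w else i # j # w)"

lemma finite_reduced_words: "finite (reduced_words n L)"
  by (rule finite_subset[OF _ finite_lists_length_le[of "{..<n}" L]]) (auto simp: reduced_words_def)

lemma Nil_in_reduced_words: "[] \<in> reduced_words n L"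
  by (simp add: reduced_words_def)

lemma reduced_Cons_reduced_Cons: "distinct_adj w \<Longrightarrow> reduced_Cons i (reduced_Cons i w) = w"
  by (cases w rule: remdups_adj.cases) auto

lemma reduced_Cons_in_reduced_words:
  "w \<in> reduced_words n L \<Longrightarrow> i < n \<Longrightarrow> length w < L \<Longrightarrow> reduced_Cons i w \<in> reduced_words n L"
  by (cases w) (auto simp: reduced_words_def distinct_adj_Cons)

lemma length_le_Suc_length_reduced_Cons: "length w \<le> Suc (length (reduced_Cons i w))"
  by (cases w) auto

lemma symmetric_on_reduced_Cons: "symmetric_on n reduced_Cons (reduced_words n L)"
  by (auto simp: symmetric_on_def reduced_words_def reduced_Cons_reduced_Cons)

text \<open>
  With \<open>r = \<surd>(n - 1)\<close> this is the spherical function of the \<open>n\<close>-regular tree for the eigenvalue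
  \<open>2 r\<close> of its adjacency operator.
\<close>

definition tree_weight :: "real \<Rightarrow> nat \<Rightarrow> real" where
  "tree_weight r d = (1 + (r\<^sup>2 - 1) / (r\<^sup>2 + 1) * real d) / r ^ d"

lemma tree_weight_pos: "r \<ge> 1 \<Longrightarrow> tree_weight r d > 0"
  unfolding tree_weight_def by (intro divide_pos_pos add_pos_nonneg) auto

lemma tree_weight_root:
  assumes "r \<ge> 1"
  shows "(r\<^sup>2 + 1) * tree_weight r 1 = 2 * r * tree_weight r 0"
proof -
  have "(r\<^sup>2 + 1) * (1 + (r\<^sup>2 - 1) / (r\<^sup>2 + 1)) = 2 * r\<^sup>2"
    by (simp add: distrib_left add_nonneg_eq_0_iff)
  then show ?thesis
    using assms by (simp add: tree_weight_def power2_eq_square)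
qed

lemma tree_weight_step:
  assumes "r \<ge> 1"
  shows "tree_weight r d + r\<^sup>2 * tree_weight r (Suc (Suc d)) = 2 * r * tree_weight r (Suc d)"
proof -
  define c where "c = (r\<^sup>2 - 1) / (r\<^sup>2 + 1)"
  show ?thesis
    using assms unfolding tree_weight_def c_def[symmetric]
    by (simp add: field_simps power2_eq_square)
qed

lemma sum_tree_weight_reduced_Cons:
  assumes n_ge: "n \<ge> 2" and letters: "set w \<subseteq> {..<n}" and r_eq: "r = sqrt (real n - 1)"
  shows "(\<Sum>i<n. tree_weight r (length (reduced_Cons i w))) = 2 * r * tree_weight r (length w)"
proof -
  have r_ge: "r \<ge> 1" and n_eq: "real n = r\<^sup>2 + 1"
    using n_ge by (auto simp: r_eq)
  show ?thesis
  proof (cases w)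
    case Nil
    then show ?thesis
      using tree_weight_root[OF r_ge] by (simp add: n_eq)
  next
    case (Cons j v)
    then have j_mem: "j \<in> {..<n}" using letters by simp
    have "(\<Sum>i<n. tree_weight r (length (reduced_Cons i w))) =
        tree_weight r (length v) + (\<Sum>i\<in>{..<n} - {j}. tree_weight r (Suc (Suc (length v))))"
      using j_mem Cons by (simp add: sum.remove[of _ j])
    also have "(\<Sum>i\<in>{..<n} - {j}. tree_weight r (Suc (Suc (length v)))) =
        r\<^sup>2 * tree_weight r (Suc (Suc (length v)))"
      using j_mem n_ge n_eq by (simp add: of_nat_diff)
    finally show ?thesis
      using tree_weight_step[OF r_ge, of "length v"] Cons by simp
  qed
qed

lemma opnorm_tree_tensor_tree_le:
  fixes n L :: nat
  assumes n_ge: "n \<ge> 2"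
  defines "W \<equiv> reduced_words n L"
  shows "opnorm_le (W \<times> W) (W \<times> W) (kron_sum n (graph_mat reduced_Cons) (graph_mat reduced_Cons))
    (2 * sqrt (real n - 1))"
proof (rule opnorm_le_kron_sum_graph_mat)
  show "0 < tree_weight (sqrt (real n - 1)) (length w)" for w :: "nat list"
    using n_ge by (intro tree_weight_pos) simp
  show "(\<Sum>i<n. tree_weight (sqrt (real n - 1)) (length (reduced_Cons i w))) \<le>
      2 * sqrt (real n - 1) * tree_weight (sqrt (real n - 1)) (length w)" if "w \<in> W" for w
    using that sum_tree_weight_reduced_Cons[OF n_ge] by (simp add: W_def reduced_words_def)
qed (use n_ge in \<open>simp_all add: W_def finite_reduced_words symmetric_on_reduced_Cons\<close>)

lemma mat_norm_tree_conj_le: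
  assumes n_ge: "n \<ge> 2" and bij: "bij_betw e {..<N} (reduced_words n L)"
  defines "\<tau> \<equiv> \<lambda>i s t. graph_mat reduced_Cons i (e s) (e t)"
  shows "mat_norm N (tensor_mat n (\<lambda>i. matop N (\<tau> i)) (\<lambda>i s t. cnj (\<tau> i s t))) \<le>
      2 * sqrt (real n - 1)"
proof (rule mat_norm_matop_le)
  have "kron_sum n \<tau> (\<lambda>i s t. cnj (\<tau> i s t)) x y =
      kron_sum n (graph_mat reduced_Cons) (graph_mat reduced_Cons) (map_prod e e x)
        (map_prod e e y)" for x y
    unfolding kron_sum_def by (intro sum.cong refl) (simp add: \<tau>_def graph_mat_def)
  from opnorm_le_reindex[where A = "kron_sum n (graph_mat reduced_Cons) (graph_mat reduced_Cons)",
      OF bij_betw_map_prod[OF bij bij] this]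
  show "opnorm_le ({..<N} \<times> {..<N}) ({..<N} \<times> {..<N}) (kron_sum n \<tau> (\<lambda>i s t. cnj (\<tau> i s t)))
      (2 * sqrt (real n - 1))"
    using opnorm_tree_tensor_tree_le[OF n_ge] by blast
qed (use n_ge in simp)

section \<open>Finite permutation models\<close>

definition tree_perm :: "nat \<Rightarrow> nat \<Rightarrow> nat \<Rightarrow> nat list \<Rightarrow> nat list" where
  "tree_perm n L i w =
    (if w \<in> reduced_words n L \<and> reduced_Cons i w \<in> reduced_words n L then reduced_Cons i w else w)"

definition tree_perms :: "nat \<Rightarrow> nat \<Rightarrow> (nat list \<Rightarrow> nat list) set" where
  "tree_perms n L = {\<gamma>. \<gamma> permutes reduced_words n L}"

definition left_mult :: "nat \<Rightarrow> nat \<Rightarrow> nat \<Rightarrow> (nat list \<Rightarrow> nat list) \<Rightarrow> nat list \<Rightarrow> nat list" where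
  "left_mult n L i \<gamma> = tree_perm n L i \<circ> \<gamma>"

lemma tree_perm_tree_perm: "tree_perm n L i (tree_perm n L i w) = w"
  using reduced_Cons_reduced_Cons[of w i] by (auto simp: tree_perm_def reduced_words_def)

lemma tree_perm_in_tree_perms: "tree_perm n L i \<in> tree_perms n L"
  unfolding tree_perms_def permutes_def
proof (intro CollectI conjI allI impI)
  fix y show "\<exists>!x. tree_perm n L i x = y"
    by (rule ex1I[of _ "tree_perm n L i y"]) (auto simp: tree_perm_tree_perm)
qed (simp add: tree_perm_def)

lemma foldr_tree_perm_reduced_Cons:
  "foldr (tree_perm n L) (reduced_Cons i w) = tree_perm n L i \<circ> foldr (tree_perm n L) w"
  by (cases w) (auto simp: fun_eq_iff tree_perm_tree_perm)

lemma finite_tree_perms: "finite (tree_perms n L)"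
  unfolding tree_perms_def by (rule finite_permutations[OF finite_reduced_words])

lemma left_mult_in_tree_perms: "\<gamma> \<in> tree_perms n L \<Longrightarrow> left_mult n L i \<gamma> \<in> tree_perms n L"
  using tree_perm_in_tree_perms[of n L i]
  by (auto simp: tree_perms_def left_mult_def intro: permutes_compose)

lemma left_mult_left_mult: "left_mult n L i (left_mult n L i \<gamma>) = \<gamma>"
  by (simp add: left_mult_def fun_eq_iff tree_perm_tree_perm)

lemma symmetric_on_left_mult: "symmetric_on n (left_mult n L) (tree_perms n L)"
  by (auto simp: symmetric_on_def left_mult_left_mult)

lemma tree_perms_Nil: "\<gamma> \<in> tree_perms n L \<Longrightarrow> \<gamma> [] \<in> reduced_words n L"
  using Nil_in_reduced_words[of n L] by (auto simp: tree_perms_def permutes_in_image)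

text \<open>
  Seen from the identity, left multiplication on the permutations of the finite tree looks like the
  tree: as long as the support stays away from the longest words, transporting a function on words
  along \<open>w \<mapsto> foldr (tree_perm n L) w\<close> intertwines the two amplified operators.
\<close>

definition perm_transport ::
  "nat \<Rightarrow> nat \<Rightarrow> ('b \<times> nat list \<Rightarrow> complex) \<Rightarrow> 'b \<times> (nat list \<Rightarrow> nat list) \<Rightarrow> complex" where
  "perm_transport n L z y =
    (if snd y = foldr (tree_perm n L) (snd y []) then z (fst y, snd y []) else 0)"

definition word_support_le :: "nat \<Rightarrow> ('b \<times> nat list \<Rightarrow> complex) \<Rightarrow> bool" where
  "word_support_le j z \<longleftrightarrow> (\<forall>b w. length w > j \<longrightarrow> z (b, w) = 0)"

lemma word_support_le_mat_vec_tree: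
  assumes "word_support_le j z"
  shows "word_support_le (Suc j)
    (mat_vec (K \<times> reduced_words n L) (kron_sum n Y (graph_mat reduced_Cons)) z)"
  unfolding word_support_le_def
proof (intro allI impI)
  fix a w assume "length (w :: nat list) > Suc j"
  then have "length (reduced_Cons i w) > j" for i
    using length_le_Suc_length_reduced_Cons[of w i] by linarith
  then show "mat_vec (K \<times> reduced_words n L) (kron_sum n Y (graph_mat reduced_Cons)) z (a, w) = 0"
    unfolding mat_vec_kron_sum_graph_mat[OF finite_reduced_words]
    using assms by (intro sum.neutral ballI) (simp add: word_support_le_def mat_vec_def)
qed

lemma perm_transport_left_mult:
  assumes support: "word_support_le j z" "j < L" and \<gamma>_mem: "\<gamma> \<in> tree_perms n L" and "i < n"
  shows "perm_transport n L z (b, left_mult n L i \<gamma>) =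
    (if \<gamma> = foldr (tree_perm n L) (\<gamma> []) \<and> reduced_Cons i (\<gamma> []) \<in> reduced_words n L
     then z (b, reduced_Cons i (\<gamma> [])) else 0)"
proof (cases "reduced_Cons i (\<gamma> []) \<in> reduced_words n L")
  case True
  then have root: "left_mult n L i \<gamma> [] = reduced_Cons i (\<gamma> [])"
    using tree_perms_Nil[OF \<gamma>_mem] by (simp add: left_mult_def tree_perm_def)
  have "left_mult n L i \<gamma> = tree_perm n L i \<circ> foldr (tree_perm n L) (\<gamma> []) \<longleftrightarrow>
      \<gamma> = foldr (tree_perm n L) (\<gamma> [])"
    by (metis left_mult_def left_mult_left_mult)
  then show ?thesis
    using True by (simp add: perm_transport_def root foldr_tree_perm_reduced_Cons)
next
  case False
  then have root: "left_mult n L i \<gamma> [] = \<gamma> []"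
    by (simp add: left_mult_def tree_perm_def)
  have "\<not> length (\<gamma> []) < L"
    using False reduced_Cons_in_reduced_words[OF tree_perms_Nil[OF \<gamma>_mem] \<open>i < n\<close>] by blast
  then have "z (b, \<gamma> []) = 0"
    using support by (simp add: word_support_le_def)
  then have "perm_transport n L z (b, left_mult n L i \<gamma>) = 0"
    unfolding perm_transport_def fst_conv snd_conv root by (simp only: if_cancel)
  then show ?thesis
    using False by simp
qed

lemma mat_vec_perm_transport:
  assumes support: "word_support_le j z" "j < L" and y_mem: "y \<in> K \<times> tree_perms n L"
  shows "mat_vec (K \<times> tree_perms n L) (kron_sum n Y (graph_mat (left_mult n L)))
      (perm_transport n L z) y =
    perm_transport n L
      (mat_vec (K \<times> reduced_words n L) (kron_sum n Y (graph_mat reduced_Cons)) z) y"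
proof -
  obtain a \<gamma> where y_eq: "y = (a, \<gamma>)" and \<gamma>_mem: "\<gamma> \<in> tree_perms n L"
    using y_mem by auto
  have "mat_vec K (Y i) (\<lambda>b. perm_transport n L z (b, left_mult n L i \<gamma>)) a =
      (if \<gamma> = foldr (tree_perm n L) (\<gamma> []) \<and> reduced_Cons i (\<gamma> []) \<in> reduced_words n L
       then mat_vec K (Y i) (\<lambda>b. z (b, reduced_Cons i (\<gamma> []))) a else 0)" if "i < n" for i
    unfolding perm_transport_left_mult[OF support \<gamma>_mem that] by (auto simp: mat_vec_def)
  then show ?thesis
    unfolding y_eq
    by (simp add: mat_vec_kron_sum_graph_mat finite_tree_perms finite_reduced_words
        left_mult_in_tree_perms[OF \<gamma>_mem] perm_transport_def[of n L _ "(a, \<gamma>)"])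
qed

lemma gram_map_perm_transport:
  fixes n L :: nat and X :: "nat \<Rightarrow> 'b \<Rightarrow> 'b \<Rightarrow> complex"
  assumes support: "word_support_le j z" "Suc j < L" and y_mem: "y \<in> K \<times> tree_perms n L"
  defines "A \<equiv> kron_sum n X (graph_mat (left_mult n L))"
    and "T \<equiv> kron_sum n X (graph_mat reduced_Cons)"
  shows "gram_map (K \<times> tree_perms n L) A (perm_transport n L z) y =
    perm_transport n L (gram_map (K \<times> reduced_words n L) T z) y"
proof -
  let ?V = "K \<times> tree_perms n L" and ?W = "K \<times> reduced_words n L" and ?X = "\<lambda>i. adjoint_mat (X i)"
  let ?z = "mat_vec ?W (kron_sum n ?X (graph_mat reduced_Cons)) z"
  have "gram_map ?V A (perm_transport n L z) =
      mat_vec ?V A (mat_vec ?V (kron_sum n ?X (graph_mat (left_mult n L))) (perm_transport n L z))"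
    unfolding A_def by (rule gram_map_kron_sum_graph_mat[OF symmetric_on_left_mult])
  also have "\<dots> = mat_vec ?V A (perm_transport n L ?z)"
    using mat_vec_perm_transport[OF support(1)] support(2) by (intro mat_vec_cong) simp
  finally have "gram_map ?V A (perm_transport n L z) y = mat_vec ?V A (perm_transport n L ?z) y"
    by (rule fun_cong)
  also have "\<dots> = perm_transport n L (mat_vec ?W T ?z) y"
    unfolding A_def T_def
    by (rule mat_vec_perm_transport[OF word_support_le_mat_vec_tree[OF support(1)] support(2)
        y_mem])
  also have "mat_vec ?W T ?z = gram_map ?W T z"
    unfolding T_def by (rule gram_map_kron_sum_graph_mat[OF symmetric_on_reduced_Cons, symmetric])
  finally show ?thesis .
qed

lemma gram_map_pow_perm_transport:
  fixes n L :: nat and X :: "nat \<Rightarrow> 'b \<Rightarrow> 'b \<Rightarrow> complex"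
  defines "A \<equiv> kron_sum n X (graph_mat (left_mult n L))"
    and "T \<equiv> kron_sum n X (graph_mat reduced_Cons)"
  assumes "word_support_le 0 z" "2 * p \<le> L" "y \<in> K \<times> tree_perms n L"
  shows "(gram_map (K \<times> tree_perms n L) A ^^ p) (perm_transport n L z) y =
    perm_transport n L ((gram_map (K \<times> reduced_words n L) T ^^ p) z) y"
  using assms(4,5)
proof (induction p arbitrary: y)
  case (Suc p)
  have support: "word_support_le (2 * p) ((gram_map (K \<times> reduced_words n L) T ^^ p) z)" for p
  proof (induction p)
    case (Suc p)
    then show ?case
      using word_support_le_mat_vec_tree[OF word_support_le_mat_vec_tree]
      unfolding T_def funpow.simps o_apply gram_map_kron_sum_graph_mat[OF symmetric_on_reduced_Cons]
      by simp
  qed (use assms(3) in simp)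
  have "(gram_map (K \<times> tree_perms n L) A ^^ Suc p) (perm_transport n L z) y =
      gram_map (K \<times> tree_perms n L) A
        (perm_transport n L ((gram_map (K \<times> reduced_words n L) T ^^ p) z)) y"
    unfolding funpow.simps o_apply using Suc by (intro gram_map_cong[THEN fun_cong]) simp
  also have "\<dots> = perm_transport n L ((gram_map (K \<times> reduced_words n L) T ^^ Suc p) z) y"
    using gram_map_perm_transport[OF support _ Suc.prems(2), of p X] Suc.prems(1)
    by (simp add: A_def T_def)
  finally show ?case .
qed simp

lemma sqnorm_perm_transport_le:
  assumes "finite K"
  shows "sqnorm (K \<times> tree_perms n L) (perm_transport n L z) \<le> sqnorm (K \<times> reduced_words n L) z"
proof -
  define S where "S = {y \<in> K \<times> tree_perms n L. snd y = foldr (tree_perm n L) (snd y [])}"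
  have inj: "inj_on (\<lambda>y. (fst y, snd y [])) S"
    by (rule inj_onI) (metis (mono_tags, lifting) S_def mem_Collect_eq prod.inject prod_eqI)
  have "sqnorm (K \<times> tree_perms n L) (perm_transport n L z) = (\<Sum>y\<in>S. (cmod (z (fst y, snd y [])))\<^sup>2)"
    unfolding sqnorm_def
    using assms by (intro sum.mono_neutral_cong_right)
      (auto simp: finite_tree_perms S_def perm_transport_def)
  also have "\<dots> = (\<Sum>x\<in>(\<lambda>y. (fst y, snd y [])) ` S. (cmod (z x))\<^sup>2)"
    by (simp add: sum.reindex[OF inj])
  also have "\<dots> \<le> sqnorm (K \<times> reduced_words n L) z"
    unfolding sqnorm_def using assms
    by (intro sum_mono2) (auto simp: finite_reduced_words S_def tree_perms_Nil)
  finally show ?thesis .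
qed

lemma diag_moment_left_mult_id_le:
  assumes tree_bound: "opnorm_le (K \<times> reduced_words n L) (K \<times> reduced_words n L)
      (kron_sum n X (graph_mat reduced_Cons)) r"
    and index: "finite K" "a \<in> K" and p_le: "2 * p \<le> L"
  shows "diag_moment (K \<times> tree_perms n L) (kron_sum n X (graph_mat (left_mult n L))) p (a, id) \<le>
    (r ^ (2 * p))\<^sup>2"
proof -
  let ?V = "K \<times> tree_perms n L" and ?W = "K \<times> reduced_words n L"
  let ?A = "kron_sum n X (graph_mat (left_mult n L))"
    and ?T = "kron_sum n X (graph_mat reduced_Cons)"
  have "unit_vec (a, id) y = perm_transport n L (unit_vec (a, [])) y" for y
    by (auto simp: unit_vec_def perm_transport_def prod_eq_iff)
  then have unit_vec_eq: "unit_vec (a, id) = perm_transport n L (unit_vec (a, []))"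
    by blast
  have "diag_moment ?V ?A p (a, id) =
      sqnorm ?V (perm_transport n L ((gram_map ?W ?T ^^ p) (unit_vec (a, []))))"
    unfolding diag_moment_def unit_vec_eq
    by (intro sqnorm_cong gram_map_pow_perm_transport p_le)
      (simp_all add: word_support_le_def unit_vec_def)
  also have "\<dots> \<le> diag_moment ?W ?T p (a, [])"
    unfolding diag_moment_def by (rule sqnorm_perm_transport_le[OF index(1)])
  also have "\<dots> \<le> (r ^ (2 * p))\<^sup>2"
    using index by (intro diag_moment_le tree_bound)
      (simp_all add: finite_reduced_words Nil_in_reduced_words)
  finally show ?thesis .
qed

lemma diag_moment_left_mult_homogeneous:
  fixes n L :: nat and X :: "nat \<Rightarrow> 'b \<Rightarrow> 'b \<Rightarrow> complex"
  assumes "a \<in> K" "\<gamma> \<in> tree_perms n L"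
  defines "A \<equiv> kron_sum n X (graph_mat (left_mult n L))"
  shows "diag_moment (K \<times> tree_perms n L) A p (a, \<gamma>) = diag_moment (K \<times> tree_perms n L) A p (a, id)"
proof -
  let ?m = "map_prod id (\<lambda>\<delta>. \<delta> \<circ> \<gamma>)"
  have perm: "\<gamma> permutes reduced_words n L" using assms by (simp add: tree_perms_def)
  have "bij_betw (\<lambda>\<delta>. \<delta> \<circ> \<gamma>) (tree_perms n L) (tree_perms n L)"
    by (rule bij_betw_byWitness[where f' = "\<lambda>\<delta>. \<delta> \<circ> inv \<gamma>"])
      (auto simp: tree_perms_def o_assoc[symmetric] permutes_inv_o[OF perm] permutes_inv[OF perm]
        intro!: permutes_compose perm)
  then have bij: "bij_betw ?m (K \<times> tree_perms n L) (K \<times> tree_perms n L)"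
    by (intro bij_betw_map_prod) auto
  have "graph_mat (left_mult n L) i (\<delta> \<circ> \<gamma>) (\<epsilon> \<circ> \<gamma>) = graph_mat (left_mult n L) i \<delta> \<epsilon>" for i \<delta> \<epsilon>
  proof -
    have "\<epsilon> \<circ> \<gamma> = left_mult n L i \<delta> \<circ> \<gamma> \<longleftrightarrow> \<epsilon> = left_mult n L i \<delta>"
      using surj_fun_eq[OF permutes_surj[OF perm]] by (metis fun.map_comp)
    then show ?thesis
      by (simp add: graph_mat_def left_mult_def o_assoc)
  qed
  then have "A x y = A (?m x) (?m y)" for x y
    by (simp add: A_def kron_sum_def)
  moreover have "(a, id) \<in> K \<times> tree_perms n L"
    using assms(1) by (simp add: tree_perms_def permutes_id)
  ultimately show ?thesis
    using diag_moment_reindex[OF bij, of A A "(a, id)" p] by simp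
qed

lemma enumerate_action:
  fixes \<phi> :: "nat \<Rightarrow> 'v \<Rightarrow> 'v"
  assumes "finite V" and closed: "\<And>i v. v \<in> V \<Longrightarrow> \<phi> i v \<in> V"
  obtains e and \<pi> :: "nat \<Rightarrow> nat \<Rightarrow> nat" where "bij_betw e {..<card V} V"
    and "\<forall>i. \<forall>t<card V. \<pi> i t < card V \<and> e (\<pi> i t) = \<phi> i (e t)"
proof -
  obtain e where bij: "bij_betw e {..<card V} V"
    using ex_bij_betw_nat_finite[OF assms(1)] by (auto simp: atLeast0LessThan)
  have "\<phi> i (e t) \<in> e ` {..<card V}" if "t < card V" for i t
    using bij closed that by (auto simp: bij_betw_def)
  then have "\<forall>i. \<forall>t<card V. the_inv_into {..<card V} e (\<phi> i (e t)) < card V \<and>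
      e (the_inv_into {..<card V} e (\<phi> i (e t))) = \<phi> i (e t)"
    using bij the_inv_into_into[of e "{..<card V}" _ "{..<card V}"]
    by (auto simp: bij_betw_def f_the_inv_into_f)
  with bij show ?thesis
    by (rule that[where \<pi> = "\<lambda>i t. the_inv_into {..<card V} e (\<phi> i (e t))"])
qed

lemma diag_moment_enumerate_action:
  assumes bij: "bij_betw e {..<N} V"
    and action: "\<forall>i. \<forall>t<N. \<pi> i t < N \<and> e (\<pi> i t) = \<phi> i (e t)"
    and "a \<in> K" "t < N"
  shows "diag_moment (K \<times> {..<N}) (kron_sum n X (graph_mat \<pi>)) p (a, t) =
    diag_moment (K \<times> V) (kron_sum n X (graph_mat \<phi>)) p (a, e t)"
proof -
  have eq_iff: "e s = e t \<longleftrightarrow> s = t" if "s < N" "t < N" for s t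
    using bij that by (auto simp: bij_betw_def inj_on_eq_iff)
  have "kron_sum n X (graph_mat \<pi>) u v =
      kron_sum n X (graph_mat \<phi>) (map_prod id e u) (map_prod id e v)"
    if "u \<in> K \<times> {..<N}" "v \<in> K \<times> {..<N}" for u v
    using that action eq_iff by (fastforce simp: kron_sum_def graph_mat_def intro!: sum.cong)
  from diag_moment_reindex[where A = "kron_sum n X (graph_mat \<phi>)",
      OF bij_betw_map_prod[OF bij_betw_id bij] this]
  show ?thesis
    using assms(3,4) by simp
qed

lemma finite_permutation_model:
  fixes k :: nat
  assumes tree_bound:
    "opnorm_le ({..<k} \<times> reduced_words n (2 * p)) ({..<k} \<times> reduced_words n (2 * p))
      (kron_sum n X (graph_mat reduced_Cons)) r"
  obtains N :: nat and \<pi> where "N > 0" and "\<forall>i. bij_betw (\<pi> i) {..<N} {..<N}"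
    and "\<forall>x\<in>{..<k} \<times> {..<N}.
      diag_moment ({..<k} \<times> {..<N}) (kron_sum n X (graph_mat \<pi>)) p x \<le> (r ^ (2 * p))\<^sup>2"
proof -
  let ?V = "tree_perms n (2 * p)" and ?act = "left_mult n (2 * p)"
  define N where "N = card ?V"
  have "id \<in> ?V" by (simp add: tree_perms_def permutes_id)
  then have "N > 0"
    using finite_tree_perms by (auto simp: N_def card_gt_0_iff)
  obtain e and \<pi> :: "nat \<Rightarrow> nat \<Rightarrow> nat" where bij: "bij_betw e {..<N} ?V"
    and action: "\<forall>i. \<forall>t<N. \<pi> i t < N \<and> e (\<pi> i t) = ?act i (e t)"
    unfolding N_def
    by (rule enumerate_action[where \<phi> = ?act, OF finite_tree_perms left_mult_in_tree_perms])
  have "\<pi> i (\<pi> i t) = t" if "t < N" for i t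
    using that action
    by (simp add: left_mult_left_mult flip: inj_on_eq_iff[OF bij_betw_imp_inj_on[OF bij]])
  then have perm: "\<forall>i. bij_betw (\<pi> i) {..<N} {..<N}"
    using action by (auto intro!: bij_betwI[where g = "\<pi> _"])
  have "\<forall>x\<in>{..<k} \<times> {..<N}.
      diag_moment ({..<k} \<times> {..<N}) (kron_sum n X (graph_mat \<pi>)) p x \<le> (r ^ (2 * p))\<^sup>2"
  proof
    fix x assume x_mem: "x \<in> {..<k} \<times> {..<N}"
    then obtain a t where x_eq: "x = (a, t)" and a_mem: "a \<in> {..<k}" and t_mem: "t < N"
      by auto
    then have "e t \<in> ?V"
      using bij_betwE[OF bij] by simp
    have "diag_moment ({..<k} \<times> {..<N}) (kron_sum n X (graph_mat \<pi>)) p x =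
        diag_moment ({..<k} \<times> ?V) (kron_sum n X (graph_mat ?act)) p (a, e t)"
      unfolding x_eq by (rule diag_moment_enumerate_action[OF bij action a_mem t_mem])
    also have "\<dots> \<le> (r ^ (2 * p))\<^sup>2"
      unfolding diag_moment_left_mult_homogeneous[OF a_mem \<open>e t \<in> ?V\<close>]
      by (rule diag_moment_left_mult_id_le[OF tree_bound _ a_mem]) simp_all
    finally show "diag_moment ({..<k} \<times> {..<N}) (kron_sum n X (graph_mat \<pi>)) p x \<le> (r ^ (2 * p))\<^sup>2" .
  qed
  with \<open>N > 0\<close> perm show ?thesis
    by (rule that)
qed

section \<open>Removal of a small subspace\<close>

text \<open>
  The trace of \<open>(A A\<^sup>*)\<^sup>2\<^sup>p\<close>, computed in the standard basis, bounds how many orthonormal vectors on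
  which \<open>A\<^sup>*\<close> is large there can be.
\<close>

lemma card_orthonormal_large_le:
  assumes finite_sets: "finite I" "finite J" and "c \<ge> 0"
    and orthonormal: "\<And>j l. j \<in> J \<Longrightarrow> l \<in> J \<Longrightarrow> finner I (u j) (u l) = (if j = l then 1 else 0)"
    and large: "\<And>j. j \<in> J \<Longrightarrow> c \<le> sqnorm I (mat_vec I (adjoint_mat A) (u j))"
    and moment: "\<forall>x\<in>I. diag_moment I A p x \<le> D"
  shows "real (card J) * c ^ (2 * p) \<le> real (card I) * D"
proof -
  let ?G = "gram_map I A ^^ p"
  have "c ^ (2 * p) \<le> sqnorm I (?G (u j))" if "j \<in> J" for j
  proof -
    have "sqnorm I (u j) = 1"
      using orthonormal[OF that that] unfolding finner_self by simp
    then show ?thesis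
      using sqnorm_gram_map_pow_ge[OF \<open>c \<ge> 0\<close>, of I "u j" A p] large[OF that] by simp
  qed
  then have "(\<Sum>j\<in>J. c ^ (2 * p)) \<le> (\<Sum>j\<in>J. sqnorm I (?G (u j)))"
    by (rule sum_mono)
  also have "\<dots> = (\<Sum>j\<in>J. \<Sum>x\<in>I. (cmod (finner I (u j) (?G (unit_vec x))))\<^sup>2)"
    unfolding sqnorm_def
    by (simp add: finner_unit_vec[OF finite_sets(1)] flip: finner_gram_map_pow)
  also have "\<dots> = (\<Sum>x\<in>I. \<Sum>j\<in>J. (cmod (finner I (u j) (?G (unit_vec x))))\<^sup>2)"
    by (rule sum.swap)
  also have "\<dots> \<le> (\<Sum>x\<in>I. diag_moment I A p x)"
    unfolding diag_moment_def by (intro sum_mono finner_Bessel finite_sets orthonormal)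
  also have "\<dots> \<le> (\<Sum>x\<in>I. D)"
    using moment by (intro sum_mono) blast
  finally show ?thesis by simp
qed

definition row_vec :: "nat \<Rightarrow> ('b \<times> nat \<Rightarrow> complex) \<Rightarrow> 'b \<Rightarrow> ell2" where
  "row_vec N v a = evec N (\<lambda>s. v (a, s))"

lemma row_vec_scale: "row_vec N (\<lambda>y. c * v y) a = c *\<^sub>C row_vec N v a"
  by (simp add: row_vec_def evec_scaleC)

lemma finner_row_vec: "finner (K \<times> {..<N}) u v = (\<Sum>a\<in>K. cinner (row_vec N u a) (row_vec N v a))"
  by (simp add: finner_def row_vec_def cinner_evec_evec sum.cartesian_product')

lemma sqnorm_row_vec: "sqnorm (K \<times> {..<N}) u = (\<Sum>a\<in>K. (norm (row_vec N u a))\<^sup>2)"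
  by (simp add: sqnorm_def row_vec_def norm_evec_sq sum.cartesian_product')

definition large_system ::
  "'b set \<Rightarrow> nat \<Rightarrow> ('b \<times> nat \<Rightarrow> 'b \<times> nat \<Rightarrow> complex) \<Rightarrow> real \<Rightarrow> nat \<Rightarrow> ell2 set \<Rightarrow>
    (nat \<Rightarrow> 'b \<times> nat \<Rightarrow> complex) \<Rightarrow> bool" where
  "large_system K N A c m F u \<longleftrightarrow>
     corthonormal (\<lambda>f. f) F \<and> F \<subseteq> range (evec N) \<and> card F \<le> card K * m \<and>
     (\<forall>j<m. c \<le> sqnorm (K \<times> {..<N}) (mat_vec (K \<times> {..<N}) (adjoint_mat A) (u j)) \<and>
        (\<forall>a\<in>K. cproj (\<lambda>f. f) F (row_vec N (u j) a) = row_vec N (u j) a)) \<and>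
     (\<forall>j<m. \<forall>l<m. finner (K \<times> {..<N}) (u j) (u l) = (if j = l then 1 else 0))"

lemma large_system_card_le:
  fixes K :: "'b set" and N :: nat
  assumes "finite K" "c \<ge> 0" "large_system K N A c m F u"
    and "\<forall>x\<in>K \<times> {..<N}. diag_moment (K \<times> {..<N}) A p x \<le> D"
  shows "real m * c ^ (2 * p) \<le> real (card K * N) * D"
  using assms card_orthonormal_large_le[of "K \<times> {..<N}" "{..<m}" c u A p D]
  by (simp add: large_system_def card_cartesian_product)

lemma large_system_orthogonal:
  assumes system: "large_system K N A c m F u" and "j < m"
    and orthogonal: "\<And>a f. a \<in> K \<Longrightarrow> f \<in> F \<Longrightarrow> cinner f (row_vec N v a) = 0"
  shows "finner (K \<times> {..<N}) v (u j) = 0" and "finner (K \<times> {..<N}) (u j) v = 0"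
proof -
  have "cinner (row_vec N v a) (row_vec N (u j) a) = 0" if "a \<in> K" for a
  proof (rule cinner_eq_zero_if_cproj)
    show "cproj (\<lambda>f. f) F (row_vec N (u j) a) = row_vec N (u j) a"
      using system \<open>j < m\<close> that by (simp add: large_system_def)
  qed (use orthogonal that in simp)
  moreover from this have "cinner (row_vec N (u j) a) (row_vec N v a) = 0" if "a \<in> K" for a
    using that cinner_eq_zero_commute by blast
  ultimately show "finner (K \<times> {..<N}) v (u j) = 0" "finner (K \<times> {..<N}) (u j) v = 0"
    by (simp_all add: finner_row_vec)
qed

lemma large_system_extend_unit:
  fixes K :: "'b set" and N :: nat
  defines "I \<equiv> K \<times> {..<N}"
  assumes "finite K" and system: "large_system K N A c m F u"
    and orthogonal: "\<And>a f. a \<in> K \<Longrightarrow> f \<in> F \<Longrightarrow> cinner f (row_vec N v a) = 0"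
    and large: "c \<le> sqnorm I (mat_vec I (adjoint_mat A) v)" and unit: "sqnorm I v = 1"
  shows "\<exists>F' u'. large_system K N A c (Suc m) F' u'"
proof -
  have basis: "corthonormal (\<lambda>f. f) F" "F \<subseteq> range (evec N)" and card: "card F \<le> card K * m"
    and u_large: "\<And>j. j < m \<Longrightarrow> c \<le> sqnorm I (mat_vec I (adjoint_mat A) (u j))"
    and u_span: "\<And>j a. j < m \<Longrightarrow> a \<in> K \<Longrightarrow> cproj (\<lambda>f. f) F (row_vec N (u j) a) = row_vec N (u j) a"
    and u_orth: "\<And>j l. j < m \<Longrightarrow> l < m \<Longrightarrow> finner I (u j) (u l) = (if j = l then 1 else 0)"
    using system unfolding large_system_def I_def by blast+
  have "finite (row_vec N v ` K)" "row_vec N v ` K \<subseteq> range (evec N)"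
    using \<open>finite K\<close> by (auto simp: row_vec_def)
  from Gram_Schmidt_extension[OF basis(1) csubspace_range_evec basis(2) this]
  obtain F' where basis': "corthonormal (\<lambda>f. f) F'" "F \<subseteq> F'" "F' \<subseteq> range (evec N)"
    and card': "card F' \<le> card F + card (row_vec N v ` K)"
    and v_span: "\<And>a. a \<in> K \<Longrightarrow> cproj (\<lambda>f. f) F' (row_vec N v a) = row_vec N v a"
    by auto
  define u' where "u' j = (if j < m then u j else v)" for j
  have "large_system K N A c (Suc m) F' u'"
    unfolding large_system_def I_def[symmetric]
  proof (intro conjI allI impI ballI)
    show "card F' \<le> card K * Suc m"
      using card card' card_image_le[OF \<open>finite K\<close>, of "row_vec N v"] by simp
    show "c \<le> sqnorm I (mat_vec I (adjoint_mat A) (u' j))" for j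
      using u_large large by (simp add: u'_def)
    show "cproj (\<lambda>f. f) F' (row_vec N (u' j) a) = row_vec N (u' j) a" if "a \<in> K" for j a
      using u_span v_span that cproj_mono[OF basis'(1,2)] by (simp add: u'_def)
    show "finner I (u' j) (u' l) = (if j = l then 1 else 0)" if "j < Suc m" "l < Suc m" for j l
      using that u_orth large_system_orthogonal[OF system _ orthogonal, folded I_def]
        finner_self[of I v] unit by (auto simp: u'_def less_Suc_eq)
  qed (use basis' in auto)
  then show ?thesis by blast
qed

lemma large_system_extend:
  fixes K :: "'b set" and N :: nat
  defines "I \<equiv> K \<times> {..<N}"
  assumes "finite K" and system: "large_system K N A c m F u"
    and orthogonal: "\<And>a f. a \<in> K \<Longrightarrow> f \<in> F \<Longrightarrow> cinner f (row_vec N v a) = 0"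
    and large: "c * sqnorm I v < sqnorm I (mat_vec I (adjoint_mat A) v)"
  shows "\<exists>F' u'. large_system K N A c (Suc m) F' u'"
proof -
  have "sqnorm I v \<noteq> 0"
  proof
    assume zero: "sqnorm I v = 0"
    then have "mat_vec I (adjoint_mat A) v = mat_vec I (adjoint_mat A) (\<lambda>_. 0)"
      using \<open>finite K\<close> by (intro mat_vec_cong) (auto simp: sqnorm_def sum_nonneg_eq_0_iff I_def)
    then show False
      using large zero by (simp add: sqnorm_def mat_vec_def)
  qed
  then have positive: "sqnorm I v > 0"
    using sqnorm_nonneg[of I v] by simp
  define w where "w = (\<lambda>y. of_real (1 / sqrt (sqnorm I v)) * v y)"
  have scale: "(cmod (of_real (1 / sqrt (sqnorm I v))))\<^sup>2 = 1 / sqnorm I v"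
    using positive by (simp add: norm_divide power_divide)
  show ?thesis
  proof (rule large_system_extend_unit[OF \<open>finite K\<close> system, folded I_def])
    show "cinner f (row_vec N w a) = 0" if "a \<in> K" "f \<in> F" for a f
      unfolding w_def row_vec_scale cinner_scaleC_right using orthogonal that by simp
    show "c \<le> sqnorm I (mat_vec I (adjoint_mat A) w)"
      unfolding w_def mat_vec_scale sqnorm_scale scale using large positive
      by (simp add: pos_le_divide_eq)
    show "sqnorm I w = 1"
      unfolding w_def sqnorm_scale scale using positive by simp
  qed
qed

lemma large_system_maximal:
  fixes K :: "'b set" and N :: nat
  assumes "finite K" "c > 0" and moment: "\<forall>x\<in>K \<times> {..<N}. diag_moment (K \<times> {..<N}) A p x \<le> D"
  obtains m F u where "large_system K N A c m F u" and "\<nexists>F' u'. large_system K N A c (Suc m) F' u'"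
proof -
  define M where "M = nat \<lceil>real (card K * N) * D / c ^ (2 * p)\<rceil>"
  have "m < Suc M" if "\<exists>F u. large_system K N A c m F u" for m
  proof -
    have "real m * c ^ (2 * p) \<le> real (card K * N) * D"
      using that large_system_card_le[OF assms(1) less_imp_le[OF assms(2)] _ moment] by blast
    then have "real m \<le> real (card K * N) * D / c ^ (2 * p)"
      using \<open>c > 0\<close> by (simp add: pos_le_divide_eq)
    then show ?thesis
      unfolding M_def by linarith
  qed
  moreover have "\<exists>F u. large_system K N A c 0 F u"
    by (intro exI[of _ "{}"]) (simp add: large_system_def corthonormal_def)
  ultimately obtain m F u where "large_system K N A c m F u"
    and "\<And>m'. \<exists>F u. large_system K N A c m' F u \<Longrightarrow> m' \<le> m"
    using ex_has_greatest_nat[of "\<lambda>m. \<exists>F u. large_system K N A c m F u" 0 "\<lambda>m. m" "Suc M"] by blast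
  then show ?thesis
    using that Suc_n_not_le_n by blast
qed

text \<open>
  A maximal system of orthonormal vectors on which \<open>A\<^sup>*\<close> is large, each new one chosen in the tensor
  product with the orthogonal complement of all the rows used so far, leaves a small set \<open>F\<close> off
  which \<open>A\<^sup>*\<close> is bounded.
\<close>

lemma exceptional_subspace:
  fixes K :: "'b set" and N :: nat
  defines "I \<equiv> K \<times> {..<N}"
  assumes "finite K" "c > 0" and moment: "\<forall>x\<in>I. diag_moment I A p x \<le> D"
  obtains F where "corthonormal (\<lambda>f. f) F" and "F \<subseteq> range (evec N)"
    and "real (card F) * c ^ (2 * p) \<le> (real (card K))\<^sup>2 * real N * D"
    and "\<forall>v. (\<forall>a\<in>K. \<forall>f\<in>F. cinner f (row_vec N v a) = 0) \<longrightarrow>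
      sqnorm I (mat_vec I (adjoint_mat A) v) \<le> c * sqnorm I v"
proof -
  obtain m F u where system: "large_system K N A c m F u"
    and maximal: "\<nexists>F' u'. large_system K N A c (Suc m) F' u'"
    by (rule large_system_maximal[OF assms(2,3) moment[unfolded I_def]])
  from system have basis: "corthonormal (\<lambda>f. f) F" "F \<subseteq> range (evec N)" and "card F \<le> card K * m"
    by (simp_all add: large_system_def)
  then have "real (card F) * c ^ (2 * p) \<le> real (card K) * real m * c ^ (2 * p)"
    using \<open>c > 0\<close> by (intro mult_right_mono) (simp_all flip: of_nat_mult)
  also have "\<dots> \<le> real (card K) * (real (card K * N) * D)"
    using large_system_card_le[OF \<open>finite K\<close> _ system moment[unfolded I_def]] \<open>c > 0\<close>
    unfolding mult.assoc by (intro mult_left_mono) simp_all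
  finally have card: "real (card F) * c ^ (2 * p) \<le> (real (card K))\<^sup>2 * real N * D"
    by (simp add: power2_eq_square mult_ac)
  have "\<forall>v. (\<forall>a\<in>K. \<forall>f\<in>F. cinner f (row_vec N v a) = 0) \<longrightarrow>
      sqnorm I (mat_vec I (adjoint_mat A) v) \<le> c * sqnorm I v"
    using large_system_extend[OF \<open>finite K\<close> system, folded I_def] maximal by (meson not_le)
  with basis card show ?thesis
    by (rule that)
qed

definition compl_proj :: "ell2 set \<Rightarrow> nat \<Rightarrow> nat \<Rightarrow> complex" where
  "compl_proj F s t = (if s = t then 1 else 0) - (\<Sum>f\<in>F. ell2_nth f s * cnj (ell2_nth f t))"

lemma adjoint_compl_proj: "adjoint_mat (compl_proj F) = compl_proj F"
  by (auto simp: fun_eq_iff adjoint_mat_def compl_proj_def mult.commute)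

lemma evec_mat_vec_compl_proj:
  assumes "F \<subseteq> range (evec N)"
  shows "evec N (mat_vec {..<N} (compl_proj F) g) = evec N g - cproj (\<lambda>f. f) F (evec N g)"
proof -
  define h where "h = evec N g - cproj (\<lambda>f. f) F (evec N g)"
  have "h \<in> range (evec N)"
    unfolding h_def using assms
    by (intro csubspace_diff csubspace_cproj csubspace_range_evec) auto
  then have "h = evec N (ell2_nth h)"
    by (auto simp: evec_ell2_nth_evec)
  also have "\<dots> = evec N (mat_vec {..<N} (compl_proj F) g)"
  proof (rule evec_cong)
    fix s assume s_less: "s < N"
    have "cinner f (evec N g) = (\<Sum>t<N. cnj (ell2_nth f t) * g t)" if "f \<in> F" for f
      using assms that by (auto simp: cinner_evec_evec evec.rep_eq)
    then have "ell2_nth h s = g s - (\<Sum>f\<in>F. (\<Sum>t<N. cnj (ell2_nth f t) * g t) * ell2_nth f s)"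
      using s_less
      by (simp add: h_def cproj_def ell2_nth_diff ell2_nth_sum ell2_nth_scaleC evec.rep_eq)
    also have "(\<Sum>f\<in>F. (\<Sum>t<N. cnj (ell2_nth f t) * g t) * ell2_nth f s) =
        (\<Sum>t<N. (\<Sum>f\<in>F. ell2_nth f s * cnj (ell2_nth f t)) * g t)"
      unfolding sum_distrib_right by (subst sum.swap) (simp add: mult_ac)
    also have "g s = (\<Sum>t<N. (if s = t then 1 else 0) * g t)"
      using s_less by (simp add: if_distrib[of "\<lambda>c. c * g _"] cong: if_cong)
    finally show "ell2_nth h s = mat_vec {..<N} (compl_proj F) g s"
      by (simp add: mat_vec_def compl_proj_def left_diff_distrib sum_subtractf)
  qed
  finally show ?thesis by (simp add: h_def)
qed

lemma opnorm_le_compl_proj: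
  assumes "corthonormal (\<lambda>f. f) F" "F \<subseteq> range (evec N)"
  shows "opnorm_le {..<N} {..<N} (compl_proj F) 1"
  unfolding opnorm_le_def sqnorm_evec evec_mat_vec_compl_proj[OF assms(2)]
  using norm_diff_cproj_le[OF assms(1)] by (simp add: power_mono)

lemma hs_sqnorm_compl_proj:
  assumes basis: "corthonormal (\<lambda>f. f) F" "F \<subseteq> range (evec N)"
  shows "hs_sqnorm {..<N} (compl_proj F) = real N - real (card F)"
proof -
  have column: "compl_proj F s t = mat_vec {..<N} (compl_proj F) (unit_vec t) s" if "t < N" for s t
    using that by (simp add: mat_vec_def unit_vec_def if_distrib[of "\<lambda>c. _ * c"] cong: if_cong)
  have "hs_sqnorm {..<N} (compl_proj F) = (\<Sum>t<N. sqnorm {..<N} (\<lambda>s. compl_proj F s t))"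
    unfolding hs_sqnorm_def sqnorm_def by (rule sum.swap)
  also have "\<dots> = (\<Sum>t<N. 1 - (\<Sum>f\<in>F. (cmod (ell2_nth f t))\<^sup>2))"
  proof (rule sum.cong)
    fix t assume t_mem: "t \<in> {..<N}"
    have coeff: "cinner f (evec N (unit_vec t)) = cnj (ell2_nth f t)" if "f \<in> F" for f
    proof -
      obtain g where f_eq: "f = evec N g" using basis(2) \<open>f \<in> F\<close> by auto
      show ?thesis
        using t_mem finner_unit_vec[of "{..<N}" t g]
        by (simp add: f_eq cinner_evec_evec finner_def evec.rep_eq)
    qed
    have "sqnorm {..<N} (\<lambda>s. compl_proj F s t) =
        (norm (evec N (unit_vec t) - cproj (\<lambda>f. f) F (evec N (unit_vec t))))\<^sup>2"
      using t_mem by (simp add: column sqnorm_evec evec_mat_vec_compl_proj[OF basis(2)])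
    also have "\<dots> = 1 - (\<Sum>f\<in>F. (cmod (ell2_nth f t))\<^sup>2)"
      using cproj_Pythagoras[OF basis(1), of "evec N (unit_vec t)"] sqnorm_unit_vec[of "{..<N}" t]
        t_mem
      by (simp add: coeff flip: sqnorm_evec)
    finally show "sqnorm {..<N} (\<lambda>s. compl_proj F s t) = 1 - (\<Sum>f\<in>F. (cmod (ell2_nth f t))\<^sup>2)" .
  qed simp
  also have "\<dots> = real N - (\<Sum>f\<in>F. \<Sum>t<N. (cmod (ell2_nth f t))\<^sup>2)"
    by (simp add: sum_subtractf sum.swap[of _ F])
  also have "(\<Sum>f\<in>F. \<Sum>t<N. (cmod (ell2_nth f t))\<^sup>2) = (\<Sum>f\<in>F. 1)"
  proof (rule sum.cong)
    fix f assume f_mem: "f \<in> F"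
    then have "(\<Sum>t<N. (cmod (ell2_nth f t))\<^sup>2) = (norm f)\<^sup>2"
      using basis(2) by (auto simp: norm_evec_sq evec.rep_eq)
    then show "(\<Sum>t<N. (cmod (ell2_nth f t))\<^sup>2) = 1"
      using norm_corthonormal[OF basis(1) f_mem] by simp
  qed simp
  finally show ?thesis by simp
qed

lemma opnorm_le_kron_sum_compl_proj:
  fixes N :: nat and K :: "'b set"
  defines "I \<equiv> K \<times> {..<N}"
  assumes basis: "corthonormal (\<lambda>f. f) F" "F \<subseteq> range (evec N)"
    and bound: "\<forall>v. (\<forall>a\<in>K. \<forall>f\<in>F. cinner f (row_vec N v a) = 0) \<longrightarrow>
      sqnorm I (mat_vec I (adjoint_mat (kron_sum n X \<beta>)) v) \<le> r\<^sup>2 * sqnorm I v"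
  shows "opnorm_le I I (kron_sum n X (\<lambda>i. mat_mult {..<N} (compl_proj F) (\<beta> i))) r"
proof -
  define \<alpha> where "\<alpha> i = mat_mult {..<N} (compl_proj F) (\<beta> i)" for i
  have "opnorm_le I I (adjoint_mat (kron_sum n X \<alpha>)) r"
    unfolding opnorm_le_def
  proof
    fix h :: "'b \<times> nat \<Rightarrow> complex"
    define v where "v y = mat_vec {..<N} (compl_proj F) (\<lambda>t. h (fst y, t)) (snd y)" for y
    have row_eq: "row_vec N v a = row_vec N h a - cproj (\<lambda>f. f) F (row_vec N h a)" for a
      by (simp add: row_vec_def v_def evec_mat_vec_compl_proj[OF basis(2)])
    have "mat_vec I (adjoint_mat (kron_sum n X \<alpha>)) h (a, s) =
        mat_vec I (adjoint_mat (kron_sum n X \<beta>)) v (a, s)" for a s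
      unfolding adjoint_kron_sum \<alpha>_def adjoint_mat_mult adjoint_compl_proj I_def
        mat_vec_kron_sum_mat_mult
        v_def ..
    then have "sqnorm I (mat_vec I (adjoint_mat (kron_sum n X \<alpha>)) h) =
        sqnorm I (mat_vec I (adjoint_mat (kron_sum n X \<beta>)) v)"
      by (intro sqnorm_cong) auto
    also have "\<dots> \<le> r\<^sup>2 * sqnorm I v"
      by (rule bound[rule_format]) (simp add: row_eq cinner_diff_cproj[OF basis(1)])
    also have "\<dots> \<le> r\<^sup>2 * sqnorm I h"
      unfolding I_def sqnorm_row_vec row_eq
      by (intro mult_left_mono sum_mono power_mono norm_diff_cproj_le basis(1)) simp_all
    finally show "sqnorm I (mat_vec I (adjoint_mat (kron_sum n X \<alpha>)) h) \<le> r\<^sup>2 * sqnorm I h" .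
  qed
  from opnorm_le_adjoint[OF this] show ?thesis
    by (simp add: \<alpha>_def[abs_def])
qed

lemma exists_mult_power_le:
  fixes q \<epsilon> C :: real
  assumes "0 \<le> q" "q < 1" "\<epsilon> > 0"
  shows "\<exists>p. C * q ^ p \<le> \<epsilon>"
proof -
  have "(\<lambda>p. C * q ^ p) \<longlonglongrightarrow> C * 0"
    using assms by (intro tendsto_intros LIMSEQ_realpow_zero)
  then have "\<forall>\<^sub>F p in sequentially. C * q ^ p < \<epsilon>"
    using assms(3) by (intro order_tendstoD(2)) simp_all
  then show ?thesis
    using eventually_happens'[OF sequentially_bot] less_imp_le by blast
qed

lemma permutation_model_exceptional_subspace:
  fixes k n :: nat
  assumes r_less: "0 \<le> r\<^sub>0" "r\<^sub>0 < r" and "\<epsilon> > 0"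
    and tree_bound: "\<And>L. opnorm_le ({..<k} \<times> reduced_words n L) ({..<k} \<times> reduced_words n L)
      (kron_sum n X (graph_mat reduced_Cons)) r\<^sub>0"
  obtains N :: nat and \<pi> F where "N > 0" and "\<forall>i. bij_betw (\<pi> i) {..<N} {..<N}"
    and "corthonormal (\<lambda>f. f) F" and "F \<subseteq> range (evec N)" and "real (card F) \<le> \<epsilon> * real N"
    and "\<forall>v. (\<forall>a\<in>{..<k}. \<forall>f\<in>F. cinner f (row_vec N v a) = 0) \<longrightarrow>
      sqnorm ({..<k} \<times> {..<N})
        (mat_vec ({..<k} \<times> {..<N}) (adjoint_mat (kron_sum n X (graph_mat \<pi>))) v)
        \<le> r\<^sup>2 * sqnorm ({..<k} \<times> {..<N}) v"
proof -
  obtain p where small: "(real k)\<^sup>2 * ((r\<^sub>0 / r) ^ 4) ^ p \<le> \<epsilon>"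
    using exists_mult_power_le[of "(r\<^sub>0 / r) ^ 4" \<epsilon> "(real k)\<^sup>2"] r_less \<open>\<epsilon> > 0\<close>
    by (auto simp: power_less_one_iff)
  obtain N :: nat and \<pi> where "N > 0" and perm: "\<forall>i. bij_betw (\<pi> i) {..<N} {..<N}"
    and moment: "\<forall>x\<in>{..<k} \<times> {..<N}.
      diag_moment ({..<k} \<times> {..<N}) (kron_sum n X (graph_mat \<pi>)) p x \<le> (r\<^sub>0 ^ (2 * p))\<^sup>2"
    by (rule finite_permutation_model[where p = p, OF tree_bound])
  have "r\<^sup>2 > 0" using r_less by simp
  obtain F where basis: "corthonormal (\<lambda>f. f) F" "F \<subseteq> range (evec N)"
    and card: "real (card F) * (r\<^sup>2) ^ (2 * p) \<le>
        (real (card {..<k}))\<^sup>2 * real N * (r\<^sub>0 ^ (2 * p))\<^sup>2"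
    and bound: "\<forall>v. (\<forall>a\<in>{..<k}. \<forall>f\<in>F. cinner f (row_vec N v a) = 0) \<longrightarrow>
      sqnorm ({..<k} \<times> {..<N})
        (mat_vec ({..<k} \<times> {..<N}) (adjoint_mat (kron_sum n X (graph_mat \<pi>))) v)
        \<le> r\<^sup>2 * sqnorm ({..<k} \<times> {..<N}) v"
    by (rule exceptional_subspace[OF finite_lessThan \<open>r\<^sup>2 > 0\<close> moment])
  have "real (card F) * (r ^ 4) ^ p \<le> (real k)\<^sup>2 * real N * (r\<^sub>0 ^ 4) ^ p"
    using card by (simp flip: power_mult)
  then have "real (card F) \<le> (real k)\<^sup>2 * real N * (r\<^sub>0 ^ 4) ^ p / (r ^ 4) ^ p"
    using r_less by (simp add: pos_le_divide_eq)
  also have "\<dots> = (real k)\<^sup>2 * ((r\<^sub>0 / r) ^ 4) ^ p * real N"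
    by (simp add: power_divide)
  also have "\<dots> \<le> \<epsilon> * real N"
    using small by (rule mult_right_mono) simp
  finally have "real (card F) \<le> \<epsilon> * real N" .
  from \<open>N > 0\<close> perm basis this bound show ?thesis
    by (rule that)
qed

lemma matrix_model:
  fixes k n :: nat
  assumes r_less: "0 \<le> r\<^sub>0" "r\<^sub>0 < r" and "\<epsilon> > 0"
    and tree_bound: "\<And>L. opnorm_le ({..<k} \<times> reduced_words n L) ({..<k} \<times> reduced_words n L)
      (kron_sum n X (graph_mat reduced_Cons)) r\<^sub>0"
  obtains N :: nat and \<alpha> where "N > 0"
    and "opnorm_le ({..<k} \<times> {..<N}) ({..<k} \<times> {..<N}) (kron_sum n X \<alpha>) r"
    and "\<forall>i<n. opnorm_le {..<N} {..<N} (\<alpha> i) 1"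
    and "real n * real N * (1 - \<epsilon>) \<le> (\<Sum>i<n. hs_sqnorm {..<N} (\<alpha> i))"
proof -
  obtain N :: nat and \<pi> F where "N > 0" and perm: "\<forall>i. bij_betw (\<pi> i) {..<N} {..<N}"
    and basis: "corthonormal (\<lambda>f. f) F" "F \<subseteq> range (evec N)" and card: "real (card F) \<le> \<epsilon> * real N"
    and bound: "\<forall>v. (\<forall>a\<in>{..<k}. \<forall>f\<in>F. cinner f (row_vec N v a) = 0) \<longrightarrow>
      sqnorm ({..<k} \<times> {..<N})
        (mat_vec ({..<k} \<times> {..<N}) (adjoint_mat (kron_sum n X (graph_mat \<pi>))) v)
        \<le> r\<^sup>2 * sqnorm ({..<k} \<times> {..<N}) v"
    by (rule permutation_model_exceptional_subspace[OF assms])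
  define \<alpha> where "\<alpha> i = mat_mult {..<N} (compl_proj F) (graph_mat \<pi> i)" for i
  have bounded: "opnorm_le ({..<k} \<times> {..<N}) ({..<k} \<times> {..<N}) (kron_sum n X \<alpha>) r"
    unfolding \<alpha>_def[abs_def] by (rule opnorm_le_kron_sum_compl_proj[OF basis bound])
  have contraction: "\<forall>i<n. opnorm_le {..<N} {..<N} (\<alpha> i) 1"
    using opnorm_le_mat_mult[OF opnorm_le_compl_proj[OF basis] opnorm_le_graph_mat] perm
    by (fastforce simp: \<alpha>_def)
  have "real n * (real N * (1 - \<epsilon>)) \<le> real n * (real N - real (card F))"
    using card by (intro mult_left_mono) (simp_all add: algebra_simps)
  then have "real n * real N * (1 - \<epsilon>) \<le> (\<Sum>i<n. hs_sqnorm {..<N} (\<alpha> i))"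
    using perm
    by (simp add: \<alpha>_def hs_sqnorm_mat_mult_graph_mat hs_sqnorm_compl_proj[OF basis] mult.assoc)
  with \<open>N > 0\<close> bounded contraction show ?thesis
    by (rule that)
qed

section \<open>Completely bounded isomorphisms\<close>

lemma operator_space_zero: "operator_space E \<Longrightarrow> 0 \<in> E"
  by (simp add: operator_space_def subspace_0)

lemma operator_space_scale_op: "operator_space E \<Longrightarrow> T \<in> E \<Longrightarrow> scale_op c T \<in> E"
  by (simp add: operator_space_def)

lemma operator_space_bop: "operator_space E \<Longrightarrow> T \<in> E \<Longrightarrow> T \<in> bop"
  by (auto simp: operator_space_def)

lemma operator_space_tensor_mat:
  assumes "operator_space E" "\<And>i. i < n \<Longrightarrow> \<theta> i \<in> E"
  shows "tensor_mat n \<theta> \<alpha> s t \<in> E"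
  unfolding tensor_mat_def using assms by (intro subspace_sum) (auto simp: operator_space_def)

lemma linear_iso_mem: "linear_iso E F u \<Longrightarrow> T \<in> E \<Longrightarrow> u T \<in> F"
  by (auto simp: linear_iso_def bij_betw_def)

lemma linear_iso_scale_op: "linear_iso E F u \<Longrightarrow> T \<in> E \<Longrightarrow> u (scale_op c T) = scale_op c (u T)"
  by (simp add: linear_iso_def)

lemma linear_iso_add: "linear_iso E F u \<Longrightarrow> S \<in> E \<Longrightarrow> T \<in> E \<Longrightarrow> u (S + T) = u S + u T"
  by (simp add: linear_iso_def)

lemma inv_into_linear_iso: "linear_iso E F u \<Longrightarrow> T \<in> E \<Longrightarrow> inv_into E u (u T) = T"
  by (simp add: linear_iso_def bij_betw_def)

lemma linear_iso_zero:
  assumes "operator_space E" "linear_iso E F u"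
  shows "u 0 = 0"
  using linear_iso_scale_op[OF assms(2) operator_space_zero[OF assms(1)], of 0] by simp

lemma linear_iso_nonzero:
  assumes "operator_space E" "linear_iso E F u" "T \<in> E" "T \<noteq> 0"
  shows "u T \<noteq> 0"
  using assms inv_into_linear_iso[OF assms(2)] linear_iso_zero[OF assms(1,2)]
    operator_space_zero[OF assms(1)] by metis

lemma linear_iso_inv_into:
  assumes space: "operator_space E" and iso: "linear_iso E F u"
  shows "linear_iso F E (inv_into E u)"
  unfolding linear_iso_def
proof (intro conjI ballI allI)
  have onto: "\<exists>S'\<in>E. S = u S'" if "S \<in> F" for S
    using iso that by (auto simp: linear_iso_def bij_betw_def)
  show "bij_betw (inv_into E u) F E"
    using iso by (simp add: linear_iso_def bij_betw_inv_into)
  fix S T assume "S \<in> F" "T \<in> F"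
  then obtain S' T' where preimages: "S' \<in> E" "S = u S'" "T' \<in> E" "T = u T'"
    using onto by blast
  then have "S' + T' \<in> E"
    using space by (simp add: operator_space_def subspace_add)
  then show "inv_into E u (S + T) = inv_into E u S + inv_into E u T"
    using preimages by (simp add: inv_into_linear_iso[OF iso] flip: linear_iso_add[OF iso])
next
  fix c T assume "T \<in> F"
  then obtain T' where preimage: "T' \<in> E" "T = u T'"
    using iso by (auto simp: linear_iso_def bij_betw_def)
  then show "inv_into E u (scale_op c T) = scale_op c (inv_into E u T)"
    using operator_space_scale_op[OF space preimage(1)]
    by (simp add: inv_into_linear_iso[OF iso] flip: linear_iso_scale_op[OF iso])
qed

lemma linear_iso_tensor_mat:
  assumes space: "operator_space E" and iso: "linear_iso E F u" and \<theta>_mem: "\<And>i. i < n \<Longrightarrow> \<theta> i \<in> E"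
  shows "u (tensor_mat n \<theta> \<alpha> s t) = tensor_mat n (\<lambda>i. u (\<theta> i)) \<alpha> s t"
  using \<theta>_mem
proof (induction n)
  case 0
  show ?case
    by (simp add: tensor_mat_def linear_iso_zero[OF space iso])
next
  case (Suc n)
  have "tensor_mat n \<theta> \<alpha> s t \<in> E"
    using Suc.prems by (intro operator_space_tensor_mat[OF space]) simp
  then show ?case
    using Suc
    by (simp add: tensor_mat_def linear_iso_add[OF iso] linear_iso_scale_op[OF iso]
        operator_space_scale_op[OF space])
qed

lemma mat_norm_cb_norm_less:
  assumes space: "operator_space E" and iso: "linear_iso E F u"
    and cb_norm_eq: "cb_norm E u = ennreal c" "c \<ge> 0"
    and x_mem: "\<And>i j. x i j \<in> E" and "k \<ge> 1" and less: "mat_norm k x < \<delta>"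
  shows "mat_norm k (\<lambda>i j. u (x i j)) \<le> c * \<delta>"
proof -
  have positive: "\<delta> > 0" using less mat_norm_nonneg[of k x] by linarith
  define y where "y i j = scale_op (of_real (1 / \<delta>)) (x i j)" for i j
  have "mat_norm k y \<le> cmod (of_real (1 / \<delta>)) * mat_norm k x"
    unfolding y_def by (rule mat_norm_scale_op)
  also have "\<dots> \<le> 1"
    using less positive by (simp add: norm_divide)
  finally have "y \<in> {x. (\<forall>i<k. \<forall>j<k. x i j \<in> E) \<and> mat_norm k x \<le> 1}"
    by (simp add: y_def operator_space_scale_op[OF space x_mem])
  then have "ennreal (mat_norm k (\<lambda>i j. u (y i j))) \<le> cb_norm E u"
    unfolding cb_norm_def using \<open>k \<ge> 1\<close> by (intro SUP_upper2[of k] SUP_upper) auto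
  then have "mat_norm k (\<lambda>i j. u (y i j)) \<le> c"
    using cb_norm_eq by simp
  have "u (x i j) = scale_op (of_real \<delta>) (u (y i j))" for i j
    unfolding y_def linear_iso_scale_op[OF iso x_mem] scale_op_scale_op
    using positive by (simp flip: of_real_mult)
  then have "mat_norm k (\<lambda>i j. u (x i j)) \<le> \<delta> * mat_norm k (\<lambda>i j. u (y i j))"
    using mat_norm_scale_op[of k "of_real \<delta>" "\<lambda>i j. u (y i j)"] positive by simp
  also have "\<dots> \<le> \<delta> * c"
    using \<open>mat_norm k (\<lambda>i j. u (y i j)) \<le> c\<close> positive by (intro mult_left_mono) simp_all
  finally show ?thesis
    by (simp add: mult.commute)
qed

lemma mat_norm_cb_norm_le:
  assumes "operator_space E" "linear_iso E F u" "cb_norm E u = ennreal c" "c \<ge> 0" "\<And>i j. x i j \<in> E"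
  shows "mat_norm k (\<lambda>i j. u (x i j)) \<le> c * mat_norm k x"
proof (cases "k = 0")
  case True
  then have "mat_norm k (\<lambda>i j. u (x i j)) \<le> 0"
    by (intro mat_norm_leI) (simp_all add: hsum_norm_def)
  also have "\<dots> \<le> c * mat_norm k x"
    using \<open>c \<ge> 0\<close> by simp
  finally show ?thesis .
next
  case False
  show ?thesis
  proof (rule field_le_epsilon)
    fix e :: real assume "e > 0"
    then have "mat_norm k (\<lambda>i j. u (x i j)) \<le> c * (mat_norm k x + e / (c + 1))"
      using \<open>c \<ge> 0\<close> False by (intro mat_norm_cb_norm_less[OF assms]) simp_all
    also have "\<dots> \<le> c * mat_norm k x + e"
      using \<open>e > 0\<close> \<open>c \<ge> 0\<close> by (simp add: distrib_left field_simps)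
    finally show "mat_norm k (\<lambda>i j. u (x i j)) \<le> c * mat_norm k x + e" .
  qed
qed

lemma cb_norm_nonzero:
  assumes space: "operator_space E" and iso: "linear_iso E F u" and T_nonzero: "T \<in> E" "T \<noteq> 0"
  shows "cb_norm E u \<noteq> 0"
proof
  assume "cb_norm E u = 0"
  then have "mat_norm 1 (\<lambda>i j. u T) \<le> 0 * mat_norm 1 (\<lambda>i j. T)"
    by (intro mat_norm_cb_norm_le[OF space iso]) (simp_all add: T_nonzero)
  then have "norm (u T) \<le> 0"
    using norm_le_mat_norm[OF zero_less_one zero_less_one, of "\<lambda>i j. u T"] by linarith
  then show False
    using linear_iso_nonzero[OF space iso T_nonzero] by simp
qed

section \<open>Distance of the operator Hilbert space to the compact operators\<close>

definition OH_family :: "nat \<Rightarrow> (nat \<Rightarrow> 'a::complex_hilbert \<Rightarrow>\<^sub>L 'a) \<Rightarrow> bool" where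
  "OH_family n \<theta> \<longleftrightarrow> (\<forall>N \<alpha>. mat_norm N (tensor_mat n \<theta> \<alpha>) =
     sqrt (mat_norm N (tensor_mat n (\<lambda>i. matop N (\<alpha> i)) (\<lambda>i s t. cnj (\<alpha> i s t)))))"

lemma is_OH_obtain_family:
  fixes E :: "('h::complex_hilbert \<Rightarrow>\<^sub>L 'h) set"
  assumes "is_OH n E"
  obtains \<theta> where "\<forall>i<n. \<theta> i \<in> E \<and> norm (\<theta> i) = 1" and "OH_family n \<theta>"
proof -
  obtain \<theta> :: "nat \<Rightarrow> 'h \<Rightarrow>\<^sub>L 'h" where space: "operator_space E"
    and E_range: "E = range (\<lambda>c. \<Sum>i<n. scale_op (c i) (\<theta> i))"
    and norm_eq: "\<And>c. norm (\<Sum>i<n. scale_op (c i) (\<theta> i)) = sqrt (\<Sum>i<n. (cmod (c i))\<^sup>2)"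
    and min_norm_eq: "\<And>a :: nat \<Rightarrow> ell2 \<Rightarrow>\<^sub>L ell2. \<forall>i<n. a i \<in> bop \<Longrightarrow>
      min_norm (map (\<lambda>i. (\<theta> i, a i)) [0..<n]) =
        sqrt (min_norm (map (\<lambda>i. (a i, conj_op (a i))) [0..<n]))"
    using assms unfolding is_OH_def by blast
  have unit: "\<theta> i \<in> E \<and> norm (\<theta> i) = 1" if "i < n" for i
  proof -
    have "(\<Sum>j<n. scale_op (unit_vec i j) (\<theta> j)) = (\<Sum>j<n. if j = i then \<theta> i else 0)"
      unfolding unit_vec_def by (intro sum.cong) auto
    then have "(\<Sum>j<n. scale_op (unit_vec i j) (\<theta> j)) = \<theta> i"
      using that by simp
    moreover have "(\<Sum>j<n. scale_op (unit_vec i j) (\<theta> j)) \<in> E"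
      unfolding E_range by (rule rangeI)
    moreover have "norm (\<Sum>j<n. scale_op (unit_vec i j) (\<theta> j)) = 1"
      using sqnorm_unit_vec[of "{..<n}" i] that by (simp add: norm_eq sqnorm_def)
    ultimately show ?thesis
      by (simp only: simp_thms)
  qed
  have "OH_family n \<theta>"
    unfolding OH_family_def
  proof (intro allI)
    fix N \<alpha>
    have "mat_norm N (tensor_mat n \<theta> \<alpha>) = min_norm (map (\<lambda>i. (\<theta> i, matop N (\<alpha> i))) [0..<n])"
      using unit operator_space_bop[OF space] by (intro min_norm_matop[symmetric]) blast
    also have "\<dots> = sqrt (min_norm (map (\<lambda>i. (matop N (\<alpha> i), conj_op (matop N (\<alpha> i)))) [0..<n]))"
      by (rule min_norm_eq) (simp add: matop_bop)
    finally show "mat_norm N (tensor_mat n \<theta> \<alpha>) =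
        sqrt (mat_norm N (tensor_mat n (\<lambda>i. matop N (\<alpha> i)) (\<lambda>i s t. cnj (\<alpha> i s t))))"
      by (simp add: min_norm_matop_conj)
  qed
  with unit show ?thesis
    using that by blast
qed

lemma OH_family_hs_sqnorm_le:
  assumes "OH_family n \<theta>" "N > 0"
  shows "sqrt ((\<Sum>i<n. hs_sqnorm {..<N} (\<alpha> i)) / real N) \<le> mat_norm N (tensor_mat n \<theta> \<alpha>)"
  using hs_sqnorm_le_mat_norm_conj[where n = n and \<alpha> = \<alpha> and N = N] assms
  by (simp add: OH_family_def pos_divide_le_eq mult.commute)

lemma opnorm_le_tensor_tree:
  assumes n_ge: "n \<ge> 2" and family: "OH_family n \<theta>" and x_bop: "\<forall>i<n. x i \<in> bop" and "C \<ge> 0"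
    and x_le: "\<And>N \<alpha>. mat_norm N (tensor_mat n x \<alpha>) \<le> C * mat_norm N (tensor_mat n \<theta> \<alpha>)"
  shows "opnorm_le ({..<k} \<times> reduced_words n L) ({..<k} \<times> reduced_words n L)
    (kron_sum n (\<lambda>i. op_entry (x i)) (graph_mat reduced_Cons)) (C * sqrt (2 * sqrt (real n - 1)))"
proof -
  define N where "N = card (reduced_words n L)"
  obtain e where bij: "bij_betw e {..<N} (reduced_words n L)"
    using ex_bij_betw_nat_finite[OF finite_reduced_words] by (auto simp: N_def atLeast0LessThan)
  define \<tau> where "\<tau> i s t = graph_mat reduced_Cons i (e s) (e t)" for i s t
  have "mat_norm N (tensor_mat n x \<tau>) \<le> C * mat_norm N (tensor_mat n \<theta> \<tau>)"
    by (rule x_le)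
  also have "\<dots> \<le> C * sqrt (2 * sqrt (real n - 1))"
    using family mat_norm_tree_conj_le[OF n_ge bij] \<open>C \<ge> 0\<close> unfolding OH_family_def \<tau>_def
    by (simp add: mult_left_mono)
  finally have bounded:
    "opnorm_le ({..<k} \<times> {..<N}) ({..<k} \<times> {..<N}) (kron_sum n (\<lambda>i. op_entry (x i)) \<tau>)
      (C * sqrt (2 * sqrt (real n - 1)))"
    using x_bop by (intro opnorm_le_mono[OF opnorm_le_op_entry] mat_norm_nonneg) simp_all
  have "kron_sum n (\<lambda>i. op_entry (x i)) \<tau> y z =
      kron_sum n (\<lambda>i. op_entry (x i)) (graph_mat reduced_Cons) (map_prod id e y)
        (map_prod id e z)" for y z
    by (simp add: kron_sum_def \<tau>_def)
  from opnorm_le_reindex[where A = "kron_sum n (\<lambda>i. op_entry (x i)) (graph_mat reduced_Cons)",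
      OF bij_betw_map_prod[OF bij_betw_id bij] this]
  show ?thesis
    using bounded by blast
qed

lemma exists_corner_close:
  fixes n :: nat
  assumes "\<forall>i<n. x i \<in> compact_ops" and "\<epsilon> > 0"
  shows "\<exists>k. \<forall>i<n. norm (x i - corner k (x i)) < \<epsilon>"
proof -
  have "\<forall>\<^sub>F k in sequentially. norm (x i - corner k (x i)) < \<epsilon>" if "i < n" for i
    using tendstoD[OF corner_tendsto[OF assms(1)[rule_format, OF that]] \<open>\<epsilon> > 0\<close>]
    by (simp add: dist_norm norm_minus_commute)
  then have "\<forall>\<^sub>F k in sequentially. \<forall>i\<in>{..<n}. norm (x i - corner k (x i)) < \<epsilon>"
    by (intro eventually_ball_finite) simp_all
  then show ?thesis
    using eventually_happens'[OF sequentially_bot] by fastforce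
qed

lemma sqrt_dim_le_approx:
  fixes x :: "nat \<Rightarrow> ell2 \<Rightarrow>\<^sub>L ell2"
  assumes n_ge: "n \<ge> 2" and family: "OH_family n \<theta>" and compact: "\<forall>i<n. x i \<in> compact_ops"
    and nonneg: "C\<^sub>1 \<ge> 0" "C\<^sub>2 \<ge> 0"
    and x_le: "\<And>N \<alpha>. mat_norm N (tensor_mat n x \<alpha>) \<le> C\<^sub>1 * mat_norm N (tensor_mat n \<theta> \<alpha>)"
    and \<theta>_le: "\<And>N \<alpha>. mat_norm N (tensor_mat n \<theta> \<alpha>) \<le> C\<^sub>2 * mat_norm N (tensor_mat n x \<alpha>)"
    and \<epsilon>_pos: "\<epsilon> > 0"
  shows "sqrt (real n * (1 - \<epsilon>)) \<le> C\<^sub>2 * (C\<^sub>1 * sqrt (2 * sqrt (real n - 1)) + \<epsilon> + real n * \<epsilon>)"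
proof -
  let ?r = "C\<^sub>1 * sqrt (2 * sqrt (real n - 1))"
  have x_bop: "\<forall>i<n. x i \<in> bop"
    using compact by (simp add: compact_ops_def)
  have r_less: "0 \<le> ?r" "?r < ?r + \<epsilon>"
    using nonneg n_ge \<epsilon>_pos by simp_all
  obtain k where corner_close: "\<forall>i<n. norm (x i - corner k (x i)) < \<epsilon>"
    using exists_corner_close[OF compact \<epsilon>_pos] by blast
  obtain N :: nat and \<alpha> where N_pos: "N > 0"
    and bounded: "opnorm_le ({..<k} \<times> {..<N}) ({..<k} \<times> {..<N}) (kron_sum n (\<lambda>i. op_entry (x i)) \<alpha>)
        (?r + \<epsilon>)"
    and contraction: "\<forall>i<n. opnorm_le {..<N} {..<N} (\<alpha> i) 1"
    and hs_ge: "real n * real N * (1 - \<epsilon>) \<le> (\<Sum>i<n. hs_sqnorm {..<N} (\<alpha> i))"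
    by (rule matrix_model[OF r_less \<epsilon>_pos
        opnorm_le_tensor_tree[OF n_ge family x_bop nonneg(1) x_le]])
  have "mat_norm N (tensor_mat n x \<alpha>) \<le>
      mat_norm N (tensor_mat n (\<lambda>i. corner k (x i)) \<alpha>) + (\<Sum>i<n. norm (x i - corner k (x i)))"
    using contraction x_bop by (intro mat_norm_tensor_mat_perturb corner_bop) simp_all
  also have "\<dots> \<le> (?r + \<epsilon>) + (\<Sum>i<n. \<epsilon>)"
    unfolding corner_def using corner_close r_less \<epsilon>_pos
    by (intro add_mono sum_mono mat_norm_matop_le[OF bounded]) (auto simp: corner_def less_imp_le)
  finally have perturbed: "mat_norm N (tensor_mat n x \<alpha>) \<le> ?r + \<epsilon> + real n * \<epsilon>"
    by simp
  have "real n * (1 - \<epsilon>) \<le> (\<Sum>i<n. hs_sqnorm {..<N} (\<alpha> i)) / real N"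
    using hs_ge N_pos by (simp add: pos_le_divide_eq mult_ac)
  then have "sqrt (real n * (1 - \<epsilon>)) \<le> mat_norm N (tensor_mat n \<theta> \<alpha>)"
    using OH_family_hs_sqnorm_le[OF family N_pos, of \<alpha>] real_sqrt_le_mono order_trans by blast
  also have "\<dots> \<le> C\<^sub>2 * mat_norm N (tensor_mat n x \<alpha>)"
    by (rule \<theta>_le)
  also have "\<dots> \<le> C\<^sub>2 * (?r + \<epsilon> + real n * \<epsilon>)"
    using perturbed nonneg(2) by (rule mult_left_mono)
  finally show ?thesis .
qed

lemma sqrt_dim_le:
  fixes x :: "nat \<Rightarrow> ell2 \<Rightarrow>\<^sub>L ell2"
  assumes n_ge: "n \<ge> 2" and family: "OH_family n \<theta>" and compact: "\<forall>i<n. x i \<in> compact_ops"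
    and nonneg: "C\<^sub>1 \<ge> 0" "C\<^sub>2 \<ge> 0"
    and x_le: "\<And>N \<alpha>. mat_norm N (tensor_mat n x \<alpha>) \<le> C\<^sub>1 * mat_norm N (tensor_mat n \<theta> \<alpha>)"
    and \<theta>_le: "\<And>N \<alpha>. mat_norm N (tensor_mat n \<theta> \<alpha>) \<le> C\<^sub>2 * mat_norm N (tensor_mat n x \<alpha>)"
  shows "sqrt (real n) \<le> C\<^sub>1 * C\<^sub>2 * sqrt (2 * sqrt (real n - 1))"
proof -
  let ?r = "C\<^sub>1 * sqrt (2 * sqrt (real n - 1))"
  have "sqrt (real n * (1 - 0)) \<le> C\<^sub>2 * (?r + 0 + real n * 0)"
  proof (rule tendsto_le[OF trivial_limit_at_right_real[of 0]])
    show "((\<lambda>\<epsilon>. C\<^sub>2 * (?r + \<epsilon> + real n * \<epsilon>)) \<longlongrightarrow> C\<^sub>2 * (?r + 0 + real n * 0)) (at_right 0)"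
      by (intro tendsto_intros)
    show "((\<lambda>\<epsilon>. sqrt (real n * (1 - \<epsilon>))) \<longlongrightarrow> sqrt (real n * (1 - 0))) (at_right 0)"
      by (intro tendsto_intros)
    show "\<forall>\<^sub>F \<epsilon> in at_right 0. sqrt (real n * (1 - \<epsilon>)) \<le> C\<^sub>2 * (?r + \<epsilon> + real n * \<epsilon>)"
      by (rule eventually_at_right_less[THEN eventually_mono]) (rule sqrt_dim_le_approx[OF assms])
  qed
  then show ?thesis by (simp add: mult_ac)
qed

lemma OH_cb_norm_real_ge:
  fixes F :: "(ell2 \<Rightarrow>\<^sub>L ell2) set"
  assumes "n \<ge> 2" and OH: "is_OH n E"
    and compact_space: "operator_space F" "F \<subseteq> compact_ops" and iso: "linear_iso E F u"
    and cb_norm_eq: "cb_norm E u = ennreal C\<^sub>1" "cb_norm F (inv_into E u) = ennreal C\<^sub>2" "C\<^sub>1 \<ge> 0"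
      "C\<^sub>2 \<ge> 0"
  shows "sqrt (real n) \<le> C\<^sub>1 * C\<^sub>2 * sqrt (2 * sqrt (real n - 1))"
proof -
  have space: "operator_space E" using OH by (simp add: is_OH_def)
  obtain \<theta> where "\<forall>i<n. \<theta> i \<in> E \<and> norm (\<theta> i) = 1" and family: "OH_family n \<theta>"
    using is_OH_obtain_family[OF OH] by blast
  then have \<theta>_mem: "\<theta> i \<in> E" if "i < n" for i
    using that by blast
  let ?x = "\<lambda>i. u (\<theta> i)"
  have tensor_mem: "tensor_mat n \<theta> \<alpha> s t \<in> E" for \<alpha> s t
    by (rule operator_space_tensor_mat[OF space \<theta>_mem])
  have u_tensor: "u (tensor_mat n \<theta> \<alpha> s t) = tensor_mat n ?x \<alpha> s t" for \<alpha> s t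
    by (rule linear_iso_tensor_mat[OF space iso \<theta>_mem])
  show ?thesis
  proof (rule sqrt_dim_le[where x = ?x, OF \<open>n \<ge> 2\<close> family _ cb_norm_eq(3,4)])
    show "\<forall>i<n. u (\<theta> i) \<in> compact_ops"
      using compact_space(2) linear_iso_mem[OF iso \<theta>_mem] by blast
    show "mat_norm N (tensor_mat n ?x \<alpha>) \<le> C\<^sub>1 * mat_norm N (tensor_mat n \<theta> \<alpha>)" for N \<alpha>
      using mat_norm_cb_norm_le[OF space iso cb_norm_eq(1,3), of "tensor_mat n \<theta> \<alpha>" N]
      by (simp add: tensor_mem u_tensor)
    show "mat_norm N (tensor_mat n \<theta> \<alpha>) \<le> C\<^sub>2 * mat_norm N (tensor_mat n ?x \<alpha>)" for N \<alpha>
      using mat_norm_cb_norm_le[OF compact_space(1) linear_iso_inv_into[OF space iso]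
          cb_norm_eq(2,4), of "tensor_mat n ?x \<alpha>" N]
        inv_into_linear_iso[OF iso tensor_mem] linear_iso_mem[OF iso tensor_mem]
      by (simp add: u_tensor)
  qed
qed

lemma OH_cb_norm_nonzero:
  assumes "n \<ge> 1" and OH: "is_OH n E" and codomain: "operator_space F" and iso: "linear_iso E F u"
  shows "cb_norm E u \<noteq> 0" and "cb_norm F (inv_into E u) \<noteq> 0"
proof -
  have space: "operator_space E" using OH by (simp add: is_OH_def)
  obtain \<theta> where "\<forall>i<n. \<theta> i \<in> E \<and> norm (\<theta> i) = 1"
    using is_OH_obtain_family[OF OH] by blast
  then have "\<theta> 0 \<in> E" "norm (\<theta> 0) = 1"
    using \<open>n \<ge> 1\<close> by simp_all
  then have nonzero: "\<theta> 0 \<in> E" "\<theta> 0 \<noteq> 0"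
    by auto
  then show "cb_norm E u \<noteq> 0"
    by (rule cb_norm_nonzero[OF space iso])
  show "cb_norm F (inv_into E u) \<noteq> 0"
    using cb_norm_nonzero[OF codomain linear_iso_inv_into[OF space iso]] linear_iso_mem[OF iso]
      linear_iso_nonzero[OF space iso]
      nonzero by blast
qed

lemma OH_cb_norm_mult_ge:
  fixes F :: "(ell2 \<Rightarrow>\<^sub>L ell2) set"
  assumes "n \<ge> 2" "is_OH n E" "operator_space F" "F \<subseteq> compact_ops" "linear_iso E F u"
  shows "ennreal (sqrt (real n / (2 * sqrt (real n - 1)))) \<le> cb_norm E u * cb_norm F (inv_into E u)"
proof (cases "cb_norm E u = top \<or> cb_norm F (inv_into E u) = top")
  case True
  then show ?thesis
    using OH_cb_norm_nonzero[OF _ assms(2,3,5)] \<open>n \<ge> 2\<close>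
    by (auto simp: ennreal_top_mult ennreal_mult_top)
next
  case False
  then obtain C\<^sub>1 C\<^sub>2 where cb_norm_eq: "cb_norm E u = ennreal C\<^sub>1"
    "cb_norm F (inv_into E u) = ennreal C\<^sub>2"
    and nonneg: "C\<^sub>1 \<ge> 0" "C\<^sub>2 \<ge> 0"
    by (metis ennreal_cases top_neq_ennreal)
  have "sqrt (real n / (2 * sqrt (real n - 1))) \<le> C\<^sub>1 * C\<^sub>2"
    using OH_cb_norm_real_ge[OF assms cb_norm_eq nonneg] \<open>n \<ge> 2\<close>
    by (simp add: real_sqrt_divide pos_divide_le_eq)
  then show ?thesis
    unfolding cb_norm_eq ennreal_mult[OF nonneg, symmetric] by (rule ennreal_leI)
qed

theorem corollary10:
  fixes n :: nat and E :: "('h::complex_hilbert \<Rightarrow>\<^sub>L 'h) set"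
  assumes "n \<ge> 2" and "is_OH n E"
  shows "d_SK E \<ge> ennreal (sqrt (real n / (2 * sqrt (real n - 1))))"
proof -
  have "ennreal (sqrt (real n / (2 * sqrt (real n - 1)))) \<le> d_cb E F"
    if "operator_space F" "F \<subseteq> compact_ops" for F :: "(ell2 \<Rightarrow>\<^sub>L ell2) set"
    unfolding d_cb_def using OH_cb_norm_mult_ge[OF assms that] by (intro INF_greatest) simp
  then show ?thesis
    unfolding d_SK_def by (intro INF_greatest) simp
qed

end
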